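(* Let $\varepsilon_1,\varepsilon_2\in[0,1)$. (1) Let $s,\beta>a$. (a) There exists a constant $C>0$ such that for every measurable $S\subset\Omega$ with $0<\mu(S)<\infty$ and every $f\in L^2(\Omega,\mu)$ which is $\varepsilon_1$-concentrated on $S$, $$\mu(S)^{\frac{\beta}{a}}\,\||\xi|^{\beta}\mathcal{T}f\|_{2,\mu}^2\ge C\,(1-\varepsilon_1^2)^{\frac{\beta}{a}}\,\|f\|_{2,\mu}^2.$$ (b) There exists a constant $C>0$ such that for every measurable $\Sigma\subset\Omega$ with $0<\mu(\Sigma)<\infty$ and every $f\in L^2(\Omega,\mu)$ which is $\varepsilon_2$-bandlimited on $\Sigma$, $$\mu(\Sigma)^{\frac{s}{a}}\,\||x|^{s}f\|_{2,\mu}^2\ge C\,(1-\varepsilon_2^2)^{\frac{s}{a}}\,\|f\|_{2,\mu}^2.$$ (2) Let $s,\beta>0$. (a) There exists a constant $C>0$ such that for every measurable $S\subset\Omega$ with $0<\mu(S)<\infty$ and every $f\in L^1(\Omega,\mu)\cap L^2(\Omega,\mu)$ which is $\varepsilon_1$-timelimited on $S$, $$\mu(S)^{\frac{a+\beta}{2a}}\,\||\xi|^{\beta}\mathcal{T}f\|_{2,\mu}\ge C\,(1-\varepsilon_1)^{\frac{a+\beta}{a}}\,\|f\|_{1,\mu}.$$ (b) There exists a constant $C>0$ such that for every measurable $\Sigma\subset\Omega$ with $0<\mu(\Sigma)<\infty$ and every $f\in L^1(\Omega,\mu)\cap L^2(\Omega,\mu)$ which is $\varepsilon_2$-bandlimited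 on $\Sigma$, $$\mu(\Sigma)^{\frac{a+s}{2a}}\,\||x|^{s}f\|_{1,\mu}\ge C\,(1-\varepsilon_2^2)^{\frac{a+s}{2a}}\,\|f\|_{2,\mu}.$$
   Context: Setting: $\Omega\subset\mathbb{R}^d$ is a convex cone ($\lambda x\in\Omega$ for all $\lambda>0$, $x\in\Omega$) with non-empty interior, endowed with a Borel measure $\mu$, absolutely continuous with respect to Lebesgue measure, with polar decomposition $d\mu(r\zeta)=r^{2a-1}\,dr\,Q(\zeta)\,d\omega(\zeta)$, where $a>0$, $d\omega$ is the surface measure on the unit sphere $\mathbb{S}^{d-1}$, and $Q\in L^1(\mathbb{S}^{d-1},d\omega)$, $Q\ne 0$ (so $\mu$ is homogeneous of degree $2a$). $\|\cdot\|_{p,\mu}$ is the norm of $L^p(\Omega,\mu)$ and $\langle f,g\rangle_\mu=\int_\Omega f\overline{g}\,d\mu$. The kernel $\mathcal{K}:\Omega\times\Omega\to\mathbb{C}$ is continuous, bounded ($|\mathcal{K}(x,\xi)|\le c_{\mathcal{K}}$) and homogeneous ($\mathcal{K}(\lambda x,\xi)=\mathcal{K}(x,\lambda\xi)$ for $\lambda>0$). The operator $\mathcal{T}$ is $\mathcal{T}f(\xi)=\int_\Omega f(x)\mathcal{K}(x,\xi)\,d\mu(x)$. It is assumed that (i) (inversion) if $f,\mathcal{T}f\in L^1(\Omega,\mu)$ then $f$ is continuous and $f(x)=\int_\Omega\mathcal{T}f(\xi)\overline{\mathcal{K}(x,\xi)}\,d\mu(\xi)$ for almost every $x$; (ii)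 (Parseval) $\langle\mathcal{T}f,\mathcal{T}g\rangle_\mu=\langle f,g\rangle_\mu$ for Schwartz functions $f,g$ on $\Omega$; in particular $\mathcal{T}$ extends to a unitary operator of $L^2(\Omega,\mu)$ onto itself, with $\mathcal{T}^{-1}f=\overline{\mathcal{T}\overline{f}}$. Weighted norms may take the value $+\infty$. For measurable $A\subset\Omega$, $A^c=\Omega\setminus A$, $E_Af=\chi_Af$ and $F_Af=\mathcal{T}^{-1}[\chi_A\mathcal{T}f]$ (on $L^2(\Omega,\mu)$). For $0\le\varepsilon<1$: a nonzero $f\in L^2(\Omega,\mu)$ is $\varepsilon$-concentrated on $S$ if $\|E_{S^c}f\|_{2,\mu}\le\varepsilon\|f\|_{2,\mu}$; a nonzero $f\in L^1(\Omega,\mu)$ is $\varepsilon$-timelimited on $S$ if $\|E_{S^c}f\|_{1,\mu}\le\varepsilon\|f\|_{1,\mu}$; a nonzero $f\in L^2(\Omega,\mu)$ is $\varepsilon$-bandlimited on $\Sigma$ if $\|F_{\Sigma^c}f\|_{2,\mu}\le\varepsilon\|f\|_{2,\mu}$. Constants $C$ depend only on the setting ($\Omega,\mu,\mathcal{K}$) and the parameters, not on $f$, $S$, $\Sigma$. *)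

theory Defs
  imports "HOL-Analysis.Analysis"
begin

subsection \<open>Lebesgue spaces\<close>

text \<open>
  Norms are extended nonnegative reals, so that weighted norms may be infinite. Elements of
  \<open>L\<^sup>p(M)\<close> are represented by measurable functions, and equality in \<open>L\<^sup>p(M)\<close> is equality
  almost everywhere.
\<close>

definition Lp_norm :: "real \<Rightarrow> 'a measure \<Rightarrow> ('a \<Rightarrow> 'b::real_normed_vector) \<Rightarrow> ennreal" where
  "Lp_norm p M f =
     (let I = (\<integral>\<^sup>+ x. ennreal (norm (f x) powr p) \<partial>M)
      in if I = \<infinity> then \<infinity> else ennreal (enn2real I powr (1 / p)))"

definition Lp_space :: "real \<Rightarrow> 'a measure \<Rightarrow> ('a \<Rightarrow> complex) set" where
  "Lp_space p M = {f \<in> borel_measurable M. Lp_norm p M f < \<infinity>}"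

definition inner_L2 :: "'a measure \<Rightarrow> ('a \<Rightarrow> complex) \<Rightarrow> ('a \<Rightarrow> complex) \<Rightarrow> complex" where
  "inner_L2 M f g = (LINT x|M. f x * cnj (g x))"

lemma Lp_space_1_iff: "f \<in> Lp_space 1 M \<longleftrightarrow> integrable M f"
  by (auto simp: Lp_space_def Lp_norm_def Let_def integrable_iff_bounded top.not_eq_extremum)

lemma Lp_space_2_iff:
  "f \<in> Lp_space 2 M \<longleftrightarrow> f \<in> borel_measurable M \<and> integrable M (\<lambda>x. (norm (f x))\<^sup>2)"
  by (auto simp: Lp_space_def Lp_norm_def Let_def integrable_iff_bounded top.not_eq_extremum)

subsection \<open>Surface measure on the unit sphere\<close>

text \<open>
  The surface measure of a Borel set \<open>A\<close> of unit vectors is \<open>d\<close> times the Lebesgue measure of the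
  cone \<open>{r\<zeta> | \<zeta> \<in> A, 0 < r \<le> 1}\<close>; this is the normalisation for which Lebesgue measure is
  \<open>r\<^bsup>d-1\<^esup> dr d\<omega>(\<zeta>)\<close> in polar coordinates.
\<close>

definition sphere_measure :: "'a::euclidean_space measure" where
  "sphere_measure =
     scale_measure (ennreal (real DIM('a)))
       (distr (restrict_space lborel (cball 0 1 - {0})) (restrict_space borel (sphere 0 1)) sgn)"

lemma emeasure_sphere_measure:
  fixes A :: "'a::euclidean_space set"
  assumes "A \<in> sets borel" "A \<subseteq> sphere 0 1"
  shows "emeasure sphere_measure A =
    ennreal (real DIM('a)) * emeasure lborel {r *\<^sub>R z | r z. 0 < r \<and> r \<le> 1 \<and> z \<in> A}"
proof -
  let ?D = "cball 0 1 - {0} :: 'a set"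
  have D: "?D \<in> sets lborel" by auto
  have meas: "sgn \<in> restrict_space lborel ?D \<rightarrow>\<^sub>M restrict_space borel (sphere (0::'a) 1)"
  proof (rule measurable_restrict_space2)
    show "sgn \<in> space (restrict_space lborel ?D) \<rightarrow> sphere (0::'a) 1"
      by (auto simp: space_restrict_space norm_sgn)
    have "sgn \<in> borel_measurable (borel :: 'a measure)"
      unfolding sgn_div_norm[abs_def] by measurable
    then show "sgn \<in> borel_measurable (restrict_space lborel ?D)"
      by (intro measurable_restrict_space1) simp
  qed
  have A: "A \<in> sets (restrict_space borel (sphere 0 1))"
    using assms by (auto simp: sets_restrict_space image_iff intro!: bexI[of _ A])
  have eq: "sgn -` A \<inter> ?D = {r *\<^sub>R z | r z. 0 < r \<and> r \<le> 1 \<and> z \<in> A}" (is "?L = ?R")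
  proof
    show "?L \<subseteq> ?R"
    proof
      fix x assume x: "x \<in> ?L"
      then have "x = norm x *\<^sub>R sgn x" by (simp add: sgn_div_norm)
      with x show "x \<in> ?R" by (intro CollectI exI[of _ "norm x"] exI[of _ "sgn x"]) auto
    qed
    show "?R \<subseteq> ?L"
    proof
      fix x assume "x \<in> ?R"
      then obtain r z where x: "x = r *\<^sub>R z" "0 < r" "r \<le> 1" "z \<in> A" by blast
      with assms(2) have "norm z = 1" by auto
      with x show "x \<in> ?L" by (auto simp: sgn_div_norm)
    qed
  qed
  have sp: "space (restrict_space lborel ?D) = ?D"
    by (simp add: space_restrict_space)
  have "emeasure (distr (restrict_space lborel ?D) (restrict_space borel (sphere 0 1)) sgn) A
      = emeasure (restrict_space lborel ?D) (sgn -` A \<inter> ?D)"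
    using emeasure_distr[OF meas A] unfolding sp .
  also have "\<dots> = emeasure lborel (sgn -` A \<inter> ?D)"
    by (rule emeasure_restrict_space) (use D in auto)
  finally show ?thesis
    unfolding sphere_measure_def emeasure_scale_measure eq by simp
qed

subsection \<open>Schwartz functions\<close>

fun iterated_pderiv :: "'a list \<Rightarrow> ('a::euclidean_space \<Rightarrow> complex) \<Rightarrow> 'a \<Rightarrow> complex" where
  "iterated_pderiv [] f = f"
| "iterated_pderiv (b # bs) f = (\<lambda>x. frechet_derivative (iterated_pderiv bs f) (at x) b)"

definition schwartz :: "('a::euclidean_space \<Rightarrow> complex) \<Rightarrow> bool" where
  "schwartz f \<longleftrightarrow>
     (\<forall>bs. set bs \<subseteq> Basis \<longrightarrow>
        (\<forall>x. iterated_pderiv bs f differentiable at x) \<and>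
        (\<forall>k::nat. bounded (range (\<lambda>x. norm x ^ k *\<^sub>R iterated_pderiv bs f x))))"

subsection \<open>The integral operator and its extension to \<open>L\<^sup>2\<close>\<close>

definition int_transform ::
  "'a measure \<Rightarrow> ('a \<Rightarrow> 'a \<Rightarrow> complex) \<Rightarrow> ('a \<Rightarrow> complex) \<Rightarrow> 'a \<Rightarrow> complex" where
  "int_transform \<mu> K f \<xi> = (LINT x|\<mu>. f x * K x \<xi>)"

text \<open>
  The extension by continuity from the Schwartz functions. Under the Parseval identity the limit
  \<open>g\<close> exists for every \<open>f \<in> L\<^sup>2(\<mu>)\<close> and is unique up to a null set. A Schwartz function on a
  subset of the Euclidean space is the restriction of one on the whole space; since \<open>\<mu>\<close> will be a
  measure with space \<open>\<Omega>\<close>, only the values on \<open>\<Omega>\<close> matter here.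
\<close>

definition L2_transform ::
  "'a::euclidean_space measure \<Rightarrow> ('a \<Rightarrow> 'a \<Rightarrow> complex) \<Rightarrow> ('a \<Rightarrow> complex) \<Rightarrow> 'a \<Rightarrow> complex" where
  "L2_transform \<mu> K f =
     (SOME g. g \<in> Lp_space 2 \<mu> \<and>
        (\<exists>\<phi>::nat \<Rightarrow> 'a \<Rightarrow> complex. (\<forall>n. schwartz (\<phi> n)) \<and>
           (\<lambda>n. Lp_norm 2 \<mu> (\<lambda>x. \<phi> n x - f x)) \<longlonglongrightarrow> 0 \<and>
           (\<lambda>n. Lp_norm 2 \<mu> (\<lambda>\<xi>. int_transform \<mu> K (\<phi> n) \<xi> - g \<xi>)) \<longlonglongrightarrow> 0))"

definition L2_inv_transform ::
  "'a::euclidean_space measure \<Rightarrow> ('a \<Rightarrow> 'a \<Rightarrow> complex) \<Rightarrow> ('a \<Rightarrow> complex) \<Rightarrow> 'a \<Rightarrow> complex" where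
  "L2_inv_transform \<mu> K g =
     (SOME f. f \<in> Lp_space 2 \<mu> \<and> (AE \<xi> in \<mu>. L2_transform \<mu> K f \<xi> = g \<xi>))"

subsection \<open>The setting\<close>

text \<open>
  The measure \<open>\<mu>\<close> has space \<open>\<Omega>\<close> and the Borel sets of the subspace \<open>\<Omega>\<close>; the convex cone \<open>\<Omega>\<close> need
  not be a Borel set itself. The last assumption says that the isometric extension to \<open>L\<^sup>2(\<mu>)\<close> is
  onto, which the inversion formula and the Parseval identity do not imply: on the plane, with
  \<open>h(r e\<^bsup>it\<^esup>) = r e\<^bsup>2it\<^esup>\<close>, the kernel \<open>e\<^bsup>-i<x, h \<xi>>\<^esup> / (2 \<pi>)\<close> satisfies all the others.
\<close>

locale cone_transform =
  fixes \<Omega> :: "'a::euclidean_space set"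
    and \<mu> :: "'a measure"
    and a :: real
    and Q :: "'a \<Rightarrow> real"
    and K :: "'a \<Rightarrow> 'a \<Rightarrow> complex"
  assumes convex_cone: "convex \<Omega>" "\<And>x c. x \<in> \<Omega> \<Longrightarrow> c > 0 \<Longrightarrow> c *\<^sub>R x \<in> \<Omega>"
    and interior_nonempty: "interior \<Omega> \<noteq> {}"
    and space_mu: "space \<mu> = \<Omega>"
    and sets_mu: "sets \<mu> = sets (restrict_space borel \<Omega>)"
    and mu_abs_continuous: "\<And>N. N \<in> null_sets lborel \<Longrightarrow> N \<inter> \<Omega> \<in> null_sets \<mu>"
    and a_pos: "a > 0"
    and Q_integrable: "integrable sphere_measure Q"
    and Q_nonneg: "AE \<zeta> in sphere_measure. 0 \<le> Q \<zeta>"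
    and Q_nonzero: "\<not> (AE \<zeta> in sphere_measure. Q \<zeta> = 0)"
    and mu_polar: "\<And>B. B \<in> sets borel \<Longrightarrow>
      emeasure \<mu> (B \<inter> \<Omega>) =
        (\<integral>\<^sup>+ \<zeta>. (\<integral>\<^sup>+ r. indicator {0<..} r * indicator B (r *\<^sub>R \<zeta>) * ennreal (r powr (2 * a - 1)) \<partial>lborel)
              * ennreal (Q \<zeta>) \<partial>sphere_measure)"
    and K_continuous: "continuous_on (\<Omega> \<times> \<Omega>) (\<lambda>(x, \<xi>). K x \<xi>)"
    and K_bounded: "bounded ((\<lambda>(x, \<xi>). K x \<xi>) ` (\<Omega> \<times> \<Omega>))"
    and K_homogeneous:
      "\<And>c x \<xi>. c > 0 \<Longrightarrow> x \<in> \<Omega> \<Longrightarrow> \<xi> \<in> \<Omega> \<Longrightarrow> K (c *\<^sub>R x) \<xi> = K x (c *\<^sub>R \<xi>)"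
    and inversion:
      "\<And>f. f \<in> Lp_space 1 \<mu> \<Longrightarrow> int_transform \<mu> K f \<in> Lp_space 1 \<mu> \<Longrightarrow>
         (\<exists>g. continuous_on \<Omega> g \<and> (AE x in \<mu>. f x = g x)) \<and>
         (AE x in \<mu>. f x = (LINT \<xi>|\<mu>. int_transform \<mu> K f \<xi> * cnj (K x \<xi>)))"
    and parseval:
      "\<And>f g. schwartz f \<Longrightarrow> schwartz g \<Longrightarrow>
         inner_L2 \<mu> (int_transform \<mu> K f) (int_transform \<mu> K g) = inner_L2 \<mu> f g"
    and onto:
      "\<And>g. g \<in> Lp_space 2 \<mu> \<Longrightarrow>
         \<exists>f \<in> Lp_space 2 \<mu>. AE \<xi> in \<mu>. L2_transform \<mu> K f \<xi> = g \<xi>"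

subsection \<open>Localisation and concentration\<close>

definition E_op :: "'a set \<Rightarrow> ('a \<Rightarrow> complex) \<Rightarrow> 'a \<Rightarrow> complex" where
  "E_op A f = (\<lambda>x. indicator A x * f x)"

definition F_op ::
  "'a::euclidean_space measure \<Rightarrow> ('a \<Rightarrow> 'a \<Rightarrow> complex) \<Rightarrow> 'a set \<Rightarrow> ('a \<Rightarrow> complex) \<Rightarrow> 'a \<Rightarrow> complex"
  where "F_op \<mu> K A f = L2_inv_transform \<mu> K (\<lambda>\<xi>. indicator A \<xi> * L2_transform \<mu> K f \<xi>)"

definition concentrated :: "'a measure \<Rightarrow> real \<Rightarrow> 'a set \<Rightarrow> ('a \<Rightarrow> complex) \<Rightarrow> bool" where
  "concentrated \<mu> \<epsilon> S f \<longleftrightarrow>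
     f \<in> Lp_space 2 \<mu> \<and> \<not> (AE x in \<mu>. f x = 0) \<and>
     Lp_norm 2 \<mu> (E_op (space \<mu> - S) f) \<le> ennreal \<epsilon> * Lp_norm 2 \<mu> f"

definition timelimited :: "'a measure \<Rightarrow> real \<Rightarrow> 'a set \<Rightarrow> ('a \<Rightarrow> complex) \<Rightarrow> bool" where
  "timelimited \<mu> \<epsilon> S f \<longleftrightarrow>
     f \<in> Lp_space 1 \<mu> \<and> \<not> (AE x in \<mu>. f x = 0) \<and>
     Lp_norm 1 \<mu> (E_op (space \<mu> - S) f) \<le> ennreal \<epsilon> * Lp_norm 1 \<mu> f"

definition bandlimited ::
  "'a::euclidean_space measure \<Rightarrow> ('a \<Rightarrow> 'a \<Rightarrow> complex) \<Rightarrow> real \<Rightarrow> 'a set \<Rightarrow> ('a \<Rightarrow> complex) \<Rightarrow> bool"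
  where
  "bandlimited \<mu> K \<epsilon> S f \<longleftrightarrow>
     f \<in> Lp_space 2 \<mu> \<and> \<not> (AE x in \<mu>. f x = 0) \<and>
     Lp_norm 2 \<mu> (F_op \<mu> K (space \<mu> - S) f) \<le> ennreal \<epsilon> * Lp_norm 2 \<mu> f"

end

theory Submission
  imports Defs
begin

text \<open>
  All four inequalities come from one localisation argument. Homogeneity of the measure gives
  \<open>\<mu>(B\<^sub>r) \<le> \<kappa> r\<^bsup>2a\<^esup>\<close> for balls. Split the function that carries the weight at radius \<open>r\<close>: by
  Cauchy-Schwarz the part inside the ball is controlled in \<open>L\<^sup>1\<close> by \<open>r\<^sup>a\<close> times the \<open>L\<^sup>2\<close> norm, and
  boundedness of the kernel turns this into a supremum bound on the other side, which is integrated
  over the set of finite measure; the part outside the ball is at most a power of \<open>1/r\<close> times the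
  weighted norm. Optimising over \<open>r\<close> gives the stated powers of the measure. The powers of
  \<open>1 - \<epsilon>\<^sub>1\<close> and of \<open>1 - \<epsilon>\<^sub>i\<^sup>2\<close> are absorbed into the constants, which may depend on \<open>\<epsilon>\<^sub>1\<close> and \<open>\<epsilon>\<^sub>2\<close>.

  The extension to \<open>L\<^sup>2\<close> exists because Schwartz functions are dense in \<open>L\<^sup>1 \<inter> L\<^sup>2\<close>: products of
  Gaussians and hyperbolic tangents approximate indicators of boxes weighted by a Gaussian, and a
  Dynkin argument passes to all Borel sets.
\<close>

section \<open>Square integrals\<close>

text \<open>The kernel gives a supremum bound only for the forward integral
  \<open>int_transform\<close>. When the weight sits on \<open>f\<close> this is the right
  direction. When \<open>f\<close> is concentrated on \<open>S\<close> and the weight sits on the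
  transform, cutting the transform at radius \<open>r\<close> would call for a bounded inverse
  kernel. Duality avoids it: with \<open>h\<close> the restriction of \<open>f\<close> to
  \<open>S\<close>, the squared norm of \<open>h\<close> is the pairing of \<open>h\<close> with
  \<open>f\<close>, hence of their transforms, and the transform of \<open>h\<close> is bounded
  because \<open>h\<close> is integrable. In the timelimited case the transform is bounded by the
  very L1 norm to be estimated, so that norm occurs on both sides and is absorbed.

  The second obstacle is that \<open>L2_transform\<close> is a chosen limit: nothing is known about
  it before the limit is shown to exist, to be unique almost everywhere and to agree with the
  integral on functions in both L1 and L2. The agreement needs Schwartz approximants that converge
  in L1 and in L2 at once, so density is proved for the sum of both quantities. The Gaussian weight
  is there because \<open>\<mu>\<close> has infinite mass: constants and complements of boxes become
  integrable only after multiplication by it.\<close>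

definition sq_int :: "'a measure \<Rightarrow> ('a \<Rightarrow> 'b::real_normed_vector) \<Rightarrow> ennreal" where
  "sq_int M f = (\<integral>\<^sup>+ x. ennreal ((norm (f x))\<^sup>2) \<partial>M)"

lemma Lp_norm_1: "Lp_norm 1 M f = (\<integral>\<^sup>+ x. ennreal (norm (f x)) \<partial>M)"
  by (auto simp: Lp_norm_def Let_def less_top)

text \<open>Squaring removes the root and the case split on infinity and leaves a plain integral,
  which is additive over disjoint sets and open to the convergence theorems. The L2 estimates below
  are carried out for this square.\<close>

lemma Lp_norm_2_power2: "(Lp_norm 2 M f)\<^sup>2 = sq_int M f"
proof -
  define I where "I = (\<integral>\<^sup>+ x. ennreal (norm (f x) powr 2) \<partial>M)"
  have I: "I = sq_int M f"
    unfolding I_def sq_int_def by simp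
  show ?thesis
  proof (cases "I = \<infinity>")
    case True
    then have "Lp_norm 2 M f = \<infinity>"
      unfolding Lp_norm_def I_def[symmetric] by simp
    then show ?thesis
      using I True by (simp add: power2_eq_square ennreal_top_mult)
  next
    case False
    have "(ennreal (enn2real I powr (1 / 2)))\<^sup>2 = ennreal (enn2real I)"
      by (simp add: powr_half_sqrt ennreal_power)
    with False I show ?thesis
      unfolding Lp_norm_def I_def[symmetric] Let_def by (simp add: less_top)
  qed
qed

lemma ennreal_le_if_power2_le:
  fixes x y :: ennreal
  assumes "x\<^sup>2 \<le> y\<^sup>2"
  shows "x \<le> y"
proof (cases y)
  case (real b)
  then have "x \<noteq> top"
    using assms by (auto simp: power2_eq_square ennreal_top_mult ennreal_mult[symmetric] top_unique)
  then obtain a where a: "x = ennreal a" "0 \<le> a"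
    by (cases x) auto
  with real assms have "a\<^sup>2 \<le> b\<^sup>2"
    by (simp add: ennreal_power)
  then have "a \<le> b"
    using real(1) by (rule power2_le_imp_le)
  then show ?thesis
    using real a by (simp add: ennreal_leI)
qed simp

lemma ennreal_power2_le_iff: "x\<^sup>2 \<le> y\<^sup>2 \<longleftrightarrow> x \<le> y" for x y :: ennreal
  by (rule iffI[OF ennreal_le_if_power2_le power_mono]) auto

lemma Lp_norm_2_le_iff:
  assumes "0 \<le> c"
  shows "Lp_norm 2 M f \<le> ennreal c * Lp_norm 2 M' g \<longleftrightarrow> sq_int M f \<le> ennreal (c\<^sup>2) * sq_int M' g"
proof -
  have "(ennreal c * Lp_norm 2 M' g)\<^sup>2 = ennreal (c\<^sup>2) * sq_int M' g"
    using assms by (simp only: power_mult_distrib Lp_norm_2_power2 ennreal_power)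
  then show ?thesis
    by (metis Lp_norm_2_power2 ennreal_power2_le_iff)
qed

lemma Lp_space_2_iff_sq_int:
  "f \<in> Lp_space 2 M \<longleftrightarrow> f \<in> borel_measurable M \<and> sq_int M f < \<infinity>"
  by (auto simp: Lp_space_def Lp_norm_2_power2[symmetric] power2_eq_square ennreal_mult_less_top
      ennreal_mult_eq_top_iff less_top)

lemma tendsto_zero_ennreal_iff:
  fixes f :: "'b \<Rightarrow> ennreal"
  shows "(f \<longlongrightarrow> 0) F \<longleftrightarrow> (\<forall>e>0. eventually (\<lambda>n. f n < ennreal e) F)"
proof (intro iffI allI impI)
  fix e :: real assume "(f \<longlongrightarrow> 0) F" "e > 0"
  then show "eventually (\<lambda>n. f n < ennreal e) F"
    using order_tendstoD(2)[of f 0 F "ennreal e"] by simp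
next
  assume *: "\<forall>e>0. eventually (\<lambda>n. f n < ennreal e) F"
  show "(f \<longlongrightarrow> 0) F"
  proof (rule order_tendstoI)
    fix y :: ennreal assume "0 < y"
    then obtain z where z: "0 < z" "z < y" using dense by blast
    then obtain e where e: "z = ennreal e" "0 \<le> e" by (cases z) auto
    with z have "e > 0" by simp
    then have "eventually (\<lambda>n. f n < ennreal e) F" using * by blast
    then show "eventually (\<lambda>n. f n < y) F" by eventually_elim (use e z in auto)
  qed simp
qed

lemma Lp_norm_2_tendsto_0_iff:
  "((\<lambda>n. Lp_norm 2 M (u n)) \<longlongrightarrow> 0) F \<longleftrightarrow> ((\<lambda>n. sq_int M (u n)) \<longlongrightarrow> 0) F"
proof -
  have *: "Lp_norm 2 M (u n) < ennreal e \<longleftrightarrow> sq_int M (u n) < ennreal (e\<^sup>2)" if "e > 0" for e n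
  proof -
    have "ennreal e \<le> Lp_norm 2 M (u n) \<longleftrightarrow> (ennreal e)\<^sup>2 \<le> (Lp_norm 2 M (u n))\<^sup>2"
      by (rule ennreal_power2_le_iff[symmetric])
    then show ?thesis
      using that by (simp add: Lp_norm_2_power2 ennreal_power flip: not_le)
  qed
  show ?thesis
    unfolding tendsto_zero_ennreal_iff
  proof (intro iffI allI impI)
    fix e :: real
    assume "\<forall>e>0. eventually (\<lambda>n. Lp_norm 2 M (u n) < ennreal e) F" "e > 0"
    then have "eventually (\<lambda>n. Lp_norm 2 M (u n) < ennreal (sqrt e)) F" by simp
    then show "eventually (\<lambda>n. sq_int M (u n) < ennreal e) F"
      using *[of "sqrt e"] \<open>e > 0\<close> by simp
  next
    fix e :: real
    assume "\<forall>e>0. eventually (\<lambda>n. sq_int M (u n) < ennreal e) F" "e > 0"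
    then have "eventually (\<lambda>n. sq_int M (u n) < ennreal (e\<^sup>2)) F" by simp
    then show "eventually (\<lambda>n. Lp_norm 2 M (u n) < ennreal e) F"
      using * \<open>e > 0\<close> by simp
  qed
qed

lemma norm_add_power2_le: "(norm (x + y :: 'b::real_normed_vector))\<^sup>2 \<le> 2 * (norm x)\<^sup>2 + 2 * (norm y)\<^sup>2"
proof -
  have "(norm (x + y))\<^sup>2 \<le> (norm x + norm y)\<^sup>2"
    by (intro power_mono norm_triangle_ineq) simp
  also have "\<dots> \<le> 2 * (norm x)\<^sup>2 + 2 * (norm y)\<^sup>2"
    using sum_squares_bound[of "norm x" "norm y"] by (simp add: power2_sum)
  finally show ?thesis .
qed

lemma sq_int_add_le:
  fixes f g :: "'a \<Rightarrow> complex"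
  assumes [measurable]: "f \<in> borel_measurable M" "g \<in> borel_measurable M"
  shows "sq_int M (\<lambda>x. f x + g x) \<le> 2 * sq_int M f + 2 * sq_int M g"
proof -
  have "sq_int M (\<lambda>x. f x + g x)
      \<le> (\<integral>\<^sup>+ x. 2 * ennreal ((norm (f x))\<^sup>2) + 2 * ennreal ((norm (g x))\<^sup>2) \<partial>M)"
    unfolding sq_int_def
    using norm_add_power2_le
    by (intro nn_integral_mono)
       (simp add: ennreal_plus[symmetric] ennreal_mult'[symmetric] ennreal_numeral[symmetric]
          del: ennreal_plus ennreal_numeral)
  also have "\<dots> = 2 * sq_int M f + 2 * sq_int M g"
    unfolding sq_int_def by (simp add: nn_integral_add nn_integral_cmult)
  finally show ?thesis .
qed

lemma sq_int_cmult:
  fixes f :: "'a \<Rightarrow> complex"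
  assumes [measurable]: "f \<in> borel_measurable M"
  shows "sq_int M (\<lambda>x. c * f x) = ennreal ((norm c)\<^sup>2) * sq_int M f"
  unfolding sq_int_def norm_mult power_mult_distrib
  by (simp add: ennreal_mult nn_integral_cmult)

lemma sq_int_minus_commute: "sq_int M (\<lambda>x. f x - g x) = sq_int M (\<lambda>x. g x - f x)"
  unfolding sq_int_def by (simp add: norm_minus_commute)

lemma sq_int_cong_AE:
  assumes "AE x in M. norm (f x) = norm (g x)"
  shows "sq_int M f = sq_int M g"
  unfolding sq_int_def by (intro nn_integral_cong_AE) (use assms in auto)

lemma sq_int_eq_0_iff:
  fixes f :: "'a \<Rightarrow> complex"
  assumes [measurable]: "f \<in> borel_measurable M"
  shows "sq_int M f = 0 \<longleftrightarrow> (AE x in M. f x = 0)"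
  unfolding sq_int_def by (subst nn_integral_0_iff_AE) auto

lemma nn_integral_power2_le_sq_int:
  fixes f :: "'a \<Rightarrow> complex"
  assumes [measurable]: "f \<in> borel_measurable M" "A \<in> sets M"
  shows "(\<integral>\<^sup>+ x. ennreal (norm (f x)) * indicator A x \<partial>M)\<^sup>2 \<le> emeasure M A * sq_int M f"
proof -
  have "(\<integral>\<^sup>+ x. (indicator A x :: ennreal)\<^sup>2 \<partial>M) = (\<integral>\<^sup>+ x. indicator A x \<partial>M)"
    by (intro nn_integral_cong) (simp split: split_indicator)
  then show ?thesis
    using Cauchy_Schwarz_nn_integral[of "\<lambda>x. ennreal (norm (f x))" M "indicator A"]
    by (simp add: sq_int_def ennreal_power mult.commute)
qed

lemma sq_int_split:
  fixes f :: "'a \<Rightarrow> complex"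
  assumes [measurable]: "f \<in> borel_measurable M" "A \<in> sets M"
  shows "sq_int M f = sq_int M (\<lambda>x. indicator A x * f x) + sq_int M (\<lambda>x. indicator (space M - A) x * f x)"
proof -
  have "sq_int M f = (\<integral>\<^sup>+ x. ennreal ((norm (indicator A x * f x))\<^sup>2)
      + ennreal ((norm (indicator (space M - A) x * f x))\<^sup>2) \<partial>M)"
    unfolding sq_int_def by (intro nn_integral_cong) (auto split: split_indicator)
  also have "\<dots> = sq_int M (\<lambda>x. indicator A x * f x) + sq_int M (\<lambda>x. indicator (space M - A) x * f x)"
    unfolding sq_int_def by (rule nn_integral_add) measurable
  finally show ?thesis .
qed

lemma sq_int_indicator_le: "sq_int M (\<lambda>x. indicator A x * f x :: complex) \<le> sq_int M f"
  unfolding sq_int_def by (intro nn_integral_mono) (auto split: split_indicator)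

text \<open>Young's inequality with a free parameter \<open>t\<close>. The factor
  \<open>1 + t\<close> in front of \<open>f\<close> can be brought close to 1, as is required to
  carry an exact isometry through a limit; the factor 2 of \<open>sq_int_add_le\<close> is too
  coarse for that.\<close>

lemma sq_int_add_le_weighted:
  fixes f g :: "'a \<Rightarrow> complex"
  assumes [measurable]: "f \<in> borel_measurable M" "g \<in> borel_measurable M" and t: "t > 0"
  shows "sq_int M (\<lambda>x. f x + g x) \<le> ennreal (1 + t) * sq_int M f + ennreal (1 + 1 / t) * sq_int M g"
proof -
  have *: "(norm (x + y))\<^sup>2 \<le> (1 + t) * (norm x)\<^sup>2 + (1 + 1 / t) * (norm y)\<^sup>2" for x y :: complex
  proof -
    have "(norm (x + y))\<^sup>2 \<le> (norm x + norm y)\<^sup>2"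
      by (intro power_mono norm_triangle_ineq) simp
    also have "2 * (sqrt t * norm x) * (norm y / sqrt t) \<le> (sqrt t * norm x)\<^sup>2 + (norm y / sqrt t)\<^sup>2"
      by (rule sum_squares_bound)
    then have "(norm x + norm y)\<^sup>2 \<le> (1 + t) * (norm x)\<^sup>2 + (1 + 1 / t) * (norm y)\<^sup>2"
      using t by (simp add: power2_sum power_mult_distrib power_divide algebra_simps)
    finally show ?thesis .
  qed
  have "sq_int M (\<lambda>x. f x + g x)
      \<le> (\<integral>\<^sup>+ x. ennreal ((1 + t) * (norm (f x))\<^sup>2) + ennreal ((1 + 1 / t) * (norm (g x))\<^sup>2) \<partial>M)"
    unfolding sq_int_def
  proof (rule nn_integral_mono)
    fix x
    have "ennreal ((norm (f x + g x))\<^sup>2) \<le> ennreal ((1 + t) * (norm (f x))\<^sup>2 + (1 + 1 / t) * (norm (g x))\<^sup>2)"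
      by (intro ennreal_leI *)
    then show "ennreal ((norm (f x + g x))\<^sup>2)
        \<le> ennreal ((1 + t) * (norm (f x))\<^sup>2) + ennreal ((1 + 1 / t) * (norm (g x))\<^sup>2)"
      using t by (subst ennreal_plus[symmetric]) auto
  qed
  also have "\<dots> = ennreal (1 + t) * sq_int M f + ennreal (1 + 1 / t) * sq_int M g"
    unfolding sq_int_def using t
    by (subst nn_integral_add) (auto simp: ennreal_mult nn_integral_cmult simp del: ennreal_plus)
  finally show ?thesis .
qed

text \<open>Continuity of the norm under L2 limits, by the weighted inequality along the chain
  \<open>f\<close>, \<open>u n\<close>, \<open>v n\<close>, \<open>g\<close>. Exchanging the two
  sequences gives the opposite inequality.\<close>

lemma sq_int_le_of_limits:
  fixes u v :: "nat \<Rightarrow> 'a \<Rightarrow> complex" and f :: "'a \<Rightarrow> complex" and g :: "'a \<Rightarrow> complex"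
  assumes [measurable]: "\<And>n. u n \<in> borel_measurable M" "\<And>n. v n \<in> borel_measurable M"
      "f \<in> borel_measurable M" "g \<in> borel_measurable M"
    and eq: "\<And>n. sq_int M (v n) = sq_int M (u n)"
    and u: "(\<lambda>n. sq_int M (\<lambda>x. u n x - f x)) \<longlonglongrightarrow> 0"
    and v: "(\<lambda>n. sq_int M (\<lambda>x. v n x - g x)) \<longlonglongrightarrow> 0"
  shows "sq_int M g \<le> sq_int M f"
proof (cases "sq_int M f")
  case (real S)
  have le: "sq_int M g \<le> ennreal ((1 + t) * ((1 + t) * S + (1 + 1 / t) * t\<^sup>2) + (1 + 1 / t) * t\<^sup>2)"
    if t: "t > 0" for t :: real
  proof -
    \<comment> \<open>An error of size \<open>t^2\<close> leaves only \<open>(t + 1) * t\<close>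
      after multiplication by the large factor \<open>1 + 1 / t\<close>, and this still vanishes
      with \<open>t\<close>.\<close>
    from t have t2: "t\<^sup>2 > 0" by simp
    from u v t2 have "eventually (\<lambda>n. sq_int M (\<lambda>x. u n x - f x) < ennreal (t\<^sup>2)
        \<and> sq_int M (\<lambda>x. v n x - g x) < ennreal (t\<^sup>2)) sequentially"
      unfolding tendsto_zero_ennreal_iff by (intro eventually_conj) blast+
    then obtain n where n: "sq_int M (\<lambda>x. u n x - f x) < ennreal (t\<^sup>2)"
      "sq_int M (\<lambda>x. v n x - g x) < ennreal (t\<^sup>2)"
      unfolding eventually_sequentially by blast
    have "sq_int M (u n) = sq_int M (\<lambda>x. f x + (u n x - f x))" by simp
    also have "\<dots> \<le> ennreal (1 + t) * sq_int M f + ennreal (1 + 1 / t) * sq_int M (\<lambda>x. u n x - f x)"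
      by (rule sq_int_add_le_weighted[OF _ _ t]) measurable
    also have "\<dots> \<le> ennreal (1 + t) * ennreal S + ennreal (1 + 1 / t) * ennreal (t\<^sup>2)"
      using n(1) real by (intro add_mono mult_left_mono) auto
    also have "\<dots> = ennreal ((1 + t) * S + (1 + 1 / t) * t\<^sup>2)"
      using t real(1) by (subst ennreal_plus) (auto simp: ennreal_mult simp del: ennreal_plus)
    finally have A: "sq_int M (u n) \<le> ennreal ((1 + t) * S + (1 + 1 / t) * t\<^sup>2)" .
    have "sq_int M g = sq_int M (\<lambda>x. v n x + (g x - v n x))" by simp
    also have "\<dots> \<le> ennreal (1 + t) * sq_int M (v n) + ennreal (1 + 1 / t) * sq_int M (\<lambda>x. g x - v n x)"
      by (rule sq_int_add_le_weighted[OF _ _ t]) measurable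
    also have "\<dots> \<le> ennreal (1 + t) * ennreal ((1 + t) * S + (1 + 1 / t) * t\<^sup>2) + ennreal (1 + 1 / t) * ennreal (t\<^sup>2)"
      using n(2) A eq[of n] by (intro add_mono mult_left_mono) (auto simp: sq_int_minus_commute[of M g])
    also have "\<dots> = ennreal ((1 + t) * ((1 + t) * S + (1 + 1 / t) * t\<^sup>2) + (1 + 1 / t) * t\<^sup>2)"
      using t real(1) by (subst ennreal_plus) (auto simp: ennreal_mult simp del: ennreal_plus)
    finally show ?thesis .
  qed
  let ?b = "\<lambda>t::real. (1 + t) * ((1 + t) * S + (t + 1) * t) + (t + 1) * t"
  have "(?b \<longlongrightarrow> (1 + 0) * ((1 + 0) * S + (0 + 1) * 0) + (0 + 1) * 0) (at_right 0)"
    by (intro tendsto_intros)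
  then have "((\<lambda>t. ennreal (?b t)) \<longlongrightarrow> ennreal S) (at_right 0)"
    by (intro tendsto_ennrealI) simp
  then have "sq_int M g \<le> ennreal S"
  proof (rule tendsto_lowerbound)
    have "(1 + 1 / t) * t\<^sup>2 = (t + 1) * t" if "t > 0" for t :: real
      using that by (simp add: field_simps power2_eq_square)
    then show "\<forall>\<^sub>F t in at_right 0. sq_int M g \<le> ennreal (?b t)"
      using le by (auto simp: eventually_at_right_field intro!: exI[of _ 1])
  qed simp
  then show ?thesis using real by simp
qed simp

section \<open>Completeness of L2 along rapidly Cauchy sequences\<close>

text \<open>From \<open>2 * y \<le> y^2 + 1\<close> at \<open>y = 2 ^ n * u n\<close> comes
  \<open>u n \<le> 2 ^ n * (u n)^2 + (1/2) ^ n\<close>. This converts control of squares, which is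
  what L2 provides, into absolute summability.\<close>

lemma summable_if_suminf_power2_finite:
  fixes u :: "nat \<Rightarrow> real"
  assumes u: "\<And>n. 0 \<le> u n" and fin: "(\<Sum>n. ennreal (2 ^ n * (u n)\<^sup>2)) < \<infinity>"
  shows "summable u"
proof -
  have "summable (\<lambda>n. 2 ^ n * (u n)\<^sup>2)"
    using fin by (intro summable_suminf_not_top) (auto simp: u)
  moreover have "summable (\<lambda>n. (1/2::real) ^ n)"
    by (simp add: summable_geometric)
  ultimately have "summable (\<lambda>n. 2 ^ n * (u n)\<^sup>2 + (1/2) ^ n)"
    by (rule summable_add)
  then show ?thesis
  proof (rule summable_comparison_test'[of _ 0])
    fix n
    have "2 * (2 ^ n * u n) * 1 \<le> (2 ^ n * u n)\<^sup>2 + 1\<^sup>2"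
      by (rule sum_squares_bound)
    moreover have "0 \<le> 2 ^ n * u n" using u by simp
    ultimately have "2 ^ n * u n \<le> (2 ^ n * u n)\<^sup>2 + 1" by simp
    then have "2 ^ n * u n \<le> 2 ^ n * (2 ^ n * (u n)\<^sup>2 + (1/2) ^ n)"
      by (simp add: power2_eq_square algebra_simps power_one_over)
    then have "u n \<le> 2 ^ n * (u n)\<^sup>2 + (1/2) ^ n"
      by simp
    with u show "norm (u n) \<le> 2 ^ n * (u n)\<^sup>2 + (1/2) ^ n" by simp
  qed
qed

text \<open>Fatou's lemma: the square integral of the limit is at most the lower limit of the square
  integrals, all of which are bounded by \<open>B\<close> from index \<open>N\<close> on.\<close>

lemma sq_int_AE_limit_le:
  fixes g :: "nat \<Rightarrow> 'a \<Rightarrow> complex"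
  assumes [measurable]: "\<And>n. g n \<in> borel_measurable M" "u \<in> borel_measurable M"
    and lim: "AE x in M. (\<lambda>n. g n x) \<longlonglongrightarrow> h x"
    and le: "\<And>m. N \<le> m \<Longrightarrow> sq_int M (\<lambda>x. g m x - u x) \<le> B"
  shows "sq_int M (\<lambda>x. h x - u x) \<le> B"
proof -
  have "sq_int M (\<lambda>x. h x - u x) = (\<integral>\<^sup>+ x. liminf (\<lambda>m. ennreal ((norm (g m x - u x))\<^sup>2)) \<partial>M)"
    unfolding sq_int_def
  proof (rule nn_integral_cong_AE, use lim in eventually_elim)
    case (elim x)
    then have "(\<lambda>m. ennreal ((norm (g m x - u x))\<^sup>2)) \<longlonglongrightarrow> ennreal ((norm (h x - u x))\<^sup>2)"
      by (intro tendsto_intros)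
    then show ?case by (rule lim_imp_Liminf[OF sequentially_bot, symmetric])
  qed
  also have "\<dots> \<le> liminf (\<lambda>m. sq_int M (\<lambda>x. g m x - u x))"
    unfolding sq_int_def by (rule nn_integral_liminf) measurable
  also have "\<dots> \<le> liminf (\<lambda>m::nat. B)"
    using le by (intro Liminf_mono eventually_sequentiallyI[of N]) auto
  also have "\<dots> = B" by (simp add: Liminf_const)
  finally show ?thesis .
qed

text \<open>The Riesz-Fischer argument: rapid decay of the increments gives convergence almost
  everywhere, and Fatou then restores the L2 rate for the pointwise limit.\<close>

lemma L2_limit_of_fast_Cauchy:
  fixes g :: "nat \<Rightarrow> 'a \<Rightarrow> complex"
  assumes [measurable]: "\<And>n. g n \<in> borel_measurable M"
    and g0: "sq_int M (g 0) < \<infinity>"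
    and Cauchy: "\<And>m n. n \<le> m \<Longrightarrow> sq_int M (\<lambda>x. g m x - g n x) \<le> ennreal (B * (1/4) ^ n)"
  obtains h where "h \<in> borel_measurable M" "sq_int M h < \<infinity>"
    "\<And>n. sq_int M (\<lambda>x. h x - g n x) \<le> ennreal (B * (1/4) ^ n)"
proof -
  \<comment> \<open>The increments have square integral of order \<open>(1/4) ^ n\<close>. The
    weight \<open>2 ^ n\<close> on their squares leaves a geometric series of ratio 1/2, so the
    weighted series is finite almost everywhere.\<close>
  define d where "d n x = norm (g (Suc n) x - g n x)" for n x
  have [measurable]: "d n \<in> borel_measurable M" for n unfolding d_def by measurable
  have "(\<integral>\<^sup>+ x. (\<Sum>n. ennreal (2 ^ n * (d n x)\<^sup>2)) \<partial>M) = (\<Sum>n. \<integral>\<^sup>+ x. ennreal (2 ^ n * (d n x)\<^sup>2) \<partial>M)"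
    by (rule nn_integral_suminf) measurable
  also have "\<dots> \<le> (\<Sum>n. ennreal (\<bar>B\<bar> * (1/2) ^ n))"
  proof (rule suminf_le)
    fix n
    have "(\<integral>\<^sup>+ x. ennreal (2 ^ n * (d n x)\<^sup>2) \<partial>M) = ennreal (2 ^ n) * sq_int M (\<lambda>x. g (Suc n) x - g n x)"
      unfolding sq_int_def d_def by (subst ennreal_mult) (auto intro!: nn_integral_cmult)
    also have "\<dots> \<le> ennreal (2 ^ n) * ennreal (\<bar>B\<bar> * (1/4) ^ n)"
      by (intro mult_left_mono order.trans[OF Cauchy] ennreal_leI mult_right_mono) auto
    also have "\<dots> = ennreal (\<bar>B\<bar> * (2 ^ n * (1/4) ^ n))"
      by (subst ennreal_mult[symmetric]) (auto simp: mult_ac)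
    also have "(2::real) ^ n * (1/4) ^ n = (1/2) ^ n"
      by (subst power_mult_distrib[symmetric]) simp
    finally show "(\<integral>\<^sup>+ x. ennreal (2 ^ n * (d n x)\<^sup>2) \<partial>M) \<le> ennreal (\<bar>B\<bar> * (1/2) ^ n)" .
  qed auto
  also have "\<dots> = ennreal (\<Sum>n. \<bar>B\<bar> * (1/2) ^ n)"
    by (rule suminf_ennreal2) (auto intro!: summable_mult summable_geometric)
  finally have fin: "(\<integral>\<^sup>+ x. (\<Sum>n. ennreal (2 ^ n * (d n x)\<^sup>2)) \<partial>M) \<noteq> \<infinity>"
    by (auto simp: top_unique)
  have "AE x in M. (\<Sum>n. ennreal (2 ^ n * (d n x)\<^sup>2)) \<noteq> \<infinity>"
    by (rule nn_integral_PInf_AE[OF _ fin]) measurable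
  then have conv: "AE x in M. convergent (\<lambda>n. g n x)"
  proof eventually_elim
    case (elim x)
    then have "summable (\<lambda>n. d n x)"
      by (intro summable_if_suminf_power2_finite) (auto simp: d_def less_top)
    then have "summable (\<lambda>n. g (Suc n) x - g n x)"
      unfolding d_def by (rule summable_norm_cancel)
    then have "convergent (\<lambda>n. \<Sum>i<n. g (Suc i) x - g i x)"
      by (simp add: summable_iff_convergent)
    then have "convergent (\<lambda>n. g n x - g 0 x)"
      by (simp only: sum_lessThan_telescope[of "\<lambda>i. g i x"])
    then have "convergent (\<lambda>n. (g n x - g 0 x) + g 0 x)"
      by (intro convergent_add convergent_const)
    then show ?case by simp
  qed
  \<comment> \<open>On the null set of divergence \<open>lim\<close> returns an unspecified value;
    the function stays measurable and the integrals do not see that set.\<close>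
  define h where "h x = lim (\<lambda>n. g n x)" for x
  have h[measurable]: "h \<in> borel_measurable M" unfolding h_def by measurable
  have lim: "AE x in M. (\<lambda>n. g n x) \<longlonglongrightarrow> h x"
    using conv by eventually_elim (simp add: h_def convergent_LIMSEQ_iff)
  have le: "sq_int M (\<lambda>x. h x - g n x) \<le> ennreal (B * (1/4) ^ n)" for n
    by (rule sq_int_AE_limit_le[OF _ _ lim Cauchy]) auto
  moreover have "sq_int M h < \<infinity>"
  proof -
    have "sq_int M h = sq_int M (\<lambda>x. (h x - g 0 x) + g 0 x)" by simp
    also have "\<dots> \<le> 2 * sq_int M (\<lambda>x. h x - g 0 x) + 2 * sq_int M (g 0)"
      by (rule sq_int_add_le) measurable
    also have "\<dots> < \<infinity>"
      using g0 le[of 0] by (auto simp: ennreal_mult_less_top intro: le_less_trans)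
    finally show ?thesis .
  qed
  ultimately show ?thesis using that h by blast
qed

section \<open>Schwartz functions\<close>

lemma schwartzD:
  assumes "schwartz f" "set bs \<subseteq> Basis"
  shows "iterated_pderiv bs f differentiable at x"
    and "bounded (range (\<lambda>x. norm x ^ k *\<^sub>R iterated_pderiv bs f x))"
  using assms unfolding schwartz_def by blast+

lemma iterated_pderiv_linear:
  assumes "schwartz f" "schwartz g" "set bs \<subseteq> Basis"
  shows "iterated_pderiv bs (\<lambda>x. f x + c * g x) = (\<lambda>x. iterated_pderiv bs f x + c * iterated_pderiv bs g x)"
  using assms(3)
proof (induction bs)
  case (Cons b bs)
  have d: "iterated_pderiv bs f differentiable at x" "iterated_pderiv bs g differentiable at x" for x
    using assms(1,2) Cons.prems by (auto intro: schwartzD(1))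
  show ?case
  proof
    fix x
    have "((\<lambda>x. iterated_pderiv bs f x + c * iterated_pderiv bs g x) has_derivative
      (\<lambda>h. frechet_derivative (iterated_pderiv bs f) (at x) h
         + c * frechet_derivative (iterated_pderiv bs g) (at x) h)) (at x)"
      using d[of x] by (intro has_derivative_add has_derivative_mult_right)
        (auto simp: frechet_derivative_works)
    from frechet_derivative_at[OF this, symmetric] Cons
    show "iterated_pderiv (b # bs) (\<lambda>x. f x + c * g x) x
       = iterated_pderiv (b # bs) f x + c * iterated_pderiv (b # bs) g x"
      by simp
  qed
qed simp

lemma schwartz_linear:
  assumes "schwartz f" "schwartz g"
  shows "schwartz (\<lambda>x. f x + c * g x)"
  unfolding schwartz_def
proof (intro allI impI conjI)
  fix bs :: "'a list" and x assume bs: "set bs \<subseteq> Basis"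
  show "iterated_pderiv bs (\<lambda>x. f x + c * g x) differentiable at x"
    unfolding iterated_pderiv_linear[OF assms bs]
    by (intro differentiable_add differentiable_mult differentiable_const schwartzD(1) assms bs)
next
  fix bs :: "'a list" and k :: nat assume bs: "set bs \<subseteq> Basis"
  from assms bs obtain A B where
    A: "\<And>x. norm (norm x ^ k *\<^sub>R iterated_pderiv bs f x) \<le> A" and
    B: "\<And>x. norm (norm x ^ k *\<^sub>R iterated_pderiv bs g x) \<le> B"
    using schwartzD(2)[OF assms(1) bs, of k] schwartzD(2)[OF assms(2) bs, of k]
    unfolding bounded_iff by blast
  show "bounded (range (\<lambda>x. norm x ^ k *\<^sub>R iterated_pderiv bs (\<lambda>x. f x + c * g x) x))"
    unfolding iterated_pderiv_linear[OF assms bs] bounded_iff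
  proof (intro exI ballI, elim rangeE)
    fix y x
    assume y: "y = norm x ^ k *\<^sub>R (iterated_pderiv bs f x + c * iterated_pderiv bs g x)"
    have "y = norm x ^ k *\<^sub>R iterated_pderiv bs f x + c * (norm x ^ k *\<^sub>R iterated_pderiv bs g x)"
      unfolding y by (simp add: scaleR_add_right)
    also have "norm \<dots> \<le> norm (norm x ^ k *\<^sub>R iterated_pderiv bs f x)
        + norm c * norm (norm x ^ k *\<^sub>R iterated_pderiv bs g x)"
      by (rule norm_triangle_le) (simp add: norm_mult)
    also have "\<dots> \<le> A + norm c * B"
      by (intro add_mono mult_left_mono A B) simp
    finally show "norm y \<le> A + norm c * B" .
  qed
qed

lemma schwartz_continuous:
  assumes "schwartz f"
  shows "continuous_on A f"
proof -
  have "f differentiable at x" for x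
    using schwartzD(1)[OF assms, of "[]"] by simp
  then show ?thesis
    by (intro continuous_at_imp_continuous_on ballI differentiable_imp_continuous_within)
qed

text \<open>The seminorms of order 0 and \<open>k\<close> suffice, since \<open>1 + norm x\<close>
  is at most twice the larger of 1 and \<open>norm x\<close>.\<close>

lemma schwartz_decay:
  fixes f :: "'a::euclidean_space \<Rightarrow> complex"
  assumes "schwartz f"
  obtains C where "C > 0" "\<And>x. norm (f x) * (1 + norm x) ^ k \<le> C"
proof -
  have "bounded (range (\<lambda>x. norm x ^ j *\<^sub>R f x))" for j
    using schwartzD(2)[OF assms, of "[]"] by simp
  from this[of 0] this[of k] obtain A B where A: "\<And>x. norm (norm x ^ 0 *\<^sub>R f x) \<le> A" 
    and B: "\<And>x. norm (norm x ^ k *\<^sub>R f x) \<le> B"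
    unfolding bounded_iff by blast
  have *: "norm (f x) * (1 + norm x) ^ k \<le> 2 ^ k * (A + B)" for x
  proof -
    have "(1 + norm x) ^ k \<le> (2 * max 1 (norm x)) ^ k"
      by (intro power_mono) auto
    also have "\<dots> \<le> 2 ^ k * (1 + norm x ^ k)"
      by (auto simp: power_mult_distrib max_def)
    finally have "norm (f x) * (1 + norm x) ^ k \<le> norm (f x) * (2 ^ k * (1 + norm x ^ k))"
      by (intro mult_left_mono) auto
    also have "\<dots> = 2 ^ k * (norm (norm x ^ 0 *\<^sub>R f x) + norm (norm x ^ k *\<^sub>R f x))"
      by (simp add: algebra_simps)
    also have "\<dots> \<le> 2 ^ k * (A + B)"
      by (intro mult_left_mono add_mono A B) auto
    finally show ?thesis .
  qed
  show ?thesis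
    by (rule that[of "max 1 (2 ^ k * (A + B))"]) (use * in \<open>auto simp: le_max_iff_disj\<close>)
qed

text \<open>
  An algebra of smooth functions of polynomial growth that is closed under partial derivatives
  because \<open>tanh' = 1 - tanh\<^sup>2\<close>; the \<open>tanh\<close> functions approximate indicators of half-spaces.
\<close>

inductive tame :: "('a::euclidean_space \<Rightarrow> complex) \<Rightarrow> bool" where
  tame_const: "tame (\<lambda>_. c)"
| tame_inner: "tame (\<lambda>x. of_real (x \<bullet> b))"
| tame_tanh: "tame (\<lambda>x. of_real (tanh (x \<bullet> b + c)))"
| tame_add: "tame f \<Longrightarrow> tame g \<Longrightarrow> tame (\<lambda>x. f x + g x)"
| tame_mult: "tame f \<Longrightarrow> tame g \<Longrightarrow> tame (\<lambda>x. f x * g x)"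

lemma tame_diff:
  assumes "tame f" "tame g"
  shows "tame (\<lambda>x. f x - g x)"
  using tame_add[OF assms(1) tame_mult[OF tame_const[of "-1"] assms(2)]] by simp

lemma tame_prod:
  assumes "finite I" "\<And>i. i \<in> I \<Longrightarrow> tame (f i)"
  shows "tame (\<lambda>x. \<Prod>i\<in>I. f i x)"
  using assms by (induction I) (auto intro: tame_const tame_mult)

lemma tame_growth:
  fixes p :: "'a::euclidean_space \<Rightarrow> complex"
  assumes "tame p"
  shows "\<exists>C n. 0 \<le> C \<and> (\<forall>x. norm (p x) \<le> C * (1 + norm x) ^ n)"
  using assms
proof induction
  case (tame_const c)
  show ?case by (intro exI[of _ "norm c"] exI[of _ 0]) simp
next
  case (tame_inner b)
  have "norm (complex_of_real (x \<bullet> b)) \<le> norm b * (1 + norm x) ^ 1" for x :: 'a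
  proof -
    have "\<bar>x \<bullet> b\<bar> \<le> norm x * norm b" by (rule Cauchy_Schwarz_ineq2)
    also have "\<dots> \<le> norm b * (1 + norm x) ^ 1" by (simp add: algebra_simps)
    finally show ?thesis by simp
  qed
  then show ?case by (intro exI[of _ "norm b"] exI[of _ 1]) auto
next
  case (tame_tanh b c)
  have "\<bar>tanh y\<bar> \<le> 1" for y :: real using tanh_real_bounds[of y] by auto
  then show ?case by (intro exI[of _ 1] exI[of _ 0]) simp
next
  case (tame_add f g)
  then obtain A m B n where A: "0 \<le> A" "\<And>x. norm (f x) \<le> A * (1 + norm x) ^ m"
    and B: "0 \<le> B" "\<And>x. norm (g x) \<le> B * (1 + norm x) ^ n" by blast
  have "norm (f x + g x) \<le> (A + B) * (1 + norm x) ^ (m + n)" for x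
  proof -
    have "norm (f x + g x) \<le> A * (1 + norm x) ^ m + B * (1 + norm x) ^ n"
      by (intro order.trans[OF norm_triangle_ineq] add_mono A B)
    also have "\<dots> \<le> A * (1 + norm x) ^ (m + n) + B * (1 + norm x) ^ (m + n)"
      by (intro add_mono mult_left_mono power_increasing A B) auto
    finally show ?thesis by (simp add: algebra_simps)
  qed
  then show ?case using A(1) B(1) by (intro exI[of _ "A + B"] exI[of _ "m + n"]) auto
next
  case (tame_mult f g)
  then obtain A m B n where A: "0 \<le> A" "\<And>x. norm (f x) \<le> A * (1 + norm x) ^ m"
    and B: "0 \<le> B" "\<And>x. norm (g x) \<le> B * (1 + norm x) ^ n" by blast
  have "norm (f x * g x) \<le> (A * B) * (1 + norm x) ^ (m + n)" for x
  proof -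
    have "norm (f x * g x) \<le> (A * (1 + norm x) ^ m) * (B * (1 + norm x) ^ n)"
      unfolding norm_mult by (intro mult_mono A B mult_nonneg_nonneg) auto
    then show ?thesis by (simp add: power_add mult_ac)
  qed
  then show ?case using A(1) B(1) by (intro exI[of _ "A * B"] exI[of _ "m + n"]) auto
qed

text \<open>The derivative comes as a family \<open>D x v\<close> that is tame in \<open>x\<close>
  for each fixed direction \<open>v\<close>. This is how \<open>iterated_pderiv\<close> consumes it,
  one basis vector at a time.\<close>

lemma tame_has_derivative:
  fixes p :: "'a::euclidean_space \<Rightarrow> complex"
  assumes "tame p"
  shows "\<exists>D. (\<forall>x. (p has_derivative D x) (at x)) \<and> (\<forall>v. tame (\<lambda>x. D x v))"
  using assms
proof induction
  case (tame_const c)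
  show ?case by (intro exI[of _ "\<lambda>_ _. 0"]) (auto intro: tame.tame_const)
next
  case (tame_inner b)
  show ?case
    by (intro exI[of _ "\<lambda>x v. of_real (v \<bullet> b)"])
       (auto intro!: tame.tame_const derivative_eq_intros)
next
  case (tame_tanh b c)
  let ?t = "\<lambda>x. complex_of_real (tanh (x \<bullet> b + c))"
  have "tame (\<lambda>x. (1 - ?t x * ?t x) * of_real (v \<bullet> b))" for v
    by (intro tame_mult tame_diff tame.tame_const tame.tame_tanh)
  moreover have "(?t has_derivative (\<lambda>v. (1 - ?t x * ?t x) * of_real (v \<bullet> b))) (at x)" for x
  proof -
    have "((\<lambda>x. tanh (x \<bullet> b + c)) has_derivative (\<lambda>v. (v \<bullet> b) * (1 - (tanh (x \<bullet> b + c))\<^sup>2))) (at x)"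
      by (rule has_derivative_eq_rhs, rule DERIV_compose_FDERIV[where f = tanh])
         (auto intro!: derivative_eq_intros)
    from bounded_linear.has_derivative[OF bounded_linear_of_real this] show ?thesis
      by (rule has_derivative_eq_rhs) (simp add: fun_eq_iff power2_eq_square mult_ac)
  qed
  ultimately show ?case
    by (intro exI[of _ "\<lambda>x v. (1 - ?t x * ?t x) * of_real (v \<bullet> b)"]) blast
next
  case (tame_add f g)
  then obtain D E where "\<And>x. (f has_derivative D x) (at x)" "\<And>v. tame (\<lambda>x. D x v)"
    "\<And>x. (g has_derivative E x) (at x)" "\<And>v. tame (\<lambda>x. E x v)" by blast
  then show ?case
    by (intro exI[of _ "\<lambda>x v. D x v + E x v"]) (auto intro!: tame.tame_add has_derivative_add)
next
  case (tame_mult f g)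
  then obtain D E where "\<And>x. (f has_derivative D x) (at x)" "\<And>v. tame (\<lambda>x. D x v)"
    "\<And>x. (g has_derivative E x) (at x)" "\<And>v. tame (\<lambda>x. E x v)" by blast
  then show ?case
    using tame_mult.hyps
    by (intro exI[of _ "\<lambda>x v. f x * E x v + D x v * g x"])
       (auto intro!: tame.tame_add tame.tame_mult has_derivative_mult)
qed

definition gauss :: "'a::euclidean_space \<Rightarrow> complex" where
  "gauss x = of_real (exp (- (x \<bullet> x)))"

lemma has_derivative_gauss:
  "(gauss has_derivative (\<lambda>v. - 2 * of_real (x \<bullet> v) * gauss x)) (at x)"
proof -
  have "((\<lambda>x. exp (- (x \<bullet> x))) has_derivative (\<lambda>v. - 2 * (x \<bullet> v) * exp (- (x \<bullet> x)))) (at x)"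
    by (auto intro!: derivative_eq_intros simp: inner_commute)
  from bounded_linear.has_derivative[OF bounded_linear_of_real this] show ?thesis
    unfolding gauss_def by simp
qed

text \<open>Differentiating \<open>q x * gauss x\<close> along \<open>b\<close> replaces
  \<open>q x\<close> by \<open>D x b - 2 * (x \<bullet> b) * q x\<close>, which is tame again, while
  the Gaussian factor persists.\<close>

lemma iterated_pderiv_tame_gauss:
  fixes p :: "'a::euclidean_space \<Rightarrow> complex"
  assumes "tame p"
  shows "\<exists>q. tame q \<and> iterated_pderiv bs (\<lambda>x. p x * gauss x) = (\<lambda>x. q x * gauss x)"
proof (induction bs)
  case Nil
  show ?case using assms by auto
next
  case (Cons b bs)
  then obtain q where q: "tame q" "iterated_pderiv bs (\<lambda>x. p x * gauss x) = (\<lambda>x. q x * gauss x)"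
    by blast
  from tame_has_derivative[OF q(1)] obtain D where
    D: "\<And>x. (q has_derivative D x) (at x)" "\<And>v. tame (\<lambda>x. D x v)" by blast
  let ?q = "\<lambda>x. D x b + q x * ((-2) * of_real (x \<bullet> b))"
  have "frechet_derivative (\<lambda>x. q x * gauss x) (at x) b = ?q x * gauss x" for x
    by (subst frechet_derivative_at[OF has_derivative_mult[OF D(1) has_derivative_gauss], symmetric])
       (simp add: algebra_simps)
  moreover have "tame ?q"
    by (intro tame_add tame_mult D q tame_const tame_inner)
  ultimately show ?case
    using q by (intro exI[of _ ?q]) auto
qed

text \<open>After \<open>1 + t \<le> exp t\<close> the exponent is \<open>n * t - t^2\<close>, and
  \<open>2 * n * t \<le> n^2 + t^2\<close> bounds it by \<open>n^2\<close>.\<close>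

lemma power_mult_exp_bounded:
  obtains C where "\<And>t::real. 0 \<le> t \<Longrightarrow> (1 + t) ^ n * exp (- (t * t)) \<le> C"
proof
  fix t :: real assume t: "0 \<le> t"
  have "(1 + t) ^ n \<le> exp t ^ n"
    using t by (intro power_mono) auto
  also have "\<dots> = exp (real n * t)"
    by (simp add: exp_of_nat_mult)
  finally have "(1 + t) ^ n * exp (- (t * t)) \<le> exp (real n * t) * exp (- (t * t))"
    by (intro mult_right_mono) auto
  also have "\<dots> = exp (real n * t - t * t)"
    by (simp add: exp_add[symmetric])
  also have "\<dots> \<le> exp (real n * real n)"
  proof -
    have "0 \<le> real n * t" using t by simp
    moreover have "2 * (real n * t) \<le> real n * real n + t * t"
      using sum_squares_bound[of "real n" t] by (simp add: power2_eq_square)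
    ultimately show ?thesis unfolding exp_le_cancel_iff by linarith
  qed
  finally show "(1 + t) ^ n * exp (- (t * t)) \<le> exp (real n * real n)" .
qed

lemma schwartz_tame_gauss:
  fixes p :: "'a::euclidean_space \<Rightarrow> complex"
  assumes "tame p"
  shows "schwartz (\<lambda>x. p x * gauss x)"
  unfolding schwartz_def
proof (intro allI impI)
  fix bs :: "'a list"
  obtain q where q: "tame q" "iterated_pderiv bs (\<lambda>x. p x * gauss x) = (\<lambda>x. q x * gauss x)"
    using iterated_pderiv_tame_gauss[OF assms] by blast
  have "(\<lambda>x. q x * gauss x) differentiable at x" for x
    using tame_has_derivative[OF q(1)] has_derivative_mult[OF _ has_derivative_gauss]
    unfolding differentiable_def by blast
  moreover have "bounded (range (\<lambda>x. norm x ^ k *\<^sub>R (q x * gauss x)))" for k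
  proof -
    obtain A n where A: "0 \<le> A" "\<And>x. norm (q x) \<le> A * (1 + norm x) ^ n"
      using tame_growth[OF q(1)] by blast
    obtain C where C: "\<And>t::real. 0 \<le> t \<Longrightarrow> (1 + t) ^ (k + n) * exp (- (t * t)) \<le> C"
      using power_mult_exp_bounded[of "k + n"] by blast
    have "norm (norm x ^ k *\<^sub>R (q x * gauss x)) \<le> A * C" for x
    proof -
      have "norm (norm x ^ k *\<^sub>R (q x * gauss x)) = norm x ^ k * norm (q x) * exp (- (norm x * norm x))"
        by (simp add: norm_mult gauss_def dot_square_norm power2_eq_square)
      also have "\<dots> \<le> (1 + norm x) ^ k * (A * (1 + norm x) ^ n) * exp (- (norm x * norm x))"
        by (intro mult_right_mono mult_mono power_mono A) auto
      also have "\<dots> = A * ((1 + norm x) ^ (k + n) * exp (- (norm x * norm x)))"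
        by (simp add: power_add mult_ac)
      also have "\<dots> \<le> A * C"
        by (intro mult_left_mono C A) auto
      finally show ?thesis .
    qed
    then show ?thesis unfolding bounded_iff by blast
  qed
  ultimately show "(\<forall>x. iterated_pderiv bs (\<lambda>x. p x * gauss x) differentiable at x) \<and>
    (\<forall>k. bounded (range (\<lambda>x. norm x ^ k *\<^sub>R iterated_pderiv bs (\<lambda>x. p x * gauss x) x)))"
    unfolding q(2) by blast
qed

section \<open>Smooth approximation of indicators of boxes\<close>

text \<open>A smooth step that gets steeper like \<open>n^2\<close> while its centre
  \<open>1 / n\<close> moves to 0 from the right. The shift by \<open>n\<close> sends the value at
  \<open>t = 0\<close> to 0 instead of 1/2, so the limit is the indicator of the open half-line at
  every point.\<close>

definition step_fun :: "nat \<Rightarrow> real \<Rightarrow> real" where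
  "step_fun n t = (1 + tanh ((real n)\<^sup>2 * t - real n)) / 2"

lemma step_fun_bounds: "0 \<le> step_fun n t" "step_fun n t \<le> 1"
  using tanh_real_bounds[of "(real n)\<^sup>2 * t - real n"] unfolding step_fun_def by auto

lemma step_fun_tendsto: "(\<lambda>n. step_fun n t) \<longlonglongrightarrow> (if t > 0 then 1 else 0)"
proof (cases "t > 0")
  case True
  have "filterlim (\<lambda>n. (real n)\<^sup>2 * t - real n) at_top sequentially"
  proof -
    have "filterlim (\<lambda>n. t * real n) at_top sequentially"
      by (rule filterlim_tendsto_pos_mult_at_top[OF tendsto_const True filterlim_real_sequentially])
    then have "filterlim (\<lambda>n. - 1 + t * real n) at_top sequentially"
      by (rule filterlim_tendsto_add_at_top[OF tendsto_const])
    from filterlim_at_top_mult_at_top[OF filterlim_real_sequentially this]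
    show ?thesis by (simp add: power2_eq_square algebra_simps)
  qed
  from filterlim_compose[OF tanh_real_at_top this]
  have "(\<lambda>n. (1 + tanh ((real n)\<^sup>2 * t - real n)) / 2) \<longlonglongrightarrow> (1 + 1) / 2"
    by (intro tendsto_intros) auto
  then show ?thesis using True by (simp add: step_fun_def)
next
  case False
  have "filterlim (\<lambda>n. (real n)\<^sup>2 * t - real n) at_bot sequentially"
  proof (rule filterlim_at_bot_mono)
    show "filterlim (\<lambda>n. - real n) at_bot sequentially"
      using filterlim_real_sequentially by (simp add: filterlim_uminus_at_top)
    show "\<forall>\<^sub>F n in sequentially. (real n)\<^sup>2 * t - real n \<le> - real n"
      using False by (intro always_eventually allI) (simp add: mult_nonneg_nonpos)
  qed
  from filterlim_compose[OF tanh_real_at_bot this]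
  have "(\<lambda>n. (1 + tanh ((real n)\<^sup>2 * t - real n)) / 2) \<longlonglongrightarrow> (1 + (-1)) / 2"
    by (intro tendsto_intros) auto
  then show ?thesis using False by (simp add: step_fun_def)
qed

text \<open>Two steps per coordinate, one for each face. Since the limits are strict at the faces,
  the product tends to the indicator of the open box everywhere, and no exceptional set on the
  boundary has to be controlled.\<close>

definition box_fun :: "'a::euclidean_space \<Rightarrow> 'a \<Rightarrow> nat \<Rightarrow> 'a \<Rightarrow> complex" where
  "box_fun a b n x = (\<Prod>i\<in>Basis. of_real (step_fun n (x \<bullet> i - a \<bullet> i)) * of_real (step_fun n (b \<bullet> i - x \<bullet> i)))"

lemma tame_step_fun: "tame (\<lambda>x. of_real (step_fun n (x \<bullet> b + c)))"
proof -
  have "step_fun n (x \<bullet> b + c) = (1/2) * (1 + tanh (x \<bullet> ((real n)\<^sup>2 *\<^sub>R b) + ((real n)\<^sup>2 * c - real n)))" for x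
    by (simp add: step_fun_def algebra_simps)
  then show ?thesis
    by (simp only: of_real_mult of_real_add) (intro tame_add tame_mult tame_const tame_tanh)
qed

lemma tame_box_fun: "tame (box_fun a b n)"
proof -
  have "tame (\<lambda>x. of_real (step_fun n (x \<bullet> i - a \<bullet> i)) * of_real (step_fun n (b \<bullet> i - x \<bullet> i)))" for i
    using tame_step_fun[of n i "- (a \<bullet> i)"] tame_step_fun[of n "- i" "b \<bullet> i"] by (intro tame_mult) auto
  then show ?thesis
    unfolding box_fun_def[abs_def] by (intro tame_prod) auto
qed

lemma norm_box_fun_le: "norm (box_fun a b n x) \<le> 1"
  unfolding box_fun_def norm_mult prod_norm[symmetric] norm_of_real
  by (intro prod_le_1) (auto simp: step_fun_bounds intro!: mult_le_one)

lemma box_fun_tendsto: "(\<lambda>n. box_fun a b n x) \<longlonglongrightarrow> indicator (box a b) x"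
proof -
  have "(\<lambda>n. box_fun a b n x) \<longlonglongrightarrow>
    (\<Prod>i\<in>Basis. of_real (if x \<bullet> i - a \<bullet> i > 0 then 1 else 0) * of_real (if b \<bullet> i - x \<bullet> i > 0 then 1 else 0))"
    unfolding box_fun_def by (intro tendsto_prod tendsto_mult tendsto_of_real step_fun_tendsto)
  also have "(\<Prod>i\<in>Basis. complex_of_real (if x \<bullet> i - a \<bullet> i > 0 then 1 else 0) * of_real (if b \<bullet> i - x \<bullet> i > 0 then 1 else 0))
      = indicator (box a b) x"
  proof (cases "x \<in> box a b")
    case True
    then show ?thesis by (intro prod.neutral[THEN trans]) (auto simp: mem_box)
  next
    case False
    then obtain i where "i \<in> Basis" "\<not> (a \<bullet> i < x \<bullet> i \<and> x \<bullet> i < b \<bullet> i)" by (auto simp: mem_box)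
    then show ?thesis using False by (subst prod_zero) (auto intro!: bexI[of _ i])
  qed
  finally show ?thesis .
qed

section \<open>The integral operator on integrable functions\<close>

lemma ennreal_le_suminf:
  fixes f :: "nat \<Rightarrow> ennreal"
  shows "f n \<le> suminf f"
  using sum_le_suminf[of f "{n}"] by auto

context cone_transform
begin

lemma borel_measurable_mu: "f \<in> borel_measurable borel \<Longrightarrow> f \<in> borel_measurable \<mu>"
  by (subst measurable_cong_sets[OF sets_mu refl]) (rule measurable_restrict_space1)

lemma continuous_on_borel_measurable_mu:
  fixes f :: "'a \<Rightarrow> complex"
  shows "continuous_on \<Omega> f \<Longrightarrow> f \<in> borel_measurable \<mu>"
  by (subst measurable_cong_sets[OF sets_mu refl]) (rule borel_measurable_continuous_on_restrict)

lemma sets_mu_Int: "A \<in> sets borel \<Longrightarrow> A \<inter> \<Omega> \<in> sets \<mu>"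
  unfolding sets_mu sets_restrict_space by auto

section \<open>Growth of the measure and integrability of Schwartz functions\<close>

text \<open>In every direction the radial integral of \<open>t powr (2 * a - 1)\<close> up to
  \<open>r\<close> is \<open>r powr (2 * a) / (2 * a)\<close>, and the angular integral of
  \<open>Q\<close> is finite. All later uses of the polar decomposition go through this
  bound.\<close>

lemma emeasure_ball_le:
  "\<exists>\<kappa>>0. \<forall>r>0. emeasure \<mu> (ball 0 r \<inter> \<Omega>) \<le> ennreal (\<kappa> * r powr (2 * a))"
proof -
  define q where "q = (\<integral>\<^sup>+ \<zeta>. ennreal (Q \<zeta>) \<partial>sphere_measure)"
  have "q \<le> (\<integral>\<^sup>+ \<zeta>. ennreal (norm (Q \<zeta>)) \<partial>sphere_measure)"
    unfolding q_def by (intro nn_integral_mono ennreal_leI) auto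
  also have "\<dots> < \<infinity>"
    using Q_integrable by (simp add: integrable_iff_bounded)
  finally have q: "q < \<infinity>" .
  have Qm[measurable]: "Q \<in> borel_measurable sphere_measure"
    using Q_integrable by auto
  \<comment> \<open>The summand 1 makes positivity of the constant immediate.\<close>
  have "emeasure \<mu> (ball 0 r \<inter> \<Omega>) \<le> ennreal ((enn2real q / (2 * a) + 1) * r powr (2 * a))" if r: "r > 0" for r
  proof -
    have "emeasure \<mu> (ball 0 r \<inter> \<Omega>) \<le>
        (\<integral>\<^sup>+ \<zeta>. ennreal (r powr (2 * a) / (2 * a)) * ennreal (Q \<zeta>) \<partial>sphere_measure)"
      unfolding mu_polar[OF borel_open[OF open_ball]]
    proof (rule nn_integral_mono, rule mult_right_mono)
      fix \<zeta> :: 'a assume "\<zeta> \<in> space sphere_measure"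
      then have \<zeta>: "norm \<zeta> = 1"
        by (simp add: sphere_measure_def space_scale_measure space_restrict_space)
      have "(\<integral>\<^sup>+ t. indicator {0<..} t * indicator (ball 0 r) (t *\<^sub>R \<zeta>) * ennreal (t powr (2 * a - 1)) \<partial>lborel)
          \<le> (\<integral>\<^sup>+ t. ennreal (t powr (2 * a - 1)) * indicator {0..r} t \<partial>lborel)"
        by (intro nn_integral_mono) (auto simp: \<zeta> split: split_indicator)
      also have "\<dots> = ennreal (r powr (2 * a - 1 + 1) / (2 * a - 1 + 1))"
        using a_pos r by (intro nn_integral_has_integral_lebesgue' has_integral_powr_from_0) auto
      finally show "(\<integral>\<^sup>+ t. indicator {0<..} t * indicator (ball 0 r) (t *\<^sub>R \<zeta>) * ennreal (t powr (2 * a - 1)) \<partial>lborel)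
          \<le> ennreal (r powr (2 * a) / (2 * a))" by simp
    qed simp
    also have "\<dots> = ennreal (r powr (2 * a) / (2 * a)) * q"
      unfolding q_def by (rule nn_integral_cmult) measurable
    also have "\<dots> = ennreal (r powr (2 * a) / (2 * a) * enn2real q)"
      using q a_pos by (subst ennreal_mult) (auto simp: less_top)
    also have "\<dots> \<le> ennreal ((enn2real q / (2 * a) + 1) * r powr (2 * a))"
      using a_pos by (intro ennreal_leI) (simp add: field_simps)
    finally show ?thesis .
  qed
  moreover have "enn2real q / (2 * a) + 1 > 0"
    using a_pos by (intro add_nonneg_pos) auto
  ultimately show ?thesis by blast
qed

lemma schwartz_measurable: "schwartz f \<Longrightarrow> f \<in> borel_measurable \<mu>"
  by (intro continuous_on_borel_measurable_mu schwartz_continuous)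

text \<open>On the shell \<open>n \<le> norm x < n + 1\<close> the decay of \<open>f\<close> beats
  the growth of the ball of radius \<open>1 + n\<close>; summing over the balls bounds the
  integral.\<close>

lemma schwartz_integrable:
  assumes f: "schwartz f"
  shows "integrable \<mu> f"
proof -
  obtain \<kappa> where \<kappa>: "\<kappa> > 0" "\<And>r. r > 0 \<Longrightarrow> emeasure \<mu> (ball 0 r \<inter> \<Omega>) \<le> ennreal (\<kappa> * r powr (2 * a))"
    using emeasure_ball_le by blast
  \<comment> \<open>The decay has to pay for the exponent \<open>2 * a\<close> of the ball growth
    and to leave an exponent 2 for a convergent series.\<close>
  obtain k :: nat where k: "2 * a + 2 \<le> real k"
    using real_arch_simple by blast
  obtain C where C: "C > 0" "\<And>x. norm (f x) * (1 + norm x) ^ k \<le> C"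
    using schwartz_decay[OF f] by blast
  let ?B = "\<lambda>n::nat. ball 0 (1 + real n) \<inter> \<Omega>"
  have [measurable]: "?B n \<in> sets \<mu>" for n
    by (intro sets_mu_Int) auto
  have "(\<integral>\<^sup>+ x. ennreal (norm (f x)) \<partial>\<mu>)
      \<le> (\<integral>\<^sup>+ x. (\<Sum>n. ennreal (C / (1 + real n) ^ k) * indicator (?B n) x) \<partial>\<mu>)"
  proof (rule nn_integral_mono)
    fix x assume "x \<in> space \<mu>"
    define n where "n = nat \<lfloor>norm x\<rfloor>"
    have n: "real n \<le> norm x" "norm x < 1 + real n"
      unfolding n_def by (auto simp: of_nat_nat) linarith
    have "norm (f x) \<le> C / (1 + norm x) ^ k"
      using C(2)[of x] by (simp add: pos_le_divide_eq add_pos_nonneg)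
    also have "\<dots> \<le> C / (1 + real n) ^ k"
      using n C(1) by (intro divide_left_mono power_mono mult_pos_pos) (auto intro!: zero_less_power add_pos_nonneg)
    finally have "ennreal (norm (f x)) \<le> ennreal (C / (1 + real n) ^ k) * indicator (?B n) x"
      using n \<open>x \<in> space \<mu>\<close> by (simp add: space_mu ennreal_leI)
    also have "\<dots> \<le> (\<Sum>n. ennreal (C / (1 + real n) ^ k) * indicator (?B n) x)"
      by (rule ennreal_le_suminf)
    finally show "ennreal (norm (f x)) \<le> (\<Sum>n. ennreal (C / (1 + real n) ^ k) * indicator (?B n) x)" .
  qed
  also have "\<dots> = (\<Sum>n. ennreal (C / (1 + real n) ^ k) * emeasure \<mu> (?B n))"
    by (subst nn_integral_suminf) (auto simp: nn_integral_cmult_indicator)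
  also have "\<dots> \<le> (\<Sum>n. ennreal (C * \<kappa> * inverse (real (Suc n) ^ 2)))"
  proof (rule suminf_le)
    fix n :: nat
    let ?m = "1 + real n"
    have "ennreal (C / ?m ^ k) * emeasure \<mu> (?B n) \<le> ennreal (C / ?m ^ k) * ennreal (\<kappa> * ?m powr (2 * a))"
      by (intro mult_left_mono \<kappa>(2)) auto
    also have "\<dots> = ennreal (C * \<kappa> * (?m powr (2 * a) / ?m ^ k))"
      using C(1) \<kappa>(1) by (subst ennreal_mult[symmetric]) (auto simp: field_simps)
    also have "\<dots> \<le> ennreal (C * \<kappa> * inverse (real (Suc n) ^ 2))"
    proof (intro ennreal_leI mult_left_mono)
      have "?m powr (2 * a) / ?m ^ k = ?m powr (2 * a - real k)"
        by (simp add: powr_diff powr_realpow add_pos_nonneg)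
      also have "\<dots> \<le> ?m powr (- 2)"
        using k by (intro powr_mono) auto
      also have "\<dots> = inverse (real (Suc n) ^ 2)"
        by (simp add: powr_minus powr_realpow add_pos_nonneg)
      finally show "?m powr (2 * a) / ?m ^ k \<le> inverse (real (Suc n) ^ 2)" .
    qed (use C(1) \<kappa>(1) in auto)
    finally show "ennreal (C / ?m ^ k) * emeasure \<mu> (?B n) \<le> ennreal (C * \<kappa> * inverse (real (Suc n) ^ 2))" .
  qed auto
  also have "\<dots> = ennreal (\<Sum>n. C * \<kappa> * inverse (real (Suc n) ^ 2))"
  proof (rule suminf_ennreal2)
    show "summable (\<lambda>n. C * \<kappa> * inverse (real (Suc n) ^ 2))"
      using inverse_power_summable[of 2, where 'a = real]
      by (intro summable_mult) (subst summable_Suc_iff, simp)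
  qed (use C(1) \<kappa>(1) in auto)
  also have "\<dots> < \<infinity>" by simp
  finally show ?thesis
    using schwartz_measurable[OF f] by (simp add: integrable_iff_bounded)
qed

lemma schwartz_sq_int:
  assumes f: "schwartz f"
  shows "sq_int \<mu> f < \<infinity>"
proof -
  obtain C where C: "C > 0" "\<And>x. norm (f x) * (1 + norm x) ^ 0 \<le> C"
    using schwartz_decay[OF f] by blast
  have "sq_int \<mu> f \<le> (\<integral>\<^sup>+ x. ennreal C * ennreal (norm (f x)) \<partial>\<mu>)"
    unfolding sq_int_def using C
    by (intro nn_integral_mono) (auto simp: ennreal_mult[symmetric] power2_eq_square intro!: ennreal_leI mult_right_mono)
  also have "\<dots> = ennreal C * (\<integral>\<^sup>+ x. ennreal (norm (f x)) \<partial>\<mu>)"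
    using schwartz_measurable[OF f] by (intro nn_integral_cmult) measurable
  also have "\<dots> < \<infinity>"
    using schwartz_integrable[OF f] by (simp add: integrable_iff_bounded ennreal_mult_less_top)
  finally show ?thesis .
qed

section \<open>Boundedness, continuity and isometry of the kernel integral\<close>

lemma K_bound: "\<exists>c>0. \<forall>x\<in>\<Omega>. \<forall>\<xi>\<in>\<Omega>. \<forall>z. norm (z * K x \<xi>) \<le> c * norm z"
proof -
  obtain c where c: "\<And>z. z \<in> (\<lambda>(x, \<xi>). K x \<xi>) ` (\<Omega> \<times> \<Omega>) \<Longrightarrow> norm z \<le> c"
    using K_bounded unfolding bounded_iff by blast
  have "norm (z * K x \<xi>) \<le> max 1 c * norm z" if "x \<in> \<Omega>" "\<xi> \<in> \<Omega>" for x \<xi> z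
  proof -
    have "norm (K x \<xi>) \<le> max 1 c"
      using c[of "K x \<xi>"] that by force
    from mult_left_mono[OF this norm_ge_zero[of z]] show ?thesis
      by (simp add: norm_mult mult.commute)
  qed
  then show ?thesis by (intro exI[of _ "max 1 c"]) auto
qed

lemma K_measurable: "\<xi> \<in> \<Omega> \<Longrightarrow> (\<lambda>x. K x \<xi>) \<in> borel_measurable \<mu>"
  by (intro continuous_on_borel_measurable_mu continuous_on_compose2[OF K_continuous, of _ "\<lambda>x. (x, \<xi>)", simplified])
     (auto intro!: continuous_intros)

lemma integrable_mult_K:
  assumes "integrable \<mu> f" "\<xi> \<in> \<Omega>"
  shows "integrable \<mu> (\<lambda>x. f x * K x \<xi>)"
proof -
  obtain c where c: "c > 0" "\<And>x \<xi> z. x \<in> \<Omega> \<Longrightarrow> \<xi> \<in> \<Omega> \<Longrightarrow> norm (z * K x \<xi>) \<le> c * norm z"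
    using K_bound by blast
  show ?thesis
  proof (rule Bochner_Integration.integrable_bound)
    show "integrable \<mu> (\<lambda>x. of_real c * f x)" using assms(1) by simp
    show "(\<lambda>x. f x * K x \<xi>) \<in> borel_measurable \<mu>"
      using assms K_measurable by (intro borel_measurable_times) auto
    show "AE x in \<mu>. norm (f x * K x \<xi>) \<le> norm (of_real c * f x)"
      using c assms(2) by (intro AE_I2) (auto simp: space_mu norm_mult[of "complex_of_real c"])
  qed
qed

lemma int_transform_bound:
  "\<exists>c>0. \<forall>f. \<forall>\<xi>\<in>\<Omega>. integrable \<mu> f \<longrightarrow>
     ennreal (norm (int_transform \<mu> K f \<xi>)) \<le> ennreal c * (\<integral>\<^sup>+ x. ennreal (norm (f x)) \<partial>\<mu>)"
proof -
  obtain c where c: "c > 0" "\<And>x \<xi> z. x \<in> \<Omega> \<Longrightarrow> \<xi> \<in> \<Omega> \<Longrightarrow> norm (z * K x \<xi>) \<le> c * norm z"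
    using K_bound by blast
  have "ennreal (norm (int_transform \<mu> K f \<xi>)) \<le> ennreal c * (\<integral>\<^sup>+ x. ennreal (norm (f x)) \<partial>\<mu>)"
    if f: "integrable \<mu> f" and \<xi>: "\<xi> \<in> \<Omega>" for f \<xi>
  proof -
    have "ennreal (norm (int_transform \<mu> K f \<xi>)) \<le> (\<integral>\<^sup>+ x. ennreal (norm (f x * K x \<xi>)) \<partial>\<mu>)"
      unfolding int_transform_def by (intro integral_norm_bound_ennreal integrable_mult_K f \<xi>)
    also have "\<dots> \<le> (\<integral>\<^sup>+ x. ennreal c * ennreal (norm (f x)) \<partial>\<mu>)"
      using c \<xi>
      by (intro nn_integral_mono)
         (auto simp: space_mu ennreal_mult[symmetric] intro!: ennreal_leI)
    also have "\<dots> = ennreal c * (\<integral>\<^sup>+ x. ennreal (norm (f x)) \<partial>\<mu>)"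
      using f by (intro nn_integral_cmult) auto
    finally show ?thesis .
  qed
  with c(1) show ?thesis by blast
qed

text \<open>Dominated convergence with majorant \<open>c * norm (f x)\<close>. The purpose is
  measurability of the transform for the Borel sets of the subspace \<open>\<Omega>\<close>.\<close>

lemma int_transform_continuous:
  assumes f: "integrable \<mu> f"
  shows "continuous_on \<Omega> (int_transform \<mu> K f)"
  unfolding continuous_on_sequentially comp_def
proof (intro allI ballI impI, elim conjE)
  fix u and \<xi> assume \<xi>: "\<xi> \<in> \<Omega>" and u: "\<forall>n. u n \<in> \<Omega>" "u \<longlonglongrightarrow> \<xi>"
  obtain c where c: "c > 0" "\<And>x \<xi> z. x \<in> \<Omega> \<Longrightarrow> \<xi> \<in> \<Omega> \<Longrightarrow> norm (z * K x \<xi>) \<le> c * norm z"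
    using K_bound by blast
  show "(\<lambda>n. int_transform \<mu> K f (u n)) \<longlonglongrightarrow> int_transform \<mu> K f \<xi>"
    unfolding int_transform_def
  proof (rule integral_dominated_convergence[where w = "\<lambda>x. c * norm (f x)"])
    show "(\<lambda>x. f x * K x \<xi>) \<in> borel_measurable \<mu>"
      using integrable_mult_K[OF f \<xi>] by auto
    show "(\<lambda>x. f x * K x (u n)) \<in> borel_measurable \<mu>" for n
      using integrable_mult_K[OF f] u(1) by auto
    show "integrable \<mu> (\<lambda>x. c * norm (f x))" using f by auto
    show "AE x in \<mu>. norm (f x * K x (u n)) \<le> c * norm (f x)" for n
      using c u(1) by (intro AE_I2) (auto simp: space_mu norm_mult[of "complex_of_real c"])
    show "AE x in \<mu>. (\<lambda>n. f x * K x (u n)) \<longlonglongrightarrow> f x * K x \<xi>"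
    proof (intro AE_I2 tendsto_mult tendsto_const)
      fix x assume "x \<in> space \<mu>"
      then have x: "x \<in> \<Omega>" by (simp add: space_mu)
      have "(\<lambda>n. (\<lambda>(x, \<xi>). K x \<xi>) (x, u n)) \<longlonglongrightarrow> (\<lambda>(x, \<xi>). K x \<xi>) (x, \<xi>)"
        by (rule continuous_on_tendsto_compose[OF K_continuous]) (use x \<xi> u in \<open>auto intro: tendsto_intros\<close>)
      then show "(\<lambda>n. K x (u n)) \<longlonglongrightarrow> K x \<xi>" by simp
    qed
  qed
qed

lemma int_transform_measurable: "integrable \<mu> f \<Longrightarrow> int_transform \<mu> K f \<in> borel_measurable \<mu>"
  by (intro continuous_on_borel_measurable_mu int_transform_continuous)

lemma int_transform_linear:
  assumes "integrable \<mu> f" "integrable \<mu> g" "\<xi> \<in> \<Omega>"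
  shows "int_transform \<mu> K (\<lambda>x. f x + c * g x) \<xi> = int_transform \<mu> K f \<xi> + c * int_transform \<mu> K g \<xi>"
proof -
  have "int_transform \<mu> K (\<lambda>x. f x + c * g x) \<xi> = (LINT x|\<mu>. f x * K x \<xi> + c * (g x * K x \<xi>))"
    unfolding int_transform_def by (simp add: algebra_simps)
  also have "\<dots> = int_transform \<mu> K f \<xi> + c * int_transform \<mu> K g \<xi>"
    unfolding int_transform_def using integrable_mult_K assms
    by (subst Bochner_Integration.integral_add) auto
  finally show ?thesis .
qed

text \<open>\<open>parseval\<close> speaks of Bochner integrals, which are 0 for non-integrable
  functions, so by itself it does not exclude an infinite norm on the transform side. If
  \<open>f\<close> vanishes almost everywhere, its transform is identically 0; otherwise the common
  value of the integrals is nonzero, and that forces integrability.\<close>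

lemma int_transform_schwartz_isometry:
  assumes f: "schwartz f"
  shows "sq_int \<mu> (int_transform \<mu> K f) = sq_int \<mu> f"
proof (cases "sq_int \<mu> f = 0")
  case True
  then have "AE x in \<mu>. f x = 0"
    using sq_int_eq_0_iff[OF schwartz_measurable[OF f]] by simp
  then have "int_transform \<mu> K f \<xi> = 0" for \<xi>
    unfolding int_transform_def by (intro integral_eq_zero_AE) auto
  then show ?thesis using True by (simp add: sq_int_def)
next
  case False
  have eq: "inner_L2 \<mu> g g = complex_of_real (LINT x|\<mu>. (norm (g x))\<^sup>2)" for g
    unfolding inner_L2_def complex_norm_square[symmetric] by (rule integral_complex_of_real)
  have "complex_of_real (LINT x|\<mu>. (norm (int_transform \<mu> K f x))\<^sup>2) = of_real (LINT x|\<mu>. (norm (f x))\<^sup>2)"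
    using parseval[OF f f] unfolding eq .
  then have *: "(LINT x|\<mu>. (norm (int_transform \<mu> K f x))\<^sup>2) = (LINT x|\<mu>. (norm (f x))\<^sup>2)"
    by (simp only: of_real_eq_iff)
  have i: "integrable \<mu> (\<lambda>x. (norm (f x))\<^sup>2)"
    using schwartz_sq_int[OF f] schwartz_measurable[OF f] Lp_space_2_iff[of f \<mu>] Lp_space_2_iff_sq_int[of f \<mu>] by simp
  then have f': "sq_int \<mu> f = ennreal (LINT x|\<mu>. (norm (f x))\<^sup>2)"
    unfolding sq_int_def by (intro nn_integral_eq_integral) auto
  with False have "(LINT x|\<mu>. (norm (f x))\<^sup>2) \<noteq> 0" by auto
  \<comment> \<open>A nonzero Bochner integral cannot be the default value, so the squared transform
    is integrable.\<close>
  then have "integrable \<mu> (\<lambda>x. (norm (int_transform \<mu> K f x))\<^sup>2)"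
    unfolding *[symmetric] by (metis not_integrable_integral_eq)
  then have "sq_int \<mu> (int_transform \<mu> K f) = ennreal (LINT x|\<mu>. (norm (int_transform \<mu> K f x))\<^sup>2)"
    unfolding sq_int_def by (intro nn_integral_eq_integral) auto
  then show ?thesis using f' * by simp
qed

end

section \<open>Density of Schwartz functions\<close>

text \<open>The L1 norm plus the squared L2 norm: convergence to 0 of this single quantity is
  convergence in both spaces, with one sequence of approximants.\<close>

definition mixed_int :: "'a measure \<Rightarrow> ('a \<Rightarrow> complex) \<Rightarrow> ennreal" where
  "mixed_int M f = (\<integral>\<^sup>+ x. ennreal (norm (f x) + (norm (f x))\<^sup>2) \<partial>M)"

lemma mixed_int_eq:
  assumes [measurable]: "f \<in> borel_measurable M"
  shows "mixed_int M f = (\<integral>\<^sup>+ x. ennreal (norm (f x)) \<partial>M) + sq_int M f"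
  unfolding mixed_int_def sq_int_def by (simp add: nn_integral_add)

lemma mixed_int_add_le:
  assumes [measurable]: "f \<in> borel_measurable M" "g \<in> borel_measurable M"
  shows "mixed_int M (\<lambda>x. f x + g x) \<le> 2 * mixed_int M f + 2 * mixed_int M g"
proof -
  have *: "norm (x + y) + (norm (x + y))\<^sup>2 \<le> 2 * (norm x + (norm x)\<^sup>2) + 2 * (norm y + (norm y)\<^sup>2)"
    for x y :: complex
  proof -
    have "norm (x + y) \<le> 2 * norm x + 2 * norm y"
      using norm_triangle_ineq[of x y] norm_ge_zero[of x] norm_ge_zero[of y] by linarith
    then show ?thesis using norm_add_power2_le[of x y] unfolding distrib_left by linarith
  qed
  have "mixed_int M (\<lambda>x. f x + g x)
      \<le> (\<integral>\<^sup>+ x. ennreal (2 * (norm (f x) + (norm (f x))\<^sup>2)) + ennreal (2 * (norm (g x) + (norm (g x))\<^sup>2)) \<partial>M)"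
    unfolding mixed_int_def
    by (rule nn_integral_mono, subst ennreal_plus[symmetric], simp, simp, intro ennreal_leI *)
  also have "\<dots> = ennreal 2 * mixed_int M f + ennreal 2 * mixed_int M g"
    unfolding mixed_int_def
    by (subst nn_integral_add) (auto simp: ennreal_mult nn_integral_cmult simp del: ennreal_numeral ennreal_plus distrib_left_numeral)
  finally show ?thesis by simp
qed

text \<open>The factor \<open>(1 + norm c)^2\<close> dominates both \<open>norm c\<close>, needed
  for the linear part, and its square.\<close>

lemma mixed_int_cmult_le:
  assumes [measurable]: "f \<in> borel_measurable M"
  shows "mixed_int M (\<lambda>x. c * f x) \<le> ennreal ((1 + norm c)\<^sup>2) * mixed_int M f"
proof -
  have *: "norm (c * z) + (norm (c * z))\<^sup>2 \<le> (1 + norm c)\<^sup>2 * (norm z + (norm z)\<^sup>2)" for z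
  proof -
    have "norm c \<le> (1 + norm c)\<^sup>2" "(norm c)\<^sup>2 \<le> (1 + norm c)\<^sup>2"
      by (auto simp: power2_sum intro: power_mono)
    then have "norm c * norm z + (norm c)\<^sup>2 * (norm z)\<^sup>2 \<le> (1 + norm c)\<^sup>2 * norm z + (1 + norm c)\<^sup>2 * (norm z)\<^sup>2"
      by (intro add_mono mult_right_mono) auto
    then show ?thesis by (simp add: norm_mult power_mult_distrib distrib_left)
  qed
  have "mixed_int M (\<lambda>x. c * f x) \<le> (\<integral>\<^sup>+ x. ennreal ((1 + norm c)\<^sup>2) * ennreal (norm (f x) + (norm (f x))\<^sup>2) \<partial>M)"
    unfolding mixed_int_def
    by (intro nn_integral_mono, subst ennreal_mult[symmetric]) (auto intro!: ennreal_leI * simp del: ennreal_plus)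
  also have "\<dots> = ennreal ((1 + norm c)\<^sup>2) * mixed_int M f"
    unfolding mixed_int_def by (rule nn_integral_cmult) measurable
  finally show ?thesis .
qed

lemma mixed_int_dominated_convergence:
  fixes f :: "'a \<Rightarrow> complex" and w :: "'a \<Rightarrow> complex"
  assumes [measurable]: "\<And>n. s n \<in> borel_measurable M" "f \<in> borel_measurable M" "w \<in> borel_measurable M"
    and lim: "\<And>x. x \<in> space M \<Longrightarrow> (\<lambda>n. s n x) \<longlonglongrightarrow> f x"
    and bound: "\<And>n x. x \<in> space M \<Longrightarrow> norm (s n x) \<le> norm (w x)"
    and w: "mixed_int M w < \<infinity>"
  shows "(\<lambda>n. mixed_int M (\<lambda>x. f x - s n x)) \<longlonglongrightarrow> 0"
proof -
  have le: "norm (f x - s n x) \<le> 2 * norm (w x)" if "x \<in> space M" for n x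
  proof -
    have "norm (f x) \<le> norm (w x)"
      by (rule LIMSEQ_le_const2[OF tendsto_norm[OF lim[OF that]]]) (use bound that in auto)
    then show ?thesis using norm_triangle_ineq4[of "f x" "s n x"] bound[OF that, of n] by linarith
  qed
  have "(\<lambda>n. mixed_int M (\<lambda>x. f x - s n x)) \<longlonglongrightarrow> (\<integral>\<^sup>+ x. 0 \<partial>M)"
    unfolding mixed_int_def
  \<comment> \<open>The difference is at most \<open>2 * norm (w x)\<close>; squaring costs the
    factor 4, which also covers the linear part.\<close>
  proof (rule nn_integral_dominated_convergence[where w = "\<lambda>x. ennreal 4 * ennreal (norm (w x) + (norm (w x))\<^sup>2)"])
    show "AE x in M. ennreal (norm (f x - s n x) + (norm (f x - s n x))\<^sup>2)
        \<le> ennreal 4 * ennreal (norm (w x) + (norm (w x))\<^sup>2)" for n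
    proof (rule AE_I2)
      fix x assume "x \<in> space M"
      from le[OF this, of n] power_mono[OF le[OF this, of n] norm_ge_zero, of 2]
      have "norm (f x - s n x) + (norm (f x - s n x))\<^sup>2 \<le> 4 * (norm (w x) + (norm (w x))\<^sup>2)"
        using norm_ge_zero[of "w x"] power_mult_distrib[of 2 "norm (w x)" 2]
        unfolding distrib_left by (simp del: norm_ge_zero)
      then show "ennreal (norm (f x - s n x) + (norm (f x - s n x))\<^sup>2)
        \<le> ennreal 4 * ennreal (norm (w x) + (norm (w x))\<^sup>2)"
        by (subst ennreal_mult[symmetric], simp, simp, intro ennreal_leI)
    qed
    have "(\<integral>\<^sup>+ x. ennreal 4 * ennreal (norm (w x) + (norm (w x))\<^sup>2) \<partial>M) = ennreal 4 * mixed_int M w"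
      unfolding mixed_int_def by (rule nn_integral_cmult) measurable
    then show "(\<integral>\<^sup>+ x. ennreal 4 * ennreal (norm (w x) + (norm (w x))\<^sup>2) \<partial>M) < \<infinity>"
      using w by (simp add: ennreal_mult_less_top)
    show "AE x in M. (\<lambda>n. ennreal (norm (f x - s n x) + (norm (f x - s n x))\<^sup>2)) \<longlonglongrightarrow> 0"
    proof (rule AE_I2)
      fix x assume "x \<in> space M"
      from lim[OF this] have "(\<lambda>n. f x - s n x) \<longlonglongrightarrow> f x - f x" by (intro tendsto_intros)
      then have "(\<lambda>n. ennreal (norm (f x - s n x) + (norm (f x - s n x))\<^sup>2)) \<longlonglongrightarrow> ennreal (norm (f x - f x) + (norm (f x - f x))\<^sup>2)"
        by (intro tendsto_ennrealI tendsto_add tendsto_power tendsto_norm)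
      then show "(\<lambda>n. ennreal (norm (f x - s n x) + (norm (f x - s n x))\<^sup>2)) \<longlonglongrightarrow> 0" by simp
    qed
  qed auto
  then show ?thesis by simp
qed

context cone_transform
begin

text \<open>The closure, for L1 and L2 simultaneously, of the functions \<open>p x * gauss x\<close>
  with tame \<open>p\<close>. Being closed under linear combinations and dominated limits, it
  supports a Dynkin argument.\<close>

definition approx :: "('a \<Rightarrow> complex) \<Rightarrow> bool" where
  "approx f \<longleftrightarrow> f \<in> borel_measurable \<mu> \<and>
     (\<forall>\<delta>>0. \<exists>p. tame p \<and> mixed_int \<mu> (\<lambda>x. f x - p x * gauss x) < ennreal \<delta>)"

lemma tame_gauss_measurable: "tame p \<Longrightarrow> (\<lambda>x. p x * gauss x) \<in> borel_measurable \<mu>"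
  by (intro schwartz_measurable schwartz_tame_gauss)

lemma approx_measurable: "approx f \<Longrightarrow> f \<in> borel_measurable \<mu>"
  by (simp add: approx_def)

lemma approx_tame_gauss: "tame p \<Longrightarrow> approx (\<lambda>x. p x * gauss x)"
  unfolding approx_def using tame_gauss_measurable by (auto simp: mixed_int_def intro!: exI[of _ p])

lemma approx_linear:
  assumes f: "approx f" and g: "approx g"
  shows "approx (\<lambda>x. f x + c * g x)"
  unfolding approx_def
proof (intro conjI allI impI)
  note [measurable] = approx_measurable[OF f] approx_measurable[OF g]
  show "(\<lambda>x. f x + c * g x) \<in> borel_measurable \<mu>" by measurable
  fix \<delta> :: real assume \<delta>: "\<delta> > 0"
  \<comment> \<open>Chosen so that, after the factors 2 and \<open>(1 + norm c)^2\<close>, each of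
    the two errors contributes \<open>\<delta> / 4\<close>.\<close>
  define e where "e = \<delta> / (8 * (1 + norm c)\<^sup>2)"
  have c1: "(1 + norm c)\<^sup>2 > 0"
    by (intro zero_less_power add_pos_nonneg) auto
  have e: "e > 0" using \<delta> c1 by (simp add: e_def)
  from f \<delta> obtain p where p: "tame p" "mixed_int \<mu> (\<lambda>x. f x - p x * gauss x) < ennreal (\<delta> / 8)"
    unfolding approx_def by (meson divide_pos_pos zero_less_numeral)
  from g e obtain q where q: "tame q" "mixed_int \<mu> (\<lambda>x. g x - q x * gauss x) < ennreal e"
    unfolding approx_def by meson
  note [measurable] = tame_gauss_measurable[OF p(1)] tame_gauss_measurable[OF q(1)]
  have "mixed_int \<mu> (\<lambda>x. (f x + c * g x) - (p x + c * q x) * gauss x)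
      = mixed_int \<mu> (\<lambda>x. (f x - p x * gauss x) + c * (g x - q x * gauss x))"
    by (simp add: algebra_simps)
  also have "\<dots> \<le> 2 * mixed_int \<mu> (\<lambda>x. f x - p x * gauss x) + 2 * mixed_int \<mu> (\<lambda>x. c * (g x - q x * gauss x))"
    by (rule mixed_int_add_le) measurable
  also have "\<dots> \<le> 2 * mixed_int \<mu> (\<lambda>x. f x - p x * gauss x)
      + 2 * (ennreal ((1 + norm c)\<^sup>2) * mixed_int \<mu> (\<lambda>x. g x - q x * gauss x))"
    by (intro add_left_mono mult_left_mono mixed_int_cmult_le) auto
  also have "\<dots> \<le> 2 * ennreal (\<delta> / 8) + 2 * (ennreal ((1 + norm c)\<^sup>2) * ennreal e)"
    using p(2) q(2) by (intro add_mono mult_left_mono) auto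
  also have "\<dots> = ennreal (2 * (\<delta> / 8) + 2 * ((1 + norm c)\<^sup>2 * e))"
    using \<delta> e by (subst ennreal_plus) (auto simp: ennreal_mult simp del: ennreal_plus times_divide_eq_right)
  also have "2 * (\<delta> / 8) + 2 * ((1 + norm c)\<^sup>2 * e) = \<delta> / 2"
    using c1 by (simp add: e_def field_simps)
  also have "ennreal (\<delta> / 2) < ennreal \<delta>"
    using \<delta> by (intro ennreal_lessI) auto
  finally show "\<exists>p. tame p \<and> mixed_int \<mu> (\<lambda>x. f x + c * g x - p x * gauss x) < ennreal \<delta>"
    by (intro exI[of _ "\<lambda>x. p x + c * q x"] conjI tame_add tame_mult tame_const p q)
qed

lemma approx_limit:
  assumes f[measurable]: "f \<in> borel_measurable \<mu>" and s: "\<And>n. approx (s n)"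
    and lim: "(\<lambda>n. mixed_int \<mu> (\<lambda>x. f x - s n x)) \<longlonglongrightarrow> 0"
  shows "approx f"
  unfolding approx_def
proof (intro conjI allI impI f)
  fix \<delta> :: real assume \<delta>: "\<delta> > 0"
  from lim \<delta> have "eventually (\<lambda>n. mixed_int \<mu> (\<lambda>x. f x - s n x) < ennreal (\<delta> / 8)) sequentially"
    unfolding tendsto_zero_ennreal_iff by simp
  then obtain n where n: "mixed_int \<mu> (\<lambda>x. f x - s n x) < ennreal (\<delta> / 8)"
    unfolding eventually_sequentially by blast
  from s[of n] \<delta> obtain p where p: "tame p" "mixed_int \<mu> (\<lambda>x. s n x - p x * gauss x) < ennreal (\<delta> / 8)"
    unfolding approx_def by (meson divide_pos_pos zero_less_numeral)
  note [measurable] = tame_gauss_measurable[OF p(1)] approx_measurable[OF s]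
  have "mixed_int \<mu> (\<lambda>x. f x - p x * gauss x) = mixed_int \<mu> (\<lambda>x. (f x - s n x) + (s n x - p x * gauss x))"
    by simp
  also have "\<dots> \<le> 2 * mixed_int \<mu> (\<lambda>x. f x - s n x) + 2 * mixed_int \<mu> (\<lambda>x. s n x - p x * gauss x)"
    by (rule mixed_int_add_le) measurable
  also have "\<dots> \<le> 2 * ennreal (\<delta> / 8) + 2 * ennreal (\<delta> / 8)"
    using p(2) n by (intro add_mono mult_left_mono) auto
  also have "\<dots> = ennreal (2 * (\<delta> / 8) + 2 * (\<delta> / 8))"
    using \<delta> by (subst ennreal_plus) (auto simp: ennreal_mult'[of 2] simp del: ennreal_plus times_divide_eq_right)
  also have "\<dots> < ennreal \<delta>"
    using \<delta> by (intro ennreal_lessI) auto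
  finally show "\<exists>p. tame p \<and> mixed_int \<mu> (\<lambda>x. f x - p x * gauss x) < ennreal \<delta>"
    using p(1) by auto
qed

lemma approx_dominated:
  assumes s: "\<And>n. approx (s n)" and f[measurable]: "f \<in> borel_measurable \<mu>" "w \<in> borel_measurable \<mu>"
    and "\<And>x. x \<in> \<Omega> \<Longrightarrow> (\<lambda>n. s n x) \<longlonglongrightarrow> f x"
    and "\<And>n x. x \<in> \<Omega> \<Longrightarrow> norm (s n x) \<le> norm (w x)"
    and "mixed_int \<mu> w < \<infinity>"
  shows "approx f"
  by (rule approx_limit[OF f(1) s], rule mixed_int_dominated_convergence[where w = w])
     (use assms approx_measurable in \<open>auto simp: space_mu\<close>)

lemma mixed_int_schwartz: "schwartz f \<Longrightarrow> mixed_int \<mu> f < \<infinity>"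
  using schwartz_integrable[of f] schwartz_sq_int[of f]
  by (subst mixed_int_eq) (auto simp: integrable_iff_bounded)

lemma schwartz_gauss: "schwartz gauss"
  using schwartz_tame_gauss[OF tame_const[of 1]] by simp

lemma gauss_measurable[measurable]: "gauss \<in> borel_measurable \<mu>"
  by (rule schwartz_measurable[OF schwartz_gauss])

lemma approx_gauss: "approx gauss"
  using approx_tame_gauss[OF tame_const[of 1]] by simp

section \<open>From boxes to all functions in L1 and L2\<close>

text \<open>Open boxes generate the Borel sets and are stable under intersection. Complements work
  because \<open>gauss\<close> itself is approximable, so subtraction stays in the class; disjoint
  unions work because \<open>gauss\<close> is a common majorant.\<close>

lemma approx_indicator_gauss:
  assumes "A \<in> sets borel"
  shows "approx (\<lambda>x. indicator A x * gauss x)"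
proof -
  have meas: "(\<lambda>x. indicator A x * gauss x) \<in> borel_measurable \<mu>" if "A \<in> sets borel" for A
    using that by (intro borel_measurable_times gauss_measurable borel_measurable_mu borel_measurable_indicator)
  have bound: "norm (z * gauss x) \<le> norm (gauss x :: complex)" if "norm z \<le> 1" for z :: complex and x :: 'a
    using mult_right_mono[OF that norm_ge_zero[of "gauss x"]] by (simp add: norm_mult)
  let ?G = "range (\<lambda>(a, b). box a b :: 'a set)"
  have "Int_stable ?G" by (auto simp: Int_stable_def box_Int_box)
  moreover have "?G \<subseteq> Pow UNIV" by simp
  moreover have "A \<in> sigma_sets UNIV ?G"
    using assms unfolding borel_eq_box by simp
  ultimately show ?thesis
  proof (induction rule: sigma_sets_induct_disjoint)
    case (basic A)
    then obtain a b where A: "A = box a b" by auto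
    show ?case
    proof (rule approx_dominated[where s = "\<lambda>n x. box_fun a b n x * gauss x" and w = gauss])
      show "(\<lambda>n. box_fun a b n x * gauss x) \<longlonglongrightarrow> indicator A x * gauss x" for x
        unfolding A by (intro tendsto_mult tendsto_const box_fun_tendsto)
    qed (auto simp: A tame_box_fun intro!: approx_tame_gauss bound norm_box_fun_le meas
           mixed_int_schwartz[unfolded infinity_ennreal_def] schwartz_gauss)
  next
    case empty
    show ?case using approx_tame_gauss[OF tame_const[of 0]] by simp
  next
    case (compl A)
    have "(\<lambda>x. indicator (UNIV - A) x * gauss x) = (\<lambda>x. gauss x + (- 1) * (indicator A x * gauss x))"
      by (auto split: split_indicator)
    then show ?case using approx_linear[OF approx_gauss compl(2), of "-1"] by simp
  next
    case (union A)
    have A: "A n \<in> sets borel" for n using union(2) unfolding borel_eq_box by auto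
    have "approx (\<lambda>x. (\<Sum>i<n. indicator (A i) x) * gauss x)" for n
    proof (induction n)
      case 0
      show ?case using approx_tame_gauss[OF tame_const[of 0]] by simp
    next
      case (Suc n)
      from approx_linear[OF this union(3)[of n], of 1] show ?case by (simp add: algebra_simps)
    qed
    then show ?case
    proof (rule approx_dominated[where w = gauss])
      \<comment> \<open>Disjointness turns the partial sums into indicators of finite unions,
        bounded by 1, so that \<open>gauss\<close> dominates all of them.\<close>
      have *: "(\<Sum>i<n. indicator (A i) x) = (indicator (\<Union>i<n. A i) x :: complex)" for n x
        by (rule indicator_UN_disjoint[symmetric]) (use union(1) in \<open>auto simp: disjoint_family_on_def\<close>)
      show "norm ((\<Sum>i<n. indicator (A i) x) * gauss x) \<le> norm (gauss x :: complex)" for n x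
        unfolding * by (rule bound) (simp split: split_indicator)
      show "(\<lambda>n. (\<Sum>i<n. indicator (A i) x) * gauss x) \<longlonglongrightarrow> indicator (\<Union>(range A)) x * gauss x" for x
        unfolding * by (intro tendsto_mult tendsto_const LIMSEQ_indicator_UN)
    qed (use A in \<open>auto intro!: meas mixed_int_schwartz[unfolded infinity_ennreal_def] schwartz_gauss\<close>)
  qed
qed

lemma approx_sum:
  assumes "finite I" "\<And>i. i \<in> I \<Longrightarrow> approx (f i)"
  shows "approx (\<lambda>x. \<Sum>i\<in>I. c i * f i x)"
  using assms
proof (induction I rule: finite_induct)
  case empty
  show ?case using approx_tame_gauss[OF tame_const[of 0]] by simp
next
  case (insert i I)
  then have "approx (\<lambda>x. (\<Sum>i\<in>I. c i * f i x) + c i * f i x)"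
    by (intro approx_linear) auto
  with insert.hyps show ?case by (simp add: add.commute)
qed

text \<open>Values off \<open>\<Omega>\<close> are invisible to \<open>\<mu>\<close>. This lets a
  measurable subset of \<open>\<Omega>\<close>, which is only the trace of a Borel set, be replaced
  by that Borel set.\<close>

lemma approx_cong:
  assumes "approx f" "\<And>x. x \<in> \<Omega> \<Longrightarrow> f x = g x"
  shows "approx g"
proof -
  have "g \<in> borel_measurable \<mu>"
    using approx_measurable[OF assms(1)] assms(2) measurable_cong[of \<mu> f g] by (simp add: space_mu)
  moreover have "mixed_int \<mu> (\<lambda>x. g x - f x) = (\<integral>\<^sup>+ x. 0 \<partial>\<mu>)"
    unfolding mixed_int_def by (rule nn_integral_cong) (simp add: assms(2) space_mu)
  ultimately show ?thesis
    using approx_limit[of g "\<lambda>_. f"] assms(1) by simp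
qed

lemma approx_simple_gauss:
  assumes s: "simple_function \<mu> s"
  shows "approx (\<lambda>x. s x * gauss x)"
proof (rule approx_cong)
  show "approx (\<lambda>x. \<Sum>y\<in>s ` space \<mu>. y * (indicator (s -` {y} \<inter> space \<mu>) x * gauss x))"
  proof (rule approx_sum)
    show "finite (s ` space \<mu>)" using s by (simp add: simple_function_def)
    fix y assume "y \<in> s ` space \<mu>"
    have "s -` {y} \<inter> space \<mu> \<in> sets \<mu>" by (rule simple_functionD(2)[OF s])
    then obtain A where A: "A \<in> sets borel" "s -` {y} \<inter> space \<mu> = A \<inter> \<Omega>"
      unfolding sets_mu sets_restrict_space by auto
    show "approx (\<lambda>x. indicator (s -` {y} \<inter> space \<mu>) x * gauss x)"
      by (rule approx_cong[OF approx_indicator_gauss[OF A(1)]]) (auto simp: A(2) split: split_indicator)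
  qed
  show "(\<Sum>y\<in>s ` space \<mu>. y * (indicator (s -` {y} \<inter> space \<mu>) x * gauss x)) = s x * gauss x"
    if "x \<in> \<Omega>" for x
  proof -
    have "s x = (\<Sum>y\<in>s ` space \<mu>. indicator (s -` {y} \<inter> space \<mu>) x *\<^sub>R y)"
      using that by (intro simple_function_indicator_representation_banach[OF s]) (simp add: space_mu)
    then have "s x * gauss x = (\<Sum>y\<in>s ` space \<mu>. (indicator (s -` {y} \<inter> space \<mu>) x *\<^sub>R y) * gauss x)"
      by (simp only: sum_distrib_right)
    also have "\<dots> = (\<Sum>y\<in>s ` space \<mu>. y * (indicator (s -` {y} \<inter> space \<mu>) x * gauss x))"
      by (intro sum.cong) (auto split: split_indicator)
    finally show ?thesis by simp
  qed
qed

text \<open>The Gaussian has no zeros, so \<open>f x / gauss x\<close> is a limit of simple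
  functions dominated by twice its norm. Multiplying back by \<open>gauss\<close> gives approximable
  functions with majorant \<open>2 * f x\<close>, which is integrable in the mixed sense.\<close>

lemma approx_mixed:
  assumes f[measurable]: "f \<in> borel_measurable \<mu>" and fin: "mixed_int \<mu> f < \<infinity>"
  shows "approx f"
proof -
  have g0: "gauss x \<noteq> 0" for x :: 'a unfolding gauss_def by simp
  have "(\<lambda>x. f x / gauss x) \<in> borel_measurable \<mu>" by measurable
  from borel_measurable_implies_sequence_metric[OF this, of 0] obtain s where
    s': "\<forall>i. simple_function \<mu> (s i)" "\<forall>x\<in>space \<mu>. (\<lambda>i. s i x) \<longlonglongrightarrow> f x / gauss x"
      "\<forall>i. \<forall>x\<in>space \<mu>. dist (s i x) 0 \<le> 2 * dist (f x / gauss x) 0" by blast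
  then have s: "\<And>i. simple_function \<mu> (s i)" "\<And>x. x \<in> \<Omega> \<Longrightarrow> (\<lambda>i. s i x) \<longlonglongrightarrow> f x / gauss x"
      "\<And>i x. x \<in> \<Omega> \<Longrightarrow> norm (s i x) \<le> 2 * norm (f x / gauss x)"
    by (simp_all add: space_mu)
  show ?thesis
  proof (rule approx_dominated[where s = "\<lambda>n x. s n x * gauss x" and w = "\<lambda>x. 2 * f x"])
    show "approx (\<lambda>x. s n x * gauss x)" for n by (rule approx_simple_gauss[OF s(1)])
    show "(\<lambda>n. s n x * gauss x) \<longlonglongrightarrow> f x" if "x \<in> \<Omega>" for x
      using tendsto_mult[OF s(2)[OF that] tendsto_const[of "gauss x"]] g0 by simp
    show "norm (s n x * gauss x) \<le> norm (2 * f x)" if "x \<in> \<Omega>" for n x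
      using mult_right_mono[OF s(3)[OF that, of n] norm_ge_zero[of "gauss x"]] g0[of x]
      by (simp add: norm_mult norm_divide)
    show "mixed_int \<mu> (\<lambda>x. 2 * f x) < \<infinity>"
      by (rule le_less_trans[OF mixed_int_cmult_le[OF f]]) (use fin in \<open>simp add: ennreal_mult_less_top\<close>)
  qed measurable
qed

end

section \<open>The unitary extension\<close>

lemma tendsto_0_ennreal_bound:
  fixes u v w :: "'b \<Rightarrow> ennreal"
  assumes v: "(v \<longlongrightarrow> 0) F" and w: "(w \<longlongrightarrow> 0) F" and le: "\<And>n. u n \<le> ennreal a * v n + ennreal b * w n"
  shows "(u \<longlongrightarrow> 0) F"
proof (rule tendsto_sandwich[where f = "\<lambda>_. 0" and h = "\<lambda>n. ennreal a * v n + ennreal b * w n"])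
  have "((\<lambda>n. ennreal a * v n + ennreal b * w n) \<longlongrightarrow> ennreal a * 0 + ennreal b * 0) F"
    by (intro tendsto_add ennreal_tendsto_cmult v w) auto
  then show "((\<lambda>n. ennreal a * v n + ennreal b * w n) \<longlongrightarrow> 0) F" by simp
  show "((\<lambda>_. 0) \<longlongrightarrow> (0::ennreal)) F" by simp
qed (use le in \<open>auto intro!: always_eventually\<close>)

lemma LIMSEQ_ennreal_quarter_power: "(\<lambda>n. ennreal (c * (1/4) ^ n)) \<longlonglongrightarrow> 0"
proof -
  have "(\<lambda>n. c * (1/4::real) ^ n) \<longlonglongrightarrow> c * 0"
    by (intro tendsto_intros LIMSEQ_power_zero) auto
  from tendsto_ennrealI[OF this] show ?thesis by simp
qed

context cone_transform
begin

abbreviation "U \<equiv> L2_transform \<mu> K"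
abbreviation "T \<equiv> int_transform \<mu> K"

text \<open>The property under the choice operator of \<open>L2_transform\<close>, with squares in
  place of norms. As a relation it can be shown to be isometric, linear, single-valued and total
  before anything is known about the chosen value.\<close>

definition L2_rel :: "('a \<Rightarrow> complex) \<Rightarrow> ('a \<Rightarrow> complex) \<Rightarrow> bool" where
  "L2_rel f g \<longleftrightarrow> g \<in> Lp_space 2 \<mu> \<and> (\<exists>\<phi>::nat \<Rightarrow> 'a \<Rightarrow> complex. (\<forall>n. schwartz (\<phi> n)) \<and>
     (\<lambda>n. sq_int \<mu> (\<lambda>x. \<phi> n x - f x)) \<longlonglongrightarrow> 0 \<and> (\<lambda>n. sq_int \<mu> (\<lambda>\<xi>. T (\<phi> n) \<xi> - g \<xi>)) \<longlonglongrightarrow> 0)"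

lemma L2_transform_eq_Eps: "U f = (SOME g. L2_rel f g)"
  unfolding L2_transform_def L2_rel_def Lp_norm_2_tendsto_0_iff ..

lemma T_schwartz_measurable: "schwartz f \<Longrightarrow> T f \<in> borel_measurable \<mu>"
  by (intro int_transform_measurable schwartz_integrable)

lemma L2_measurable: "f \<in> Lp_space 2 \<mu> \<Longrightarrow> f \<in> borel_measurable \<mu>"
  by (simp add: Lp_space_def)

text \<open>The transform preserves the norm on each approximant, and
  \<open>sq_int_le_of_limits\<close> is applied once in each direction.\<close>

lemma L2_rel_isometry:
  assumes "L2_rel f g" and f: "f \<in> borel_measurable \<mu>"
  shows "sq_int \<mu> g = sq_int \<mu> f"
proof -
  obtain \<phi> :: "nat \<Rightarrow> 'a \<Rightarrow> complex" where \<phi>: "\<And>n. schwartz (\<phi> n)"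
    and lim: "(\<lambda>n. sq_int \<mu> (\<lambda>x. \<phi> n x - f x)) \<longlonglongrightarrow> 0" "(\<lambda>n. sq_int \<mu> (\<lambda>\<xi>. T (\<phi> n) \<xi> - g \<xi>)) \<longlonglongrightarrow> 0"
    and g: "g \<in> borel_measurable \<mu>"
    using assms(1) unfolding L2_rel_def by (auto intro: L2_measurable)
  note m = schwartz_measurable[OF \<phi>] T_schwartz_measurable[OF \<phi>]
  note eq = int_transform_schwartz_isometry[OF \<phi>]
  show ?thesis
    by (rule antisym[OF sq_int_le_of_limits[OF m(1) m(2) f g eq lim]
          sq_int_le_of_limits[OF m(2) m(1) g f eq[symmetric] lim(2,1)]])
qed

lemma L2_rel_linear:
  assumes fg: "L2_rel f g" and fg': "L2_rel f' g'"
    and f[measurable]: "f \<in> borel_measurable \<mu>" "f' \<in> borel_measurable \<mu>"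
  shows "L2_rel (\<lambda>x. f x + c * f' x) (\<lambda>x. g x + c * g' x)"
proof -
  obtain \<phi> :: "nat \<Rightarrow> 'a \<Rightarrow> complex" where \<phi>: "\<And>n. schwartz (\<phi> n)"
    and lim: "(\<lambda>n. sq_int \<mu> (\<lambda>x. \<phi> n x - f x)) \<longlonglongrightarrow> 0" "(\<lambda>n. sq_int \<mu> (\<lambda>\<xi>. T (\<phi> n) \<xi> - g \<xi>)) \<longlonglongrightarrow> 0"
    and g: "g \<in> Lp_space 2 \<mu>"
    using fg unfolding L2_rel_def by auto
  obtain \<psi> :: "nat \<Rightarrow> 'a \<Rightarrow> complex" where \<psi>: "\<And>n. schwartz (\<psi> n)"
    and lim': "(\<lambda>n. sq_int \<mu> (\<lambda>x. \<psi> n x - f' x)) \<longlonglongrightarrow> 0" "(\<lambda>n. sq_int \<mu> (\<lambda>\<xi>. T (\<psi> n) \<xi> - g' \<xi>)) \<longlonglongrightarrow> 0"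
    and g': "g' \<in> Lp_space 2 \<mu>"
    using fg' unfolding L2_rel_def by auto
  note [measurable] = schwartz_measurable[OF \<phi>] T_schwartz_measurable[OF \<phi>] L2_measurable[OF g]
    schwartz_measurable[OF \<psi>] T_schwartz_measurable[OF \<psi>] L2_measurable[OF g']
  have comb: "(\<lambda>n. sq_int \<mu> (\<lambda>x. (u n x + c * v n x) - (h x + c * k x))) \<longlonglongrightarrow> 0"
    if "(\<lambda>n. sq_int \<mu> (\<lambda>x. u n x - h x)) \<longlonglongrightarrow> 0" "(\<lambda>n. sq_int \<mu> (\<lambda>x. v n x - k x)) \<longlonglongrightarrow> 0"
      and [measurable]: "\<And>n. u n \<in> borel_measurable \<mu>" "\<And>n. v n \<in> borel_measurable \<mu>"
        "h \<in> borel_measurable \<mu>" "k \<in> borel_measurable \<mu>"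
    for u v :: "nat \<Rightarrow> 'a \<Rightarrow> complex" and h k
  proof (rule tendsto_0_ennreal_bound[OF that(1,2), where a = 2 and b = "2 * (norm c)\<^sup>2"])
    fix n
    have "sq_int \<mu> (\<lambda>x. (u n x + c * v n x) - (h x + c * k x)) = sq_int \<mu> (\<lambda>x. (u n x - h x) + c * (v n x - k x))"
      by (simp add: algebra_simps)
    also have "\<dots> \<le> 2 * sq_int \<mu> (\<lambda>x. u n x - h x) + 2 * sq_int \<mu> (\<lambda>x. c * (v n x - k x))"
      by (rule sq_int_add_le) measurable
    also have "\<dots> = ennreal 2 * sq_int \<mu> (\<lambda>x. u n x - h x) + ennreal (2 * (norm c)\<^sup>2) * sq_int \<mu> (\<lambda>x. v n x - k x)"
      by (subst sq_int_cmult) (auto simp: ennreal_mult mult.assoc)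
    finally show "sq_int \<mu> (\<lambda>x. (u n x + c * v n x) - (h x + c * k x)) \<le>
      ennreal 2 * sq_int \<mu> (\<lambda>x. u n x - h x) + ennreal (2 * (norm c)\<^sup>2) * sq_int \<mu> (\<lambda>x. v n x - k x)" .
  qed
  have "sq_int \<mu> (\<lambda>\<xi>. T (\<lambda>x. \<phi> n x + c * \<psi> n x) \<xi> - (g \<xi> + c * g' \<xi>))
      = sq_int \<mu> (\<lambda>\<xi>. (T (\<phi> n) \<xi> + c * T (\<psi> n) \<xi>) - (g \<xi> + c * g' \<xi>))" for n
    by (rule sq_int_cong_AE, rule AE_I2)
       (simp add: space_mu int_transform_linear[OF schwartz_integrable[OF \<phi>] schwartz_integrable[OF \<psi>]])
  then have "(\<lambda>n. sq_int \<mu> (\<lambda>\<xi>. T (\<lambda>x. \<phi> n x + c * \<psi> n x) \<xi> - (g \<xi> + c * g' \<xi>))) \<longlonglongrightarrow> 0"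
    using comb[OF lim(2) lim'(2)] by simp
  moreover have "(\<lambda>n. sq_int \<mu> (\<lambda>x. (\<phi> n x + c * \<psi> n x) - (f x + c * f' x))) \<longlonglongrightarrow> 0"
    by (rule comb[OF lim(1) lim'(1)]) measurable
  moreover have "(\<lambda>x. g x + c * g' x) \<in> Lp_space 2 \<mu>"
    unfolding Lp_space_2_iff_sq_int
  proof
    have "sq_int \<mu> (\<lambda>x. g x + c * g' x) \<le> 2 * sq_int \<mu> g + 2 * sq_int \<mu> (\<lambda>x. c * g' x)"
      by (rule sq_int_add_le) measurable
    also have "\<dots> < \<infinity>"
      using g g' by (subst sq_int_cmult) (auto simp: Lp_space_2_iff_sq_int ennreal_mult_less_top)
    finally show "sq_int \<mu> (\<lambda>x. g x + c * g' x) < \<infinity>" .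
  qed measurable
  ultimately show ?thesis
    unfolding L2_rel_def by (intro conjI exI[of _ "\<lambda>n x. \<phi> n x + c * \<psi> n x"]) (auto intro: schwartz_linear \<phi> \<psi>)
qed

text \<open>By linearity the difference of two images is an image of \<open>f - f\<close>, and the
  isometry makes its norm 0.\<close>

lemma L2_rel_unique:
  assumes fg: "L2_rel f g" and fg': "L2_rel f g'" and f: "f \<in> borel_measurable \<mu>"
  shows "AE x in \<mu>. g x = g' x"
proof -
  note [measurable] = L2_measurable[of g] L2_measurable[of g']
  have g: "g \<in> Lp_space 2 \<mu>" "g' \<in> Lp_space 2 \<mu>" using fg fg' by (auto simp: L2_rel_def)
  have "L2_rel (\<lambda>x. f x + (-1) * f x) (\<lambda>x. g x + (-1) * g' x)"
    by (rule L2_rel_linear[OF fg fg' f f])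
  then have "sq_int \<mu> (\<lambda>x. g x + (-1) * g' x) = sq_int \<mu> (\<lambda>x. f x + (-1) * f x)"
    by (rule L2_rel_isometry) (use f in measurable)
  also have "\<dots> = 0" by (simp add: sq_int_def)
  finally have "AE x in \<mu>. g x + (-1) * g' x = 0"
    by (subst (asm) sq_int_eq_0_iff) (use g in \<open>auto intro!: L2_measurable borel_measurable_diff\<close>)
  then show ?thesis by eventually_elim simp
qed

lemma L2_rel_cong_AE:
  assumes "L2_rel f g" "AE x in \<mu>. f x = f' x"
  shows "L2_rel f' g"
proof -
  have "sq_int \<mu> (\<lambda>x. \<phi> x - f x) = sq_int \<mu> (\<lambda>x. \<phi> x - f' x)" for \<phi>
    by (rule sq_int_cong_AE) (use assms(2) in auto)
  then show ?thesis using assms(1) unfolding L2_rel_def by simp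
qed

section \<open>Density in L2 and existence of the extension\<close>

text \<open>Balls have finite measure, so Cauchy-Schwarz turns square integrability into
  integrability on them.\<close>

lemma ball_truncation_mixed:
  assumes f: "f \<in> Lp_space 2 \<mu>" and r: "r > 0"
  shows "mixed_int \<mu> (\<lambda>x. indicator (ball 0 r \<inter> \<Omega>) x * f x) < \<infinity>"
proof -
  have fm[measurable]: "f \<in> borel_measurable \<mu>" and fin: "sq_int \<mu> f < \<infinity>"
    using f by (auto simp: Lp_space_2_iff_sq_int)
  have B[measurable]: "ball 0 r \<inter> \<Omega> \<in> sets \<mu>" by (rule sets_mu_Int) simp
  obtain \<kappa> where "\<forall>r>0. emeasure \<mu> (ball 0 r \<inter> \<Omega>) \<le> ennreal (\<kappa> * r powr (2 * a))"
    using emeasure_ball_le by blast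
  with r have "emeasure \<mu> (ball 0 r \<inter> \<Omega>) < \<infinity>"
    by (metis ennreal_less_top infinity_ennreal_def order_le_less_trans)
  then have "(\<integral>\<^sup>+ x. ennreal (norm (f x)) * indicator (ball 0 r \<inter> \<Omega>) x \<partial>\<mu>)\<^sup>2 < \<infinity>"
    using fin by (intro le_less_trans[OF nn_integral_power2_le_sq_int[OF fm B]]) (simp add: ennreal_mult_less_top)
  then have "(\<integral>\<^sup>+ x. ennreal (norm (f x)) * indicator (ball 0 r \<inter> \<Omega>) x \<partial>\<mu>) < \<infinity>"
    by (auto simp: power2_eq_square ennreal_mult_less_top)
  moreover have "(\<integral>\<^sup>+ x. ennreal (norm (indicator (ball 0 r \<inter> \<Omega>) x * f x)) \<partial>\<mu>)
      = (\<integral>\<^sup>+ x. ennreal (norm (f x)) * indicator (ball 0 r \<inter> \<Omega>) x \<partial>\<mu>)"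
    by (intro nn_integral_cong) (auto split: split_indicator)
  moreover have "sq_int \<mu> (\<lambda>x. indicator (ball 0 r \<inter> \<Omega>) x * f x) < \<infinity>"
    using fin by (rule le_less_trans[OF sq_int_indicator_le])
  ultimately show ?thesis by (subst mixed_int_eq) auto
qed

lemma schwartz_dense_mixed:
  assumes "f \<in> borel_measurable \<mu>" "mixed_int \<mu> f < \<infinity>" "\<delta> > 0"
  obtains \<phi> :: "'a \<Rightarrow> complex" where "schwartz \<phi>" "mixed_int \<mu> (\<lambda>x. f x - \<phi> x) < ennreal \<delta>"
  using approx_mixed[OF assms(1,2)] assms(3) schwartz_tame_gauss unfolding approx_def by blast

lemma sq_int_le_mixed_int: "sq_int M f \<le> mixed_int M f"
  unfolding sq_int_def mixed_int_def by (intro nn_integral_mono ennreal_leI) auto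

text \<open>A function in L2 need not be integrable, so it is first cut off to a large ball, where
  the mixed density result applies.\<close>

lemma schwartz_dense_L2:
  assumes f: "f \<in> Lp_space 2 \<mu>" and \<delta>: "\<delta> > 0"
  obtains \<phi> :: "'a \<Rightarrow> complex" where "schwartz \<phi>" "sq_int \<mu> (\<lambda>x. f x - \<phi> x) < ennreal \<delta>"
proof -
  have fm[measurable]: "f \<in> borel_measurable \<mu>" and fin: "sq_int \<mu> f < \<infinity>"
    using f by (auto simp: Lp_space_2_iff_sq_int)
  \<comment> \<open>The radius \<open>Suc n\<close> is positive for every \<open>n\<close>, and once
    \<open>n\<close> reaches the ceiling of \<open>norm x\<close> the open ball contains
    \<open>x\<close>.\<close>
  define B where "B n = ball 0 (real (Suc n)) \<inter> \<Omega>" for n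
  have B[measurable]: "B n \<in> sets \<mu>" for n unfolding B_def by (rule sets_mu_Int) simp
  have "(\<lambda>n. sq_int \<mu> (\<lambda>x. f x - indicator (B n) x * f x)) \<longlonglongrightarrow> (\<integral>\<^sup>+ x. 0 \<partial>\<mu>)"
    unfolding sq_int_def
  proof (rule nn_integral_dominated_convergence[where w = "\<lambda>x. ennreal ((norm (f x))\<^sup>2)"])
    show "AE x in \<mu>. ennreal ((norm (f x - indicator (B n) x * f x))\<^sup>2) \<le> ennreal ((norm (f x))\<^sup>2)" for n
      by (intro AE_I2) (auto split: split_indicator)
    show "AE x in \<mu>. (\<lambda>n. ennreal ((norm (f x - indicator (B n) x * f x))\<^sup>2)) \<longlonglongrightarrow> 0"
    proof (intro AE_I2 tendsto_eventually)
      fix x assume "x \<in> space \<mu>"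
      then have "norm (f x - indicator (B n) x * f x) = 0" if "nat \<lceil>norm x\<rceil> \<le> n" for n
        using that by (auto simp: space_mu B_def split: split_indicator)
      then show "\<forall>\<^sub>F n in sequentially. ennreal ((norm (f x - indicator (B n) x * f x))\<^sup>2) = 0"
        by (intro eventually_sequentiallyI[of "nat \<lceil>norm x\<rceil>"]) simp
    qed
  qed (use fin in \<open>auto simp: sq_int_def\<close>)
  then have lim: "(\<lambda>n. sq_int \<mu> (\<lambda>x. f x - indicator (B n) x * f x)) \<longlonglongrightarrow> 0" by simp
  have "eventually (\<lambda>n. sq_int \<mu> (\<lambda>x. f x - indicator (B n) x * f x) < ennreal (\<delta> / 8)) sequentially"
    by (rule lim[unfolded tendsto_zero_ennreal_iff, rule_format]) (use \<delta> in simp)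
  then obtain n where n: "sq_int \<mu> (\<lambda>x. f x - indicator (B n) x * f x) < ennreal (\<delta> / 8)"
    unfolding eventually_sequentially by blast
  have fB[measurable]: "(\<lambda>x. indicator (B n) x * f x) \<in> borel_measurable \<mu>"
    by measurable
  obtain \<phi> :: "'a \<Rightarrow> complex" where \<phi>: "schwartz \<phi>"
    "mixed_int \<mu> (\<lambda>x. indicator (B n) x * f x - \<phi> x) < ennreal (\<delta> / 8)"
    using schwartz_dense_mixed[OF fB, of "\<delta> / 8"] ball_truncation_mixed[OF f, of "real (Suc n)"] \<delta>
    unfolding B_def by auto
  note [measurable] = schwartz_measurable[OF \<phi>(1)]
  have "sq_int \<mu> (\<lambda>x. f x - \<phi> x)
      = sq_int \<mu> (\<lambda>x. (f x - indicator (B n) x * f x) + (indicator (B n) x * f x - \<phi> x))" by simp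
  also have "\<dots> \<le> 2 * sq_int \<mu> (\<lambda>x. f x - indicator (B n) x * f x) + 2 * sq_int \<mu> (\<lambda>x. indicator (B n) x * f x - \<phi> x)"
    by (rule sq_int_add_le) measurable
  also have "\<dots> \<le> 2 * ennreal (\<delta> / 8) + 2 * ennreal (\<delta> / 8)"
    using n order.strict_implies_order[OF le_less_trans[OF sq_int_le_mixed_int \<phi>(2)]]
    by (intro add_mono mult_left_mono) auto
  also have "\<dots> = ennreal (2 * (\<delta> / 8) + 2 * (\<delta> / 8))"
    using \<delta> by (subst ennreal_plus) (auto simp: ennreal_mult'[of 2] simp del: ennreal_plus times_divide_eq_right)
  also have "\<dots> < ennreal \<delta>"
    using \<delta> by (intro ennreal_lessI) auto
  finally show ?thesis using that \<phi>(1) by blast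
qed

text \<open>The isometry on Schwartz functions carries the rate from the approximants to their
  transforms; the factor 4 comes from the triangle inequality through \<open>f\<close>.\<close>

lemma T_fast_Cauchy:
  fixes \<phi> :: "nat \<Rightarrow> 'a \<Rightarrow> complex"
  assumes \<phi>: "\<And>n. schwartz (\<phi> n)" and f[measurable]: "f \<in> borel_measurable \<mu>"
    and le: "\<And>n. sq_int \<mu> (\<lambda>x. f x - \<phi> n x) \<le> ennreal ((1/4) ^ n)" and "n \<le> m"
  shows "sq_int \<mu> (\<lambda>\<xi>. T (\<phi> m) \<xi> - T (\<phi> n) \<xi>) \<le> ennreal (4 * (1/4) ^ n)"
proof -
  note [measurable] = schwartz_measurable[OF \<phi>]
  have "sq_int \<mu> (\<lambda>\<xi>. T (\<phi> m) \<xi> - T (\<phi> n) \<xi>) = sq_int \<mu> (T (\<lambda>x. \<phi> m x + (-1) * \<phi> n x))"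
    by (rule sq_int_cong_AE, rule AE_I2)
       (simp only: space_mu int_transform_linear[OF schwartz_integrable[OF \<phi>] schwartz_integrable[OF \<phi>]], simp)
  also have "\<dots> = sq_int \<mu> (\<lambda>x. \<phi> m x + (-1) * \<phi> n x)"
    by (intro int_transform_schwartz_isometry schwartz_linear \<phi>)
  also have "\<dots> = sq_int \<mu> (\<lambda>x. (\<phi> m x - f x) + (f x - \<phi> n x))" by simp
  also have "\<dots> \<le> 2 * sq_int \<mu> (\<lambda>x. \<phi> m x - f x) + 2 * sq_int \<mu> (\<lambda>x. f x - \<phi> n x)"
    by (rule sq_int_add_le) measurable
  also have "\<dots> \<le> 2 * ennreal ((1/4) ^ n) + 2 * ennreal ((1/4) ^ n)"
  proof (intro add_mono mult_left_mono le)
    have "sq_int \<mu> (\<lambda>x. \<phi> m x - f x) \<le> ennreal ((1/4) ^ m)"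
      using le[of m] by (simp only: sq_int_minus_commute[of \<mu> f])
    also have "\<dots> \<le> ennreal ((1/4) ^ n)"
      using \<open>n \<le> m\<close> by (intro ennreal_leI power_decreasing) auto
    finally show "sq_int \<mu> (\<lambda>x. \<phi> m x - f x) \<le> ennreal ((1/4) ^ n)" .
  qed auto
  also have "\<dots> = ennreal (2 * (1/4) ^ n + 2 * (1/4) ^ n)"
    by (subst ennreal_plus) (auto simp: ennreal_mult'[of 2] simp del: ennreal_plus)
  also have "2 * (1/4) ^ n + 2 * (1/4) ^ n = 4 * (1/4::real) ^ n" by simp
  finally show ?thesis .
qed

text \<open>The approximants are taken at rate \<open>(1/4) ^ n\<close>, the rate for which
  \<open>L2_limit_of_fast_Cauchy\<close> supplies a limit of the transforms.\<close>

lemma L2_rel_exists: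
  assumes f: "f \<in> Lp_space 2 \<mu>"
  shows "\<exists>g. L2_rel f g"
proof -
  have fm: "f \<in> borel_measurable \<mu>" by (rule L2_measurable[OF f])
  have "\<exists>\<phi>::'a \<Rightarrow> complex. schwartz \<phi> \<and> sq_int \<mu> (\<lambda>x. f x - \<phi> x) < ennreal ((1/4) ^ n)" for n
    by (rule schwartz_dense_L2[OF f, of "(1/4) ^ n"]) auto
  then obtain \<phi> :: "nat \<Rightarrow> 'a \<Rightarrow> complex" where \<phi>: "\<And>n. schwartz (\<phi> n)"
    and lt: "\<And>n. sq_int \<mu> (\<lambda>x. f x - \<phi> n x) < ennreal ((1/4) ^ n)" by metis
  then have le: "sq_int \<mu> (\<lambda>x. f x - \<phi> n x) \<le> ennreal ((1/4) ^ n)" for n by (simp add: less_imp_le)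
  have fin: "sq_int \<mu> (T (\<phi> 0)) < \<infinity>"
    using int_transform_schwartz_isometry[OF \<phi>] schwartz_sq_int[OF \<phi>] by simp
  obtain g where g: "g \<in> borel_measurable \<mu>" "sq_int \<mu> g < \<infinity>"
    "\<And>n. sq_int \<mu> (\<lambda>x. g x - T (\<phi> n) x) \<le> ennreal (4 * (1/4) ^ n)"
    using L2_limit_of_fast_Cauchy[of "\<lambda>n. T (\<phi> n)" \<mu> 4, OF T_schwartz_measurable[OF \<phi>] fin T_fast_Cauchy[OF \<phi> fm le]]
    by blast
  have "(\<lambda>n. sq_int \<mu> (\<lambda>x. \<phi> n x - f x)) \<longlonglongrightarrow> 0"
    by (rule tendsto_sandwich[OF _ _ tendsto_const LIMSEQ_ennreal_quarter_power[of 1]])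
       (use le in \<open>auto simp: sq_int_minus_commute[of \<mu> f]\<close>)
  moreover have "(\<lambda>n. sq_int \<mu> (\<lambda>x. T (\<phi> n) x - g x)) \<longlonglongrightarrow> 0"
    by (rule tendsto_sandwich[OF _ _ tendsto_const LIMSEQ_ennreal_quarter_power[of 4]])
       (use g(3) in \<open>auto simp: sq_int_minus_commute[of \<mu> g]\<close>)
  ultimately show ?thesis
    unfolding L2_rel_def using g(1,2) \<phi> by (auto simp: Lp_space_2_iff_sq_int)
qed

lemma L2_rel_transform: "f \<in> Lp_space 2 \<mu> \<Longrightarrow> L2_rel f (U f)"
  unfolding L2_transform_eq_Eps by (rule someI_ex[OF L2_rel_exists])

lemma L2_transform_L2: "f \<in> Lp_space 2 \<mu> \<Longrightarrow> U f \<in> Lp_space 2 \<mu>"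
  using L2_rel_transform unfolding L2_rel_def by blast

lemma L2_transform_isometry: "f \<in> Lp_space 2 \<mu> \<Longrightarrow> sq_int \<mu> (U f) = sq_int \<mu> f"
  by (intro L2_rel_isometry L2_rel_transform L2_measurable)

lemma L2_linear:
  assumes f: "f \<in> Lp_space 2 \<mu>" and g: "g \<in> Lp_space 2 \<mu>"
  shows "(\<lambda>x. f x + c * g x) \<in> Lp_space 2 \<mu>"
  unfolding Lp_space_2_iff_sq_int
proof
  note [measurable] = L2_measurable[OF f] L2_measurable[OF g]
  show "(\<lambda>x. f x + c * g x) \<in> borel_measurable \<mu>" by measurable
  have "sq_int \<mu> (\<lambda>x. f x + c * g x) \<le> 2 * sq_int \<mu> f + 2 * sq_int \<mu> (\<lambda>x. c * g x)"
    by (rule sq_int_add_le) measurable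
  also have "\<dots> < \<infinity>"
    using f g by (subst sq_int_cmult) (auto simp: Lp_space_2_iff_sq_int ennreal_mult_less_top)
  finally show "sq_int \<mu> (\<lambda>x. f x + c * g x) < \<infinity>" .
qed

text \<open>The value of the extension is chosen separately for each function, so linearity can hold
  only almost everywhere.\<close>

lemma L2_transform_linear:
  assumes f: "f \<in> Lp_space 2 \<mu>" and g: "g \<in> Lp_space 2 \<mu>"
  shows "AE x in \<mu>. U (\<lambda>x. f x + c * g x) x = U f x + c * U g x"
  by (rule L2_rel_unique[OF L2_rel_transform[OF L2_linear[OF f g]]
        L2_rel_linear[OF L2_rel_transform[OF f] L2_rel_transform[OF g]]])
     (auto intro!: L2_measurable f g L2_linear)

text \<open>One sequence of Schwartz functions serves twice. Its L1 convergence and the bounded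
  kernel make \<open>T (\<phi> n)\<close> converge to \<open>T f\<close> pointwise; its L2
  convergence makes the same sequence rapidly Cauchy in L2. Hence \<open>T f\<close> is also the L2
  limit, and uniqueness applies.\<close>

lemma L2_transform_eq_int_transform:
  assumes f1: "integrable \<mu> f" and f2: "f \<in> Lp_space 2 \<mu>"
  shows "AE x in \<mu>. U f x = T f x"
proof -
  have fm[measurable]: "f \<in> borel_measurable \<mu>" by (rule L2_measurable[OF f2])
  have mix: "mixed_int \<mu> f < \<infinity>"
    using f1 f2 by (simp add: mixed_int_eq[OF fm] Lp_space_2_iff_sq_int integrable_iff_bounded)
  have "\<exists>\<phi>::'a \<Rightarrow> complex. schwartz \<phi> \<and> mixed_int \<mu> (\<lambda>x. f x - \<phi> x) < ennreal ((1/4) ^ n)" for n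
    by (rule schwartz_dense_mixed[OF fm mix, of "(1/4) ^ n"]) auto
  then obtain \<phi> :: "nat \<Rightarrow> 'a \<Rightarrow> complex" where \<phi>: "\<And>n. schwartz (\<phi> n)"
    and lt: "\<And>n. mixed_int \<mu> (\<lambda>x. f x - \<phi> n x) < ennreal ((1/4) ^ n)" by metis
  note [measurable] = schwartz_measurable[OF \<phi>]
  have le: "sq_int \<mu> (\<lambda>x. f x - \<phi> n x) \<le> ennreal ((1/4) ^ n)" for n
    using le_less_trans[OF sq_int_le_mixed_int lt] by (rule less_imp_le)
  have le1: "(\<integral>\<^sup>+ x. ennreal (norm (f x - \<phi> n x)) \<partial>\<mu>) \<le> ennreal ((1/4) ^ n)" for n
  proof -
    have "(\<integral>\<^sup>+ x. ennreal (norm (f x - \<phi> n x)) \<partial>\<mu>) \<le> mixed_int \<mu> (\<lambda>x. f x - \<phi> n x)"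
      unfolding mixed_int_def by (intro nn_integral_mono ennreal_leI) auto
    with lt[of n] show ?thesis by simp
  qed
  obtain c where c: "c > 0" "\<And>f \<xi>. \<xi> \<in> \<Omega> \<Longrightarrow> integrable \<mu> f \<Longrightarrow>
     ennreal (norm (T f \<xi>)) \<le> ennreal c * (\<integral>\<^sup>+ x. ennreal (norm (f x)) \<partial>\<mu>)"
    using int_transform_bound by blast
  have lim: "(\<lambda>n. T (\<phi> n) \<xi>) \<longlonglongrightarrow> T f \<xi>" if \<xi>: "\<xi> \<in> \<Omega>" for \<xi>
  proof (rule Lim_transform2[OF tendsto_const])
    have "(\<lambda>n. T f \<xi> - T (\<phi> n) \<xi>) \<longlonglongrightarrow> 0"
    proof (rule Lim_null_comparison)
      have "ennreal (norm (T f \<xi> - T (\<phi> n) \<xi>)) \<le> ennreal (c * (1/4) ^ n)" for n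
      proof -
        have "T f \<xi> - T (\<phi> n) \<xi> = T (\<lambda>x. f x + (-1) * \<phi> n x) \<xi>"
          by (simp only: int_transform_linear[OF f1 schwartz_integrable[OF \<phi>] \<xi>], simp)
        also have "ennreal (norm \<dots>) \<le> ennreal c * (\<integral>\<^sup>+ x. ennreal (norm (f x + (-1) * \<phi> n x)) \<partial>\<mu>)"
          using f1 schwartz_integrable[OF \<phi>] by (intro c(2) \<xi>) auto
        also have "\<dots> \<le> ennreal c * ennreal ((1/4) ^ n)"
          using le1[of n] by (intro mult_left_mono) auto
        also have "\<dots> = ennreal (c * (1/4) ^ n)"
          using c(1) by (simp add: ennreal_mult)
        finally show ?thesis .
      qed
      then show "\<forall>\<^sub>F n in sequentially. norm (T f \<xi> - T (\<phi> n) \<xi>) \<le> c * (1/4) ^ n"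
        using c(1) by (intro always_eventually allI) (simp add: ennreal_le_iff)
      have "(\<lambda>n. c * (1/4::real) ^ n) \<longlonglongrightarrow> c * 0"
        by (intro tendsto_intros LIMSEQ_power_zero) auto
      then show "(\<lambda>n. c * (1/4::real) ^ n) \<longlonglongrightarrow> 0" by simp
    qed
    then show "(\<lambda>n. T f \<xi> - T (\<phi> n) \<xi>) \<longlonglongrightarrow> 0" .
  qed
  have Tf[measurable]: "T f \<in> borel_measurable \<mu>" by (rule int_transform_measurable[OF f1])
  note [measurable] = T_schwartz_measurable[OF \<phi>]
  \<comment> \<open>Fatou, applied to the pointwise limit, upgrades the Cauchy estimate to an L2
    rate towards \<open>T f\<close>.\<close>
  have leT: "sq_int \<mu> (\<lambda>\<xi>. T f \<xi> - T (\<phi> n) \<xi>) \<le> ennreal (4 * (1/4) ^ n)" for n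
    by (rule sq_int_AE_limit_le[where g = "\<lambda>m. T (\<phi> m)" and N = n])
       (use lim T_fast_Cauchy[OF \<phi> fm le] in \<open>auto simp: space_mu\<close>)
  have "L2_rel f (T f)"
    unfolding L2_rel_def
  proof (intro conjI exI[of _ \<phi>] allI \<phi>)
    show "(\<lambda>n. sq_int \<mu> (\<lambda>x. \<phi> n x - f x)) \<longlonglongrightarrow> 0"
      by (rule tendsto_sandwich[OF _ _ tendsto_const LIMSEQ_ennreal_quarter_power[of 1]])
         (use le in \<open>auto simp: sq_int_minus_commute[of \<mu> f]\<close>)
    show "(\<lambda>n. sq_int \<mu> (\<lambda>x. T (\<phi> n) x - T f x)) \<longlonglongrightarrow> 0"
      by (rule tendsto_sandwich[OF _ _ tendsto_const LIMSEQ_ennreal_quarter_power[of 4]])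
         (use leT in \<open>auto simp: sq_int_minus_commute[of \<mu> "T f"]\<close>)
    have "sq_int \<mu> (T f) = sq_int \<mu> (\<lambda>x. (T f x - T (\<phi> 0) x) + T (\<phi> 0) x)" by simp
    also have "\<dots> \<le> 2 * sq_int \<mu> (\<lambda>x. T f x - T (\<phi> 0) x) + 2 * sq_int \<mu> (T (\<phi> 0))"
      by (rule sq_int_add_le) measurable
    also have "\<dots> < \<infinity>"
      using leT[of 0] schwartz_sq_int[OF \<phi>, of 0]
      by (auto simp: ennreal_mult_less_top int_transform_schwartz_isometry[OF \<phi>] intro: le_less_trans)
    finally show "T f \<in> Lp_space 2 \<mu>" by (simp add: Lp_space_2_iff_sq_int Tf)
  qed
  then show ?thesis
    by (intro L2_rel_unique[OF L2_rel_transform[OF f2] _ fm])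
qed

lemma L2_indicator:
  assumes "f \<in> Lp_space 2 \<mu>" "A \<in> sets \<mu>"
  shows "(\<lambda>x. indicator A x * f x) \<in> Lp_space 2 \<mu>"
  using assms le_less_trans[OF sq_int_indicator_le[of \<mu> A f]] unfolding Lp_space_2_iff_sq_int by auto

text \<open>Surjectivity makes the preimage chosen in \<open>L2_inv_transform\<close> a genuine one,
  and the isometry then moves the norm to the transform side.\<close>

lemma sq_int_F_op:
  assumes f: "f \<in> Lp_space 2 \<mu>" and A: "A \<in> sets \<mu>"
  shows "sq_int \<mu> (F_op \<mu> K A f) = sq_int \<mu> (\<lambda>x. indicator A x * U f x)"
proof -
  let ?g = "\<lambda>x. indicator A x * U f x" and ?h = "F_op \<mu> K A f"
  have "?g \<in> Lp_space 2 \<mu>"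
    by (intro L2_indicator L2_transform_L2 f A)
  then have "\<exists>h. h \<in> Lp_space 2 \<mu> \<and> (AE \<xi> in \<mu>. U h \<xi> = ?g \<xi>)"
    using onto by blast
  then have h: "?h \<in> Lp_space 2 \<mu> \<and> (AE \<xi> in \<mu>. U ?h \<xi> = ?g \<xi>)"
    unfolding F_op_def L2_inv_transform_def by (rule someI_ex)
  then have "sq_int \<mu> ?h = sq_int \<mu> (U ?h)"
    using L2_transform_isometry by simp
  also have "\<dots> = sq_int \<mu> ?g"
    using h by (intro sq_int_cong_AE) auto
  finally show ?thesis .
qed

end

section \<open>Localisation\<close>

text \<open>Choosing \<open>r\<close> with \<open>A m r\<^bsup>2a\<^esup> = \<eta>/2\<close> absorbs the first term on the right into the left.\<close>

lemma optimise_radius: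
  fixes a \<beta> \<eta> A B t :: real
  assumes a: "a > 0" and \<eta>: "\<eta> > 0" and A: "A > 0" and B: "B > 0"
  shows "\<exists>C>0. \<forall>m n M. m > 0 \<longrightarrow> n < \<infinity> \<longrightarrow>
    (\<forall>r>0. ennreal \<eta> * n \<le> ennreal (A * m * r powr (2 * a)) * n + ennreal (B * m powr t * r powr (- 2 * \<beta>)) * M) \<longrightarrow>
    ennreal C * n \<le> ennreal (m powr (t + \<beta> / a)) * M"
\<comment> \<open>At the chosen radius \<open>r powr (- 2 * \<beta>)\<close> equals
  \<open>(2 * A / \<eta>) powr (\<beta> / a) * m powr (\<beta> / a)\<close>, so \<open>?D\<close> is
  the part of the weight coefficient free of \<open>m\<close>. The parameter \<open>t\<close>
  records a power of \<open>m\<close> already present there: 0 for the two L2 estimates, 1 for the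
  two that involve L1 norms.\<close>
proof (intro exI[of _ "\<eta> / 2 / (B * (2 * A / \<eta>) powr (\<beta> / a))"] conjI allI impI)
  let ?D = "B * (2 * A / \<eta>) powr (\<beta> / a)"
  have D: "?D > 0" using A B \<eta> by simp
  then show "\<eta> / 2 / ?D > 0" using \<eta> by simp
  fix m :: real and n M :: ennreal
  assume m: "m > 0" and n: "n < \<infinity>" and
    le: "\<forall>r>0. ennreal \<eta> * n \<le> ennreal (A * m * r powr (2 * a)) * n + ennreal (B * m powr t * r powr (- 2 * \<beta>)) * M"
  show "ennreal (\<eta> / 2 / ?D) * n \<le> ennreal (m powr (t + \<beta> / a)) * M"
  proof (cases M)
    case top
    then show ?thesis using m by (simp add: ennreal_mult_top)
  next
    case (real y)
    \<comment> \<open>Finiteness of \<open>n\<close> permits the passage to real numbers, where half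
      of the left side can be subtracted.\<close>
    from n obtain x where x: "n = ennreal x" "0 \<le> x" by (cases n) auto
    define r where "r = (\<eta> / (2 * A * m)) powr (1 / (2 * a))"
    have r: "r > 0" using \<eta> A m by (simp add: r_def)
    have r1: "r powr (2 * a) = \<eta> / (2 * A * m)"
      using a \<eta> A m by (simp add: r_def powr_powr)
    have "r powr (- 2 * \<beta>) = (\<eta> / (2 * A * m)) powr (- (\<beta> / a))"
      by (simp add: r_def powr_powr)
    also have "\<dots> = inverse (\<eta> / (2 * A * m)) powr (\<beta> / a)"
      using \<eta> A m by (subst inverse_powr) (auto intro: powr_minus)
    also have "inverse (\<eta> / (2 * A * m)) = (2 * A / \<eta>) * m"
      by (simp add: field_simps)
    also have "\<dots> powr (\<beta> / a) = (2 * A / \<eta>) powr (\<beta> / a) * m powr (\<beta> / a)"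
      by (rule powr_mult)
    finally have r2: "r powr (- 2 * \<beta>) = (2 * A / \<eta>) powr (\<beta> / a) * m powr (\<beta> / a)" .
    from le r have "ennreal \<eta> * n \<le> ennreal (A * m * r powr (2 * a)) * n + ennreal (B * m powr t * r powr (- 2 * \<beta>)) * M"
      by blast
    then have "ennreal (\<eta> * x) \<le> ennreal (A * m * r powr (2 * a) * x + B * m powr t * r powr (- 2 * \<beta>) * y)"
      using x real \<eta> A B m by (simp add: ennreal_mult)
    then have "\<eta> * x \<le> A * m * r powr (2 * a) * x + B * m powr t * r powr (- 2 * \<beta>) * y"
      using x real A B m by (subst (asm) ennreal_le_iff) auto
    also have "A * m * r powr (2 * a) = \<eta> / 2"
      unfolding r1 using A m by simp
    also have "B * m powr t * r powr (- 2 * \<beta>) = ?D * m powr (t + \<beta> / a)"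
      unfolding r2 by (simp add: powr_add)
    finally have "\<eta> / 2 * x \<le> ?D * (m powr (t + \<beta> / a) * y)" by simp
    then have "\<eta> / 2 / ?D * x \<le> m powr (t + \<beta> / a) * y"
      using D by (simp add: field_simps)
    then have "ennreal (\<eta> / 2 / ?D * x) \<le> ennreal (m powr (t + \<beta> / a) * y)"
      by (rule ennreal_leI)
    moreover have "0 \<le> \<eta> / 2 / ?D" using D \<eta> by simp
    ultimately show ?thesis
      using x real by (simp only: ennreal_mult powr_ge_zero)
  qed
qed

lemma ennreal_power2_add_le: "(x + y)\<^sup>2 \<le> 2 * x\<^sup>2 + 2 * y\<^sup>2" for x y :: ennreal
proof (cases "x = \<infinity> \<or> y = \<infinity>")
  case True
  then show ?thesis by (auto simp: power2_eq_square ennreal_mult_top ennreal_top_mult)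
next
  case False
  then obtain p q where x: "x = ennreal p" "0 \<le> p" and y: "y = ennreal q" "0 \<le> q"
    by (cases x; cases y) auto
  have "(p + q)\<^sup>2 \<le> 2 * p\<^sup>2 + 2 * q\<^sup>2"
    using sum_squares_bound[of p q] by (simp add: power2_sum)
  then have "ennreal ((p + q)\<^sup>2) \<le> ennreal (2 * p\<^sup>2 + 2 * q\<^sup>2)" by (rule ennreal_leI)
  then show ?thesis using x y by (simp add: ennreal_power[symmetric] ennreal_mult)
qed

context cone_transform
begin

lemma weight_measurable[measurable]: "(\<lambda>x::'a. norm x powr s) \<in> borel_measurable \<mu>"
  by (rule borel_measurable_mu) measurable

text \<open>Outside the ball \<open>norm x / r\<close> is at least 1, so its power
  \<open>2 * s\<close> may be inserted under the integral.\<close>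

lemma tail_sq_int_le:
  fixes f :: "'a \<Rightarrow> complex"
  assumes [measurable]: "f \<in> borel_measurable \<mu>" and r: "r > 0" and s: "s > 0"
  shows "sq_int \<mu> (\<lambda>x. indicator (space \<mu> - ball 0 r \<inter> \<Omega>) x * f x)
    \<le> ennreal (r powr (- 2 * s)) * sq_int \<mu> (\<lambda>x. (norm x powr s) *\<^sub>R f x)"
proof -
  have "sq_int \<mu> (\<lambda>x. indicator (space \<mu> - ball 0 r \<inter> \<Omega>) x * f x)
    \<le> (\<integral>\<^sup>+ x. ennreal (r powr (- 2 * s)) * ennreal ((norm ((norm x powr s) *\<^sub>R f x))\<^sup>2) \<partial>\<mu>)"
    unfolding sq_int_def
  proof (rule nn_integral_mono)
    fix x assume "x \<in> space \<mu>"
    show "ennreal ((norm (indicator (space \<mu> - ball 0 r \<inter> \<Omega>) x * f x))\<^sup>2)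
        \<le> ennreal (r powr (- 2 * s)) * ennreal ((norm ((norm x powr s) *\<^sub>R f x))\<^sup>2)"
    proof (cases "x \<in> ball 0 r \<inter> \<Omega>")
      case False
      then have "r \<le> norm x" using \<open>x \<in> space \<mu>\<close> by (auto simp: space_mu)
      then have "r powr (2 * s) \<le> norm x powr (2 * s)" using r s by (intro powr_mono2) auto
      then have "1 \<le> r powr (- 2 * s) * norm x powr (2 * s)"
        using r by (simp add: powr_minus field_simps)
      also have "norm x powr (2 * s) = (norm x powr s)\<^sup>2"
        by (simp add: power2_eq_square powr_add[symmetric])
      finally have "1 * (norm (f x))\<^sup>2 \<le> (r powr (- 2 * s) * (norm x powr s)\<^sup>2) * (norm (f x))\<^sup>2"
        by (rule mult_right_mono) simp
      then have "(norm (f x))\<^sup>2 \<le> r powr (- 2 * s) * (norm ((norm x powr s) *\<^sub>R f x))\<^sup>2"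
        by (simp add: power_mult_distrib mult.assoc)
      then show ?thesis
        using False \<open>x \<in> space \<mu>\<close> by (simp add: ennreal_mult[symmetric] ennreal_leI del: norm_scaleR)
    qed auto
  qed
  also have "\<dots> = ennreal (r powr (- 2 * s)) * sq_int \<mu> (\<lambda>x. (norm x powr s) *\<^sub>R f x)"
    unfolding sq_int_def by (rule nn_integral_cmult) measurable
  finally show ?thesis .
qed

lemma tail_nn_integral_le:
  fixes f :: "'a \<Rightarrow> complex"
  assumes [measurable]: "f \<in> borel_measurable \<mu>" and r: "r > 0" and s: "s > 0"
  shows "(\<integral>\<^sup>+ x. ennreal (norm (f x)) * indicator (space \<mu> - ball 0 r \<inter> \<Omega>) x \<partial>\<mu>)
    \<le> ennreal (r powr (- s)) * (\<integral>\<^sup>+ x. ennreal (norm ((norm x powr s) *\<^sub>R f x)) \<partial>\<mu>)"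
proof -
  have "(\<integral>\<^sup>+ x. ennreal (norm (f x)) * indicator (space \<mu> - ball 0 r \<inter> \<Omega>) x \<partial>\<mu>)
    \<le> (\<integral>\<^sup>+ x. ennreal (r powr (- s)) * ennreal (norm ((norm x powr s) *\<^sub>R f x)) \<partial>\<mu>)"
  proof (rule nn_integral_mono)
    fix x assume "x \<in> space \<mu>"
    show "ennreal (norm (f x)) * indicator (space \<mu> - ball 0 r \<inter> \<Omega>) x
        \<le> ennreal (r powr (- s)) * ennreal (norm ((norm x powr s) *\<^sub>R f x))"
    proof (cases "x \<in> ball 0 r \<inter> \<Omega>")
      case False
      then have "r \<le> norm x" using \<open>x \<in> space \<mu>\<close> by (auto simp: space_mu)
      then have "r powr s \<le> norm x powr s" using r s by (intro powr_mono2) auto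
      then have "1 \<le> r powr (- s) * norm x powr s"
        using r by (simp add: powr_minus field_simps)
      then have "1 * norm (f x) \<le> (r powr (- s) * norm x powr s) * norm (f x)"
        by (rule mult_right_mono) simp
      then have "norm (f x) \<le> r powr (- s) * norm ((norm x powr s) *\<^sub>R f x)"
        by (simp add: mult.assoc)
      then show ?thesis
        using False \<open>x \<in> space \<mu>\<close> by (simp add: ennreal_mult[symmetric] ennreal_leI del: norm_scaleR)
    qed auto
  qed
  also have "\<dots> = ennreal (r powr (- s)) * (\<integral>\<^sup>+ x. ennreal (norm ((norm x powr s) *\<^sub>R f x)) \<partial>\<mu>)"
    by (rule nn_integral_cmult) measurable
  finally show ?thesis .
qed

lemma ball_Int_sets[measurable]: "ball 0 r \<inter> \<Omega> \<in> sets \<mu>"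
  by (rule sets_mu_Int) simp

lemma int_transform_sq_int_le:
  assumes c: "\<And>\<xi>. \<xi> \<in> \<Omega> \<Longrightarrow> ennreal (norm (T h \<xi>)) \<le> H" and A: "A \<in> sets \<mu>"
  shows "sq_int \<mu> (\<lambda>\<xi>. indicator A \<xi> * T h \<xi>) \<le> emeasure \<mu> A * H\<^sup>2"
proof -
  have "sq_int \<mu> (\<lambda>\<xi>. indicator A \<xi> * T h \<xi>) \<le> (\<integral>\<^sup>+ x. H\<^sup>2 * indicator A x \<partial>\<mu>)"
    unfolding sq_int_def
  proof (rule nn_integral_mono)
    fix x assume "x \<in> space \<mu>"
    then have "(ennreal (norm (T h x)))\<^sup>2 \<le> H\<^sup>2"
      by (intro power_mono c) (auto simp: space_mu)
    then show "ennreal ((norm (indicator A x * T h x))\<^sup>2) \<le> H\<^sup>2 * indicator A x"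
      by (auto simp: ennreal_power split: split_indicator)
  qed
  also have "\<dots> = emeasure \<mu> A * H\<^sup>2"
    using nn_integral_cmult_indicator[OF A, of "H\<^sup>2"] by (simp only: mult.commute)
  finally show ?thesis .
qed

section \<open>Local estimates: mass on a set against a weight on the other side\<close>

text \<open>The mass of \<open>f\<close> on \<open>S\<close> is written as a pairing on the
  transform side and split there at radius \<open>r\<close>. Near the origin the bounded transform
  of the restriction \<open>h\<close> does the work, far away the weight on \<open>U f\<close>. Each
  part is the root of the mass times a small quantity, so one root cancels.\<close>

lemma local_uncertainty_concentration:
  assumes \<beta>: "\<beta> > 0"
  shows "\<exists>A>0. \<forall>S f r. S \<in> sets \<mu> \<longrightarrow> emeasure \<mu> S < \<infinity> \<longrightarrow> f \<in> Lp_space 2 \<mu> \<longrightarrow> r > 0 \<longrightarrow>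
    sq_int \<mu> (\<lambda>x. indicator S x * f x) \<le> ennreal (A * measure \<mu> S * r powr (2 * a)) * sq_int \<mu> f
      + ennreal (2 * r powr (- 2 * \<beta>)) * sq_int \<mu> (\<lambda>\<xi>. (norm \<xi> powr \<beta>) *\<^sub>R U f \<xi>)"
proof -
  obtain \<kappa> where \<kappa>: "\<kappa> > 0" "\<And>r. r > 0 \<Longrightarrow> emeasure \<mu> (ball 0 r \<inter> \<Omega>) \<le> ennreal (\<kappa> * r powr (2 * a))"
    using emeasure_ball_le by blast
  obtain c where c: "c > 0" "\<And>f \<xi>. \<xi> \<in> \<Omega> \<Longrightarrow> integrable \<mu> f \<Longrightarrow>
     ennreal (norm (T f \<xi>)) \<le> ennreal c * (\<integral>\<^sup>+ x. ennreal (norm (f x)) \<partial>\<mu>)"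
    using int_transform_bound by blast
  have main: "sq_int \<mu> (\<lambda>x. indicator S x * f x) \<le> ennreal (2 * c\<^sup>2 * \<kappa> * measure \<mu> S * r powr (2 * a)) * sq_int \<mu> f
      + ennreal (2 * r powr (- 2 * \<beta>)) * sq_int \<mu> (\<lambda>\<xi>. (norm \<xi> powr \<beta>) *\<^sub>R U f \<xi>)"
    if S[measurable]: "S \<in> sets \<mu>" and Sfin: "emeasure \<mu> S < \<infinity>" and f: "f \<in> Lp_space 2 \<mu>" and r: "r > 0"
    for S f r
  proof -
    define h where "h = (\<lambda>x. indicator S x * f x)"
    define e where "e = sq_int \<mu> h"
    let ?B = "ball 0 r \<inter> \<Omega>"
    let ?M = "sq_int \<mu> (\<lambda>\<xi>. (norm \<xi> powr \<beta>) *\<^sub>R U f \<xi>)"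
    have h: "h \<in> Lp_space 2 \<mu>" unfolding h_def by (rule L2_indicator[OF f S])
    note [measurable] = L2_measurable[OF f] L2_measurable[OF h]
      L2_measurable[OF L2_transform_L2[OF f]] L2_measurable[OF L2_transform_L2[OF h]]
    have e_fin: "e < \<infinity>" using h by (simp add: e_def Lp_space_2_iff_sq_int)
    define H where "H = ennreal c * (\<integral>\<^sup>+ x. ennreal (norm (h x)) \<partial>\<mu>)"
    have hS: "(\<integral>\<^sup>+ x. ennreal (norm (h x)) \<partial>\<mu>)\<^sup>2 \<le> emeasure \<mu> S * e"
    proof -
      have "(\<integral>\<^sup>+ x. ennreal (norm (h x)) \<partial>\<mu>) = (\<integral>\<^sup>+ x. ennreal (norm (h x)) * indicator S x \<partial>\<mu>)"
        by (intro nn_integral_cong) (auto simp: h_def split: split_indicator)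
      then show ?thesis
        unfolding e_def by (simp add: nn_integral_power2_le_sq_int)
    qed
    also have "\<dots> < \<infinity>" using Sfin e_fin by (simp add: ennreal_mult_less_top)
    finally have h1: "integrable \<mu> h"
      by (auto simp: integrable_iff_bounded power2_eq_square ennreal_mult_less_top)
    have UT: "AE x in \<mu>. U h x = T h x" by (rule L2_transform_eq_int_transform[OF h1 h])
    have TH: "ennreal (norm (T h \<xi>)) \<le> H" if "\<xi> \<in> \<Omega>" for \<xi>
      unfolding H_def by (rule c(2)[OF that h1])
    \<comment> \<open>The inner products of \<open>h\<close>, \<open>f\<close> and of their
      transforms agree, but only norms are known to be preserved, so the pairing is recovered by
      polarisation. Its real part is enough, because \<open>h x\<close> times the conjugate of
      \<open>f x\<close> is \<open>(norm (h x))^2\<close>.\<close>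
    have polar: "e \<le> (\<integral>\<^sup>+ x. ennreal (norm (U h x)) * ennreal (norm (U f x)) \<partial>\<mu>)"
    proof -
      let ?P = "\<integral>\<^sup>+ x. ennreal (norm (U h x)) * ennreal (norm (U f x)) \<partial>\<mu>"
      have iso: "sq_int \<mu> (\<lambda>x. h x + z * f x) = sq_int \<mu> (\<lambda>x. U h x + z * U f x)" for z
      proof -
        have "sq_int \<mu> (U (\<lambda>x. h x + z * f x)) = sq_int \<mu> (\<lambda>x. U h x + z * U f x)"
          by (rule sq_int_cong_AE) (use L2_transform_linear[OF h f, of z] in eventually_elim, simp)
        then show ?thesis by (simp add: L2_transform_isometry[OF L2_linear[OF h f]])
      qed
      \<comment> \<open>On \<open>S\<close> the sum is \<open>2 * h x\<close> and the difference
        vanishes; off \<open>S\<close> both have the norm of \<open>f x\<close>.\<close>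
      have "sq_int \<mu> (\<lambda>x. h x + (-1) * f x) + 4 * e = sq_int \<mu> (\<lambda>x. h x + 1 * f x)"
      proof -
        have "sq_int \<mu> (\<lambda>x. h x + 1 * f x)
            = (\<integral>\<^sup>+ x. ennreal ((norm (h x + (-1) * f x))\<^sup>2) + 4 * ennreal ((norm (h x))\<^sup>2) \<partial>\<mu>)"
          unfolding sq_int_def
          by (intro nn_integral_cong)
             (auto simp: h_def norm_mult power_mult_distrib ennreal_mult' mult_2[symmetric] split: split_indicator)
        then show ?thesis
          unfolding e_def sq_int_def by (simp add: nn_integral_add nn_integral_cmult)
      qed
      also have "\<dots> = sq_int \<mu> (\<lambda>x. U h x + 1 * U f x)"
        by (rule iso)
      also have "\<dots> \<le> (\<integral>\<^sup>+ x. ennreal ((norm (U h x + (-1) * U f x))\<^sup>2)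
          + 4 * (ennreal (norm (U h x)) * ennreal (norm (U f x))) \<partial>\<mu>)"
        unfolding sq_int_def
      proof (rule nn_integral_mono)
        fix x
        have "(norm (z + w))\<^sup>2 \<le> (norm (z - w))\<^sup>2 + 4 * (norm z * norm w)" for z w :: complex
        proof -
          have "(norm (z + w))\<^sup>2 = (norm (z - w))\<^sup>2 + 4 * (z \<bullet> w)"
            by (simp add: power2_norm_eq_inner inner_add inner_diff inner_commute)
          moreover have "z \<bullet> w \<le> norm z * norm w" by (rule norm_cauchy_schwarz)
          ultimately show ?thesis by linarith
        qed
        from ennreal_leI[OF this[of "U h x" "U f x"]]
        show "ennreal ((norm (U h x + 1 * U f x))\<^sup>2) \<le> ennreal ((norm (U h x + (-1) * U f x))\<^sup>2)
          + 4 * (ennreal (norm (U h x)) * ennreal (norm (U f x)))"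
          by (simp add: ennreal_mult)
      qed
      also have "\<dots> = sq_int \<mu> (\<lambda>x. U h x + (-1) * U f x) + 4 * ?P"
        unfolding sq_int_def by (subst nn_integral_add) (auto simp: nn_integral_cmult)
      also have "sq_int \<mu> (\<lambda>x. U h x + (-1) * U f x) = sq_int \<mu> (\<lambda>x. h x + (-1) * f x)"
        by (rule iso[symmetric])
      \<comment> \<open>The common term may be cancelled because \<open>h - f\<close> is square
        integrable, so the term is finite.\<close>
      finally have "4 * e \<le> 4 * ?P"
        using L2_linear[OF h f, of "-1"] by (auto simp: Lp_space_2_iff_sq_int ennreal_add_left_cancel_le)
      then show ?thesis by (simp add: ennreal_mult_le_mult_iff)
    qed
    define X where "X = (\<integral>\<^sup>+ x. ennreal (norm (U h x)) * ennreal (norm (indicator ?B x * U f x)) \<partial>\<mu>)"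
    define Y where "Y = (\<integral>\<^sup>+ x. ennreal (norm (U h x)) * ennreal (norm (indicator (space \<mu> - ?B) x * U f x)) \<partial>\<mu>)"
    have "(\<integral>\<^sup>+ x. ennreal (norm (U h x)) * ennreal (norm (U f x)) \<partial>\<mu>)
        = (\<integral>\<^sup>+ x. ennreal (norm (U h x)) * ennreal (norm (indicator ?B x * U f x))
          + ennreal (norm (U h x)) * ennreal (norm (indicator (space \<mu> - ?B) x * U f x)) \<partial>\<mu>)"
      by (intro nn_integral_cong) (auto split: split_indicator)
    also have "\<dots> = X + Y"
      unfolding X_def Y_def by (rule nn_integral_add) measurable
    finally have eXY: "e \<le> X + Y" using polar by simp
    \<comment> \<open>Inside the ball \<open>U h\<close> is bounded by \<open>H\<close>, whose
      square is at most \<open>c^2\<close> times the measure of \<open>S\<close> times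
      \<open>e\<close>; Cauchy-Schwarz over the ball supplies the power of \<open>r\<close> and the
      norm of \<open>f\<close>. The factor \<open>e\<close> is kept apart for the cancellation
      below.\<close>
    have X: "X\<^sup>2 \<le> e * (ennreal (c\<^sup>2 * \<kappa> * measure \<mu> S * r powr (2 * a)) * sq_int \<mu> f)"
    proof -
      have "X \<le> (\<integral>\<^sup>+ x. H * (ennreal (norm (U f x)) * indicator ?B x) \<partial>\<mu>)"
        unfolding X_def
      proof (rule nn_integral_mono_AE, use UT AE_space in eventually_elim)
        case (elim x)
        then have "ennreal (norm (U h x)) \<le> H" using TH by (simp add: space_mu)
        then show ?case by (auto split: split_indicator intro!: mult_right_mono)
      qed
      also have "\<dots> = H * (\<integral>\<^sup>+ x. ennreal (norm (U f x)) * indicator ?B x \<partial>\<mu>)"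
        by (rule nn_integral_cmult) measurable
      finally have "X\<^sup>2 \<le> H\<^sup>2 * (\<integral>\<^sup>+ x. ennreal (norm (U f x)) * indicator ?B x \<partial>\<mu>)\<^sup>2"
        unfolding power_mult_distrib[symmetric] by (rule power_mono) simp
      also have "\<dots> \<le> (ennreal (c\<^sup>2) * (emeasure \<mu> S * e)) * (emeasure \<mu> ?B * sq_int \<mu> (U f))"
        unfolding H_def power_mult_distrib using hS c(1)
        by (intro mult_mono nn_integral_power2_le_sq_int) (auto simp: ennreal_power)
      also have "\<dots> \<le> (ennreal (c\<^sup>2) * (emeasure \<mu> S * e)) * (ennreal (\<kappa> * r powr (2 * a)) * sq_int \<mu> f)"
        unfolding L2_transform_isometry[OF f] by (intro mult_left_mono mult_right_mono \<kappa>(2) r) auto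
      also have "\<dots> = e * ((ennreal (c\<^sup>2) * ennreal (measure \<mu> S) * ennreal (\<kappa> * r powr (2 * a))) * sq_int \<mu> f)"
        using Sfin by (simp add: emeasure_eq_ennreal_measure mult_ac)
      also have "ennreal (c\<^sup>2) * ennreal (measure \<mu> S) * ennreal (\<kappa> * r powr (2 * a))
          = ennreal (c\<^sup>2 * \<kappa> * measure \<mu> S * r powr (2 * a))"
        using \<kappa>(1) by (simp add: ennreal_mult[symmetric] mult_ac)
      finally show ?thesis .
    qed
    have Y: "Y\<^sup>2 \<le> e * (ennreal (r powr (- 2 * \<beta>)) * ?M)"
    proof -
      have "Y\<^sup>2 \<le> sq_int \<mu> (U h) * sq_int \<mu> (\<lambda>x. indicator (space \<mu> - ?B) x * U f x)"
        using Cauchy_Schwarz_nn_integral[of "\<lambda>x. ennreal (norm (U h x))" \<mu> "\<lambda>x. ennreal (norm (indicator (space \<mu> - ?B) x * U f x))"]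
        unfolding Y_def sq_int_def by (simp add: ennreal_power)
      also have "\<dots> \<le> e * (ennreal (r powr (- 2 * \<beta>)) * ?M)"
        unfolding L2_transform_isometry[OF h] e_def[symmetric]
        by (intro mult_left_mono tail_sq_int_le r \<beta>) auto
      finally show ?thesis .
    qed
    let ?R = "2 * (ennreal (c\<^sup>2 * \<kappa> * measure \<mu> S * r powr (2 * a)) * sq_int \<mu> f)
        + 2 * (ennreal (r powr (- 2 * \<beta>)) * ?M)"
    have "e * e \<le> (X + Y)\<^sup>2"
      unfolding power2_eq_square using eXY by (intro mult_mono) auto
    also have "\<dots> \<le> 2 * X\<^sup>2 + 2 * Y\<^sup>2" by (rule ennreal_power2_add_le)
    also have "\<dots> \<le> 2 * (e * (ennreal (c\<^sup>2 * \<kappa> * measure \<mu> S * r powr (2 * a)) * sq_int \<mu> f))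
        + 2 * (e * (ennreal (r powr (- 2 * \<beta>)) * ?M))"
      by (intro add_mono mult_left_mono X Y) auto
    also have "\<dots> = e * ?R" by (simp add: distrib_left mult_ac)
    \<comment> \<open>One factor \<open>e\<close> is cancelled from
      \<open>e * e \<le> e * ?R\<close>: it is finite, and the case \<open>e = 0\<close> is
      trivial.\<close>
    finally have "e \<le> ?R"
      using e_fin by (cases "e = 0") (auto simp: ennreal_mult_le_mult_iff)
    also have "?R = ennreal (2 * c\<^sup>2 * \<kappa> * measure \<mu> S * r powr (2 * a)) * sq_int \<mu> f
      + ennreal (2 * r powr (- 2 * \<beta>)) * ?M"
      using \<kappa>(1) by (simp add: ennreal_mult mult_ac)
    finally show ?thesis unfolding e_def h_def .
  qed
  have pos: "2 * c\<^sup>2 * \<kappa> > 0" using c(1) \<kappa>(1) by simp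
  show ?thesis
    by (rule exI[of _ "2 * c\<^sup>2 * \<kappa>"], intro conjI allI impI pos main)
qed

text \<open>Here the weight sits on \<open>f\<close>, so \<open>f\<close> itself is cut at radius
  \<open>r\<close>. The inner part is integrable and has a bounded transform, which is integrated
  over \<open>S\<close>; the outer part is small in L2, and so is its transform.\<close>

lemma local_uncertainty_band:
  assumes s: "s > 0"
  shows "\<exists>A>0. \<forall>S f r. S \<in> sets \<mu> \<longrightarrow> emeasure \<mu> S < \<infinity> \<longrightarrow> f \<in> Lp_space 2 \<mu> \<longrightarrow> r > 0 \<longrightarrow>
    sq_int \<mu> (\<lambda>\<xi>. indicator S \<xi> * U f \<xi>) \<le> ennreal (A * measure \<mu> S * r powr (2 * a)) * sq_int \<mu> f
      + ennreal (2 * r powr (- 2 * s)) * sq_int \<mu> (\<lambda>x. (norm x powr s) *\<^sub>R f x)"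
proof -
  obtain \<kappa> where \<kappa>: "\<kappa> > 0" "\<And>r. r > 0 \<Longrightarrow> emeasure \<mu> (ball 0 r \<inter> \<Omega>) \<le> ennreal (\<kappa> * r powr (2 * a))"
    using emeasure_ball_le by blast
  obtain c where c: "c > 0" "\<And>f \<xi>. \<xi> \<in> \<Omega> \<Longrightarrow> integrable \<mu> f \<Longrightarrow>
     ennreal (norm (T f \<xi>)) \<le> ennreal c * (\<integral>\<^sup>+ x. ennreal (norm (f x)) \<partial>\<mu>)"
    using int_transform_bound by blast
  have main: "sq_int \<mu> (\<lambda>\<xi>. indicator S \<xi> * U f \<xi>) \<le> ennreal (2 * c\<^sup>2 * \<kappa> * measure \<mu> S * r powr (2 * a)) * sq_int \<mu> f
      + ennreal (2 * r powr (- 2 * s)) * sq_int \<mu> (\<lambda>x. (norm x powr s) *\<^sub>R f x)"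
    if S[measurable]: "S \<in> sets \<mu>" and Sfin: "emeasure \<mu> S < \<infinity>" and f: "f \<in> Lp_space 2 \<mu>" and r: "r > 0"
    for S f r
  proof -
    let ?B = "ball 0 r \<inter> \<Omega>"
    let ?M = "sq_int \<mu> (\<lambda>x. (norm x powr s) *\<^sub>R f x)"
    define p where "p = (\<lambda>x. indicator ?B x * f x)"
    define q where "q = (\<lambda>x. indicator (space \<mu> - ?B) x * f x)"
    have p: "p \<in> Lp_space 2 \<mu>" unfolding p_def by (rule L2_indicator[OF f]) measurable
    have q: "q \<in> Lp_space 2 \<mu>" unfolding q_def by (rule L2_indicator[OF f]) measurable
    have fm[measurable]: "f \<in> borel_measurable \<mu>" by (rule L2_measurable[OF f])
    note [measurable] = L2_measurable[OF p] L2_measurable[OF q] L2_measurable[OF L2_transform_L2[OF q]]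
    have "mixed_int \<mu> p < \<infinity>" unfolding p_def by (rule ball_truncation_mixed[OF f r])
    then have p1: "integrable \<mu> p"
      by (subst (asm) mixed_int_eq) (auto simp: integrable_iff_bounded)
    have Tp[measurable]: "T p \<in> borel_measurable \<mu>" by (rule int_transform_measurable[OF p1])
    have pn: "(\<integral>\<^sup>+ x. ennreal (norm (p x)) \<partial>\<mu>)\<^sup>2 \<le> ennreal (\<kappa> * r powr (2 * a)) * sq_int \<mu> f"
    proof -
      have "(\<integral>\<^sup>+ x. ennreal (norm (p x)) \<partial>\<mu>) = (\<integral>\<^sup>+ x. ennreal (norm (f x)) * indicator ?B x \<partial>\<mu>)"
        by (intro nn_integral_cong) (auto simp: p_def split: split_indicator)
      then have "(\<integral>\<^sup>+ x. ennreal (norm (p x)) \<partial>\<mu>)\<^sup>2 \<le> emeasure \<mu> ?B * sq_int \<mu> f"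
        using nn_integral_power2_le_sq_int[OF fm ball_Int_sets[of r]] by simp
      also have "\<dots> \<le> ennreal (\<kappa> * r powr (2 * a)) * sq_int \<mu> f"
        by (intro mult_right_mono \<kappa>(2) r) simp
      finally show ?thesis .
    qed
    have eq: "(\<lambda>x. p x + 1 * q x) x = f x" if "x \<in> space \<mu>" for x
      using that by (auto simp: p_def q_def split: split_indicator)
    \<comment> \<open>The sum of the two pieces equals \<open>f\<close> only on
      \<open>\<Omega>\<close>, and the extension is a choice depending on the whole function; the
      relation transfers the value almost everywhere.\<close>
    have "L2_rel f (U (\<lambda>x. p x + 1 * q x))"
      by (rule L2_rel_cong_AE[OF L2_rel_transform[OF L2_linear[OF p q]]]) (use eq in auto)
    then have "AE x in \<mu>. U f x = U (\<lambda>x. p x + 1 * q x) x"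
      by (rule L2_rel_unique[OF L2_rel_transform[OF f] _ fm])
    then have "AE x in \<mu>. U f x = T p x + U q x"
      using L2_transform_linear[OF p q, of 1] L2_transform_eq_int_transform[OF p1 p] by eventually_elim simp
    then have "sq_int \<mu> (\<lambda>\<xi>. indicator S \<xi> * U f \<xi>)
        = sq_int \<mu> (\<lambda>\<xi>. indicator S \<xi> * T p \<xi> + indicator S \<xi> * U q \<xi>)"
      by (intro sq_int_cong_AE) (auto simp: distrib_left)
    also have "\<dots> \<le> 2 * sq_int \<mu> (\<lambda>\<xi>. indicator S \<xi> * T p \<xi>) + 2 * sq_int \<mu> (\<lambda>\<xi>. indicator S \<xi> * U q \<xi>)"
      by (rule sq_int_add_le) measurable
    also have "\<dots> \<le> 2 * (emeasure \<mu> S * (ennreal c * (\<integral>\<^sup>+ x. ennreal (norm (p x)) \<partial>\<mu>))\<^sup>2) + 2 * sq_int \<mu> q"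
      by (intro add_mono mult_left_mono int_transform_sq_int_le c(2) p1 S
          order.trans[OF sq_int_indicator_le L2_transform_isometry[OF q, THEN eq_refl]]) auto
    also have "\<dots> \<le> 2 * (ennreal (measure \<mu> S) * (ennreal (c\<^sup>2) * (ennreal (\<kappa> * r powr (2 * a)) * sq_int \<mu> f)))
        + 2 * (ennreal (r powr (- 2 * s)) * ?M)"
      unfolding power_mult_distrib using Sfin c(1) pn tail_sq_int_le[OF fm r s]
      by (intro add_mono mult_left_mono mult_mono) (auto simp: emeasure_eq_ennreal_measure ennreal_power q_def)
    also have "\<dots> = ennreal (2 * c\<^sup>2 * \<kappa> * measure \<mu> S * r powr (2 * a)) * sq_int \<mu> f
      + ennreal (2 * r powr (- 2 * s)) * ?M"
      using \<kappa>(1) by (simp add: ennreal_mult mult_ac)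
    finally show ?thesis .
  qed
  have pos: "2 * c\<^sup>2 * \<kappa> > 0" using c(1) \<kappa>(1) by simp
  show ?thesis
    by (rule exI[of _ "2 * c\<^sup>2 * \<kappa>"], intro conjI allI impI pos main)
qed

text \<open>Square integrals are exactly additive over \<open>S\<close> and its complement, and this
  produces the factor \<open>1 - \<epsilon>^2\<close>. Finiteness of the total allows the
  complement's share to be subtracted.\<close>

lemma concentrated_sq_int_le:
  fixes g :: "'a \<Rightarrow> complex"
  assumes \<epsilon>: "0 \<le> \<epsilon>" "\<epsilon> < 1" and g: "g \<in> borel_measurable \<mu>" and S: "S \<in> sets \<mu>" and fin: "sq_int \<mu> g < \<infinity>"
    and le: "sq_int \<mu> (\<lambda>x. indicator (space \<mu> - S) x * g x) \<le> ennreal (\<epsilon>\<^sup>2) * sq_int \<mu> g"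
  shows "ennreal (1 - \<epsilon>\<^sup>2) * sq_int \<mu> g \<le> sq_int \<mu> (\<lambda>x. indicator S x * g x)"
proof -
  have "\<epsilon>\<^sup>2 \<le> 1" using \<epsilon> by (simp add: power_le_one)
  then have "ennreal (1 - \<epsilon>\<^sup>2) * sq_int \<mu> g + ennreal (\<epsilon>\<^sup>2) * sq_int \<mu> g = sq_int \<mu> g"
    by (simp add: distrib_right[symmetric] ennreal_plus[symmetric] del: ennreal_plus)
  also have "\<dots> = sq_int \<mu> (\<lambda>x. indicator S x * g x) + sq_int \<mu> (\<lambda>x. indicator (space \<mu> - S) x * g x)"
    by (rule sq_int_split[OF g S])
  also have "\<dots> \<le> sq_int \<mu> (\<lambda>x. indicator S x * g x) + ennreal (\<epsilon>\<^sup>2) * sq_int \<mu> g"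
    by (intro add_left_mono le)
  finally have "ennreal (\<epsilon>\<^sup>2) * sq_int \<mu> g + ennreal (1 - \<epsilon>\<^sup>2) * sq_int \<mu> g
      \<le> ennreal (\<epsilon>\<^sup>2) * sq_int \<mu> g + sq_int \<mu> (\<lambda>x. indicator S x * g x)"
    by (simp only: add.commute)
  moreover have "ennreal (\<epsilon>\<^sup>2) * sq_int \<mu> g < \<infinity>"
    using fin by (simp add: ennreal_mult_less_top)
  ultimately show ?thesis
    by (auto simp: ennreal_add_left_cancel_le)
qed

text \<open>Being band-limited is being concentrated on the transform side, since
  \<open>F_op\<close> has the norm of the truncated transform.\<close>

lemma bandlimited_sq_int_le:
  assumes \<epsilon>: "0 \<le> \<epsilon>" "\<epsilon> < 1" and S: "S \<in> sets \<mu>" and f: "bandlimited \<mu> K \<epsilon> S f"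
  shows "ennreal (1 - \<epsilon>\<^sup>2) * sq_int \<mu> f \<le> sq_int \<mu> (\<lambda>x. indicator S x * U f x)"
proof -
  have f2: "f \<in> Lp_space 2 \<mu>" using f by (simp add: bandlimited_def)
  have "sq_int \<mu> (F_op \<mu> K (space \<mu> - S) f) \<le> ennreal (\<epsilon>\<^sup>2) * sq_int \<mu> f"
    using f \<epsilon> by (simp add: bandlimited_def Lp_norm_2_le_iff)
  then have "sq_int \<mu> (\<lambda>x. indicator (space \<mu> - S) x * U f x) \<le> ennreal (\<epsilon>\<^sup>2) * sq_int \<mu> (U f)"
    using S by (simp add: sq_int_F_op[OF f2] L2_transform_isometry[OF f2])
  from concentrated_sq_int_le[OF \<epsilon> L2_measurable[OF L2_transform_L2[OF f2]] S _ this]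
  show ?thesis using f2 by (simp add: L2_transform_isometry Lp_space_2_iff_sq_int)
qed

end

section \<open>The uncertainty inequalities\<close>

context cone_transform
begin

lemma measure_pos:
  assumes "0 < emeasure \<mu> S" "emeasure \<mu> S < \<infinity>"
  shows "0 < measure \<mu> S"
  using assms by (simp add: measure_def enn2real_positive_iff)

lemma uncertainty_concentrated:
  assumes \<beta>: "\<beta> > 0" and \<epsilon>: "0 \<le> \<epsilon>" "\<epsilon> < 1"
  shows "\<exists>C>0. \<forall>S f. S \<in> sets \<mu> \<longrightarrow> 0 < emeasure \<mu> S \<longrightarrow> emeasure \<mu> S < \<infinity> \<longrightarrow>
    f \<in> Lp_space 2 \<mu> \<longrightarrow> concentrated \<mu> \<epsilon> S f \<longrightarrow>
    ennreal C * sq_int \<mu> f \<le> ennreal (measure \<mu> S powr (\<beta> / a)) * sq_int \<mu> (\<lambda>\<xi>. (norm \<xi> powr \<beta>) *\<^sub>R U f \<xi>)"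
proof -
  have \<eta>: "1 - \<epsilon>\<^sup>2 > 0" using \<epsilon> by (simp add: power_less_one_iff abs_square_less_1)
  obtain A where A: "A > 0" "\<And>S f r. S \<in> sets \<mu> \<Longrightarrow> emeasure \<mu> S < \<infinity> \<Longrightarrow> f \<in> Lp_space 2 \<mu> \<Longrightarrow> r > 0 \<Longrightarrow>
    sq_int \<mu> (\<lambda>x. indicator S x * f x) \<le> ennreal (A * measure \<mu> S * r powr (2 * a)) * sq_int \<mu> f
      + ennreal (2 * r powr (- 2 * \<beta>)) * sq_int \<mu> (\<lambda>\<xi>. (norm \<xi> powr \<beta>) *\<^sub>R U f \<xi>)"
    using local_uncertainty_concentration[OF \<beta>] by blast
  obtain C where C: "C > 0" "\<And>m n M. m > 0 \<Longrightarrow> n < \<infinity> \<Longrightarrow>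
    (\<And>r. r > 0 \<Longrightarrow> ennreal (1 - \<epsilon>\<^sup>2) * n \<le> ennreal (A * m * r powr (2 * a)) * n + ennreal (2 * m powr 0 * r powr (- 2 * \<beta>)) * M) \<Longrightarrow>
    ennreal C * n \<le> ennreal (m powr (0 + \<beta> / a)) * M"
    \<comment> \<open>Here \<open>B = 2\<close> and \<open>t = 0\<close>: the measure of
      \<open>S\<close> enters the local estimate only through the ball term.\<close>
    using optimise_radius[OF a_pos \<eta> A(1), of 2 0 \<beta>] by auto
  have "ennreal C * sq_int \<mu> f \<le> ennreal (measure \<mu> S powr (\<beta> / a)) * sq_int \<mu> (\<lambda>\<xi>. (norm \<xi> powr \<beta>) *\<^sub>R U f \<xi>)"
    if S: "S \<in> sets \<mu>" "0 < emeasure \<mu> S" "emeasure \<mu> S < \<infinity>" and f: "concentrated \<mu> \<epsilon> S f" for S f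
  proof -
    have m: "measure \<mu> S > 0" using S by (intro measure_pos)
    have f2: "f \<in> Lp_space 2 \<mu>" using f by (simp add: concentrated_def)
    then have fin: "sq_int \<mu> f < \<infinity>" by (simp add: Lp_space_2_iff_sq_int)
    have "ennreal (1 - \<epsilon>\<^sup>2) * sq_int \<mu> f \<le> sq_int \<mu> (\<lambda>x. indicator S x * f x)"
      using f \<epsilon> by (intro concentrated_sq_int_le S L2_measurable f2 fin)
        (simp_all add: concentrated_def Lp_norm_2_le_iff E_op_def)
    then have le: "ennreal (1 - \<epsilon>\<^sup>2) * sq_int \<mu> f \<le> ennreal (A * measure \<mu> S * r powr (2 * a)) * sq_int \<mu> f
        + ennreal (2 * measure \<mu> S powr 0 * r powr (- 2 * \<beta>)) * sq_int \<mu> (\<lambda>\<xi>. (norm \<xi> powr \<beta>) *\<^sub>R U f \<xi>)"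
      if "r > 0" for r
      using A(2)[OF S(1,3) f2 that] m by simp
    show ?thesis
      using C(2)[OF m fin le] by simp
  qed
  then show ?thesis using C(1) by blast
qed

lemma uncertainty_bandlimited:
  assumes s: "s > 0" and \<epsilon>: "0 \<le> \<epsilon>" "\<epsilon> < 1"
  shows "\<exists>C>0. \<forall>S f. S \<in> sets \<mu> \<longrightarrow> 0 < emeasure \<mu> S \<longrightarrow> emeasure \<mu> S < \<infinity> \<longrightarrow>
    f \<in> Lp_space 2 \<mu> \<longrightarrow> bandlimited \<mu> K \<epsilon> S f \<longrightarrow>
    ennreal C * sq_int \<mu> f \<le> ennreal (measure \<mu> S powr (s / a)) * sq_int \<mu> (\<lambda>x. (norm x powr s) *\<^sub>R f x)"
proof -
  have \<eta>: "1 - \<epsilon>\<^sup>2 > 0" using \<epsilon> by (simp add: power_less_one_iff abs_square_less_1)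
  obtain A where A: "A > 0" "\<And>S f r. S \<in> sets \<mu> \<Longrightarrow> emeasure \<mu> S < \<infinity> \<Longrightarrow> f \<in> Lp_space 2 \<mu> \<Longrightarrow> r > 0 \<Longrightarrow>
    sq_int \<mu> (\<lambda>x. indicator S x * U f x) \<le> ennreal (A * measure \<mu> S * r powr (2 * a)) * sq_int \<mu> f
      + ennreal (2 * r powr (- 2 * s)) * sq_int \<mu> (\<lambda>x. (norm x powr s) *\<^sub>R f x)"
    using local_uncertainty_band[OF s] by blast
  obtain C where C: "C > 0" "\<And>m n M. m > 0 \<Longrightarrow> n < \<infinity> \<Longrightarrow>
    (\<And>r. r > 0 \<Longrightarrow> ennreal (1 - \<epsilon>\<^sup>2) * n \<le> ennreal (A * m * r powr (2 * a)) * n + ennreal (2 * m powr 0 * r powr (- 2 * s)) * M) \<Longrightarrow>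
    ennreal C * n \<le> ennreal (m powr (0 + s / a)) * M"
    using optimise_radius[OF a_pos \<eta> A(1), of 2 0 s] by auto
  have "ennreal C * sq_int \<mu> f \<le> ennreal (measure \<mu> S powr (s / a)) * sq_int \<mu> (\<lambda>x. (norm x powr s) *\<^sub>R f x)"
    if S: "S \<in> sets \<mu>" "0 < emeasure \<mu> S" "emeasure \<mu> S < \<infinity>" and f: "bandlimited \<mu> K \<epsilon> S f" for S f
  proof -
    have m: "measure \<mu> S > 0" using S by (intro measure_pos)
    have f2: "f \<in> Lp_space 2 \<mu>" using f by (simp add: bandlimited_def)
    then have fin: "sq_int \<mu> f < \<infinity>" by (simp add: Lp_space_2_iff_sq_int)
    have le: "ennreal (1 - \<epsilon>\<^sup>2) * sq_int \<mu> f \<le> ennreal (A * measure \<mu> S * r powr (2 * a)) * sq_int \<mu> f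
        + ennreal (2 * measure \<mu> S powr 0 * r powr (- 2 * s)) * sq_int \<mu> (\<lambda>x. (norm x powr s) *\<^sub>R f x)"
      if "r > 0" for r
      using order.trans[OF bandlimited_sq_int_le[OF \<epsilon> S(1) f] A(2)[OF S(1,3) f2 that]] m by simp
    show ?thesis
      using C(2)[OF m fin le] by simp
  qed
  then show ?thesis using C(1) by blast
qed

text \<open>Squaring the exponent of the L1 inequalities gives the \<open>t + s / a\<close> of
  \<open>optimise_radius\<close> at \<open>t = 1\<close>.\<close>

lemma powr_half_exponent_power2:
  shows "(m powr ((a + s) / (2 * a)))\<^sup>2 = m powr (1 + s / a)"
proof -
  have "(a + s) / (2 * a) + (a + s) / (2 * a) = 1 + s / a"
    using a_pos by (simp add: divide_simps)
  then show ?thesis by (simp add: power2_eq_square powr_add[symmetric])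
qed

text \<open>Cauchy-Schwarz on \<open>S\<close> bounds the squared L1 norm by the measure of
  \<open>S\<close> times the squared L2 norm, which the isometry moves to \<open>T f\<close>. Inside
  the ball \<open>T f\<close> is at most \<open>c\<close> times the L1 norm, so that norm reappears
  on the right with a small factor and is absorbed.\<close>

lemma uncertainty_timelimited:
  assumes \<beta>: "\<beta> > 0" and \<epsilon>: "0 \<le> \<epsilon>" "\<epsilon> < 1"
  shows "\<exists>C>0. \<forall>S f. S \<in> sets \<mu> \<longrightarrow> 0 < emeasure \<mu> S \<longrightarrow> emeasure \<mu> S < \<infinity> \<longrightarrow>
    f \<in> Lp_space 1 \<mu> \<inter> Lp_space 2 \<mu> \<longrightarrow> timelimited \<mu> \<epsilon> S f \<longrightarrow>
    ennreal C * Lp_norm 1 \<mu> f \<le>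
      ennreal (measure \<mu> S powr ((a + \<beta>) / (2 * a))) * Lp_norm 2 \<mu> (\<lambda>\<xi>. (norm \<xi> powr \<beta>) *\<^sub>R T f \<xi>)"
proof -
  have \<eta>: "(1 - \<epsilon>)\<^sup>2 > 0" using \<epsilon> by simp
  obtain \<kappa> where \<kappa>: "\<kappa> > 0" "\<And>r. r > 0 \<Longrightarrow> emeasure \<mu> (ball 0 r \<inter> \<Omega>) \<le> ennreal (\<kappa> * r powr (2 * a))"
    using emeasure_ball_le by blast
  obtain c where c: "c > 0" "\<And>f \<xi>. \<xi> \<in> \<Omega> \<Longrightarrow> integrable \<mu> f \<Longrightarrow>
     ennreal (norm (T f \<xi>)) \<le> ennreal c * (\<integral>\<^sup>+ x. ennreal (norm (f x)) \<partial>\<mu>)"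
    using int_transform_bound by blast
  have A: "\<kappa> * c\<^sup>2 > 0" using c \<kappa> by simp
  obtain C where C: "C > 0" "\<And>m n M. m > 0 \<Longrightarrow> n < \<infinity> \<Longrightarrow>
    (\<And>r. r > 0 \<Longrightarrow> ennreal ((1 - \<epsilon>)\<^sup>2) * n \<le> ennreal (\<kappa> * c\<^sup>2 * m * r powr (2 * a)) * n + ennreal (1 * m powr 1 * r powr (- 2 * \<beta>)) * M) \<Longrightarrow>
    ennreal C * n \<le> ennreal (m powr (1 + \<beta> / a)) * M"
    \<comment> \<open>The Cauchy-Schwarz factor \<open>m\<close> multiplies the weighted term as
      well, hence \<open>t = 1\<close>; the quantity \<open>n\<close> will be the squared L1
      norm.\<close>
    using optimise_radius[OF a_pos \<eta> A, of 1 1 \<beta>] by auto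
  have "ennreal (sqrt C) * Lp_norm 1 \<mu> f \<le>
      ennreal (measure \<mu> S powr ((a + \<beta>) / (2 * a))) * Lp_norm 2 \<mu> (\<lambda>\<xi>. (norm \<xi> powr \<beta>) *\<^sub>R T f \<xi>)"
    if S: "S \<in> sets \<mu>" "0 < emeasure \<mu> S" "emeasure \<mu> S < \<infinity>"
      and f12: "f \<in> Lp_space 1 \<mu> \<inter> Lp_space 2 \<mu>" and f: "timelimited \<mu> \<epsilon> S f" for S f
  proof -
    define m where "m = measure \<mu> S"
    have m: "m > 0" unfolding m_def using S by (intro measure_pos)
    have Sm: "emeasure \<mu> S = ennreal m"
      using S unfolding m_def by (intro emeasure_eq_ennreal_measure) auto
    have f1: "integrable \<mu> f" and f2: "f \<in> Lp_space 2 \<mu>" using f12 by (auto simp: Lp_space_1_iff)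
    have fm[measurable]: "f \<in> borel_measurable \<mu>" by (rule L2_measurable[OF f2])
    have Tf[measurable]: "T f \<in> borel_measurable \<mu>" by (rule int_transform_measurable[OF f1])
    note [measurable] = S(1)
    define N where "N = (\<integral>\<^sup>+ x. ennreal (norm (f x)) \<partial>\<mu>)"
    let ?M = "sq_int \<mu> (\<lambda>\<xi>. (norm \<xi> powr \<beta>) *\<^sub>R T f \<xi>)"
    have N: "N < \<infinity>" using f1 by (simp add: N_def integrable_iff_bounded)
    have "ennreal (1 - \<epsilon>) * N \<le> (\<integral>\<^sup>+ x. ennreal (norm (f x)) * indicator S x \<partial>\<mu>)"
    proof -
      have "ennreal \<epsilon> * N + ennreal (1 - \<epsilon>) * N = N"
        using \<epsilon> by (simp add: distrib_right[symmetric] ennreal_plus[symmetric] del: ennreal_plus)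
      also have "N = (\<integral>\<^sup>+ x. ennreal (norm (indicator (space \<mu> - S) x * f x)) + ennreal (norm (f x)) * indicator S x \<partial>\<mu>)"
        unfolding N_def by (intro nn_integral_cong) (auto split: split_indicator)
      also have "\<dots> = (\<integral>\<^sup>+ x. ennreal (norm (indicator (space \<mu> - S) x * f x)) \<partial>\<mu>)
          + (\<integral>\<^sup>+ x. ennreal (norm (f x)) * indicator S x \<partial>\<mu>)"
        by (rule nn_integral_add) measurable
      also have "(\<integral>\<^sup>+ x. ennreal (norm (indicator (space \<mu> - S) x * f x)) \<partial>\<mu>) \<le> ennreal \<epsilon> * N"
        using f by (simp add: timelimited_def Lp_norm_1 N_def E_op_def)
      finally have "ennreal \<epsilon> * N + ennreal (1 - \<epsilon>) * N
          \<le> ennreal \<epsilon> * N + (\<integral>\<^sup>+ x. ennreal (norm (f x)) * indicator S x \<partial>\<mu>)"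
        by simp
      moreover have "ennreal \<epsilon> * N < \<infinity>" using N by (simp add: ennreal_mult_less_top)
      ultimately show ?thesis by (auto simp: ennreal_add_left_cancel_le)
    qed
    then have "(ennreal (1 - \<epsilon>) * N)\<^sup>2 \<le> (\<integral>\<^sup>+ x. ennreal (norm (f x)) * indicator S x \<partial>\<mu>)\<^sup>2"
      by (rule power_mono) simp
    also have "\<dots> \<le> ennreal m * sq_int \<mu> f"
      using nn_integral_power2_le_sq_int[OF fm S(1)] unfolding Sm .
    finally have le1: "ennreal ((1 - \<epsilon>)\<^sup>2) * N\<^sup>2 \<le> ennreal m * sq_int \<mu> f"
      using \<epsilon> by (simp add: power_mult_distrib ennreal_power)
    have "sq_int \<mu> f = sq_int \<mu> (U f)" using L2_transform_isometry[OF f2] by simp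
    also have "\<dots> = sq_int \<mu> (T f)"
      using L2_transform_eq_int_transform[OF f1 f2] by (intro sq_int_cong_AE) auto
    finally have iso: "sq_int \<mu> f = sq_int \<mu> (T f)" .
    have le: "ennreal ((1 - \<epsilon>)\<^sup>2) * N\<^sup>2 \<le> ennreal (\<kappa> * c\<^sup>2 * m * r powr (2 * a)) * N\<^sup>2
        + ennreal (1 * m powr 1 * r powr (- 2 * \<beta>)) * ?M" if r: "r > 0" for r
    proof -
      let ?B = "ball 0 r \<inter> \<Omega>"
      have "sq_int \<mu> (T f) = sq_int \<mu> (\<lambda>x. indicator ?B x * T f x) + sq_int \<mu> (\<lambda>x. indicator (space \<mu> - ?B) x * T f x)"
        by (rule sq_int_split) measurable
      also have "\<dots> \<le> emeasure \<mu> ?B * (ennreal c * N)\<^sup>2 + ennreal (r powr (- 2 * \<beta>)) * ?M"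
        by (intro add_mono int_transform_sq_int_le tail_sq_int_le Tf r \<beta> ball_Int_sets)
           (use c(2) f1 N_def in auto)
      also have "\<dots> \<le> ennreal (\<kappa> * r powr (2 * a)) * (ennreal c * N)\<^sup>2 + ennreal (r powr (- 2 * \<beta>)) * ?M"
        by (intro add_mono mult_right_mono \<kappa>(2) r) auto
      finally have "ennreal m * sq_int \<mu> f
          \<le> ennreal m * (ennreal (\<kappa> * r powr (2 * a)) * (ennreal c * N)\<^sup>2 + ennreal (r powr (- 2 * \<beta>)) * ?M)"
        unfolding iso by (rule mult_left_mono) simp
      also have "\<dots> = ennreal (\<kappa> * c\<^sup>2 * m * r powr (2 * a)) * N\<^sup>2 + ennreal (1 * m powr 1 * r powr (- 2 * \<beta>)) * ?M"
        using m \<kappa>(1) c(1)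
        by (simp add: ennreal_mult power_mult_distrib ennreal_power[symmetric] distrib_left mult_ac)
      finally show ?thesis using le1 by simp
    qed
    have "N\<^sup>2 < \<infinity>" using N by (simp add: power2_eq_square ennreal_mult_less_top)
    from C(2)[OF m this le] have "ennreal C * N\<^sup>2 \<le> ennreal (m powr (1 + \<beta> / a)) * ?M" .
    \<comment> \<open>The estimate so far concerns squares; taking roots turns the constant into
      \<open>sqrt C\<close> and halves the exponent of \<open>m\<close>.\<close>
    then have "(ennreal (sqrt C) * N)\<^sup>2
        \<le> (ennreal (m powr ((a + \<beta>) / (2 * a))) * Lp_norm 2 \<mu> (\<lambda>\<xi>. (norm \<xi> powr \<beta>) *\<^sub>R T f \<xi>))\<^sup>2"
      using C(1) m by (simp add: power_mult_distrib ennreal_power Lp_norm_2_power2 powr_half_exponent_power2)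
    then show ?thesis
      unfolding ennreal_power2_le_iff by (simp add: N_def Lp_norm_1 m_def)
  qed
  then show ?thesis using C(1) by (intro exI[of _ "sqrt C"]) auto
qed

text \<open>The bounded transform on the band controls the squared L2 norm by \<open>m\<close> times
  the squared L1 norm. The latter is split at radius \<open>r\<close>: inside, Cauchy-Schwarz over
  the ball returns the L2 norm to be absorbed; outside, the weighted L1 norm takes over.\<close>

lemma uncertainty_bandlimited_L1:
  assumes s: "s > 0" and \<epsilon>: "0 \<le> \<epsilon>" "\<epsilon> < 1"
  shows "\<exists>C>0. \<forall>S f. S \<in> sets \<mu> \<longrightarrow> 0 < emeasure \<mu> S \<longrightarrow> emeasure \<mu> S < \<infinity> \<longrightarrow>
    f \<in> Lp_space 1 \<mu> \<inter> Lp_space 2 \<mu> \<longrightarrow> bandlimited \<mu> K \<epsilon> S f \<longrightarrow>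
    ennreal C * Lp_norm 2 \<mu> f \<le>
      ennreal (measure \<mu> S powr ((a + s) / (2 * a))) * Lp_norm 1 \<mu> (\<lambda>x. (norm x powr s) *\<^sub>R f x)"
proof -
  have \<eta>: "1 - \<epsilon>\<^sup>2 > 0" using \<epsilon> by (simp add: power_less_one_iff abs_square_less_1)
  obtain \<kappa> where \<kappa>: "\<kappa> > 0" "\<And>r. r > 0 \<Longrightarrow> emeasure \<mu> (ball 0 r \<inter> \<Omega>) \<le> ennreal (\<kappa> * r powr (2 * a))"
    using emeasure_ball_le by blast
  obtain c where c: "c > 0" "\<And>f \<xi>. \<xi> \<in> \<Omega> \<Longrightarrow> integrable \<mu> f \<Longrightarrow>
     ennreal (norm (T f \<xi>)) \<le> ennreal c * (\<integral>\<^sup>+ x. ennreal (norm (f x)) \<partial>\<mu>)"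
    using int_transform_bound by blast
  have A: "2 * \<kappa> * c\<^sup>2 > 0" using c \<kappa> by simp
  have B: "2 * c\<^sup>2 > 0" using c by simp
  obtain C where C: "C > 0" "\<And>m n M. m > 0 \<Longrightarrow> n < \<infinity> \<Longrightarrow>
    (\<And>r. r > 0 \<Longrightarrow> ennreal (1 - \<epsilon>\<^sup>2) * n \<le> ennreal (2 * \<kappa> * c\<^sup>2 * m * r powr (2 * a)) * n + ennreal (2 * c\<^sup>2 * m powr 1 * r powr (- 2 * s)) * M) \<Longrightarrow>
    ennreal C * n \<le> ennreal (m powr (1 + s / a)) * M"
    \<comment> \<open>The supremum bound is integrated over the band before \<open>f\<close> is
      split, so \<open>m\<close> multiplies both terms and \<open>t = 1\<close> again.\<close>
    using optimise_radius[OF a_pos \<eta> A B, of 1 s] by auto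
  have "ennreal (sqrt C) * Lp_norm 2 \<mu> f \<le>
      ennreal (measure \<mu> S powr ((a + s) / (2 * a))) * Lp_norm 1 \<mu> (\<lambda>x. (norm x powr s) *\<^sub>R f x)"
    if S: "S \<in> sets \<mu>" "0 < emeasure \<mu> S" "emeasure \<mu> S < \<infinity>"
      and f12: "f \<in> Lp_space 1 \<mu> \<inter> Lp_space 2 \<mu>" and f: "bandlimited \<mu> K \<epsilon> S f" for S f
  proof -
    define m where "m = measure \<mu> S"
    have m: "m > 0" unfolding m_def using S by (intro measure_pos)
    have Sm: "emeasure \<mu> S = ennreal m"
      using S unfolding m_def by (intro emeasure_eq_ennreal_measure) auto
    have f1: "integrable \<mu> f" and f2: "f \<in> Lp_space 2 \<mu>" using f12 by (auto simp: Lp_space_1_iff)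
    have fm[measurable]: "f \<in> borel_measurable \<mu>" by (rule L2_measurable[OF f2])
    have fin: "sq_int \<mu> f < \<infinity>" using f2 by (simp add: Lp_space_2_iff_sq_int)
    define N where "N = (\<integral>\<^sup>+ x. ennreal (norm (f x)) \<partial>\<mu>)"
    define W where "W = Lp_norm 1 \<mu> (\<lambda>x. (norm x powr s) *\<^sub>R f x)"
    have "ennreal (1 - \<epsilon>\<^sup>2) * sq_int \<mu> f \<le> sq_int \<mu> (\<lambda>x. indicator S x * U f x)"
      by (rule bandlimited_sq_int_le[OF \<epsilon> S(1) f])
    also have "\<dots> = sq_int \<mu> (\<lambda>x. indicator S x * T f x)"
      using L2_transform_eq_int_transform[OF f1 f2] by (intro sq_int_cong_AE) auto
    also have "\<dots> \<le> ennreal m * (ennreal c * N)\<^sup>2"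
      unfolding Sm[symmetric] by (intro int_transform_sq_int_le S(1)) (use c(2) f1 N_def in auto)
    finally have le1: "ennreal (1 - \<epsilon>\<^sup>2) * sq_int \<mu> f \<le> ennreal m * (ennreal c * N)\<^sup>2" .
    have le: "ennreal (1 - \<epsilon>\<^sup>2) * sq_int \<mu> f \<le> ennreal (2 * \<kappa> * c\<^sup>2 * m * r powr (2 * a)) * sq_int \<mu> f
        + ennreal (2 * c\<^sup>2 * m powr 1 * r powr (- 2 * s)) * W\<^sup>2" if r: "r > 0" for r
    proof -
      let ?B = "ball 0 r \<inter> \<Omega>"
      let ?X = "\<integral>\<^sup>+ x. ennreal (norm (f x)) * indicator ?B x \<partial>\<mu>"
      let ?Y = "\<integral>\<^sup>+ x. ennreal (norm (f x)) * indicator (space \<mu> - ?B) x \<partial>\<mu>"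
      have "N = (\<integral>\<^sup>+ x. ennreal (norm (f x)) * indicator ?B x + ennreal (norm (f x)) * indicator (space \<mu> - ?B) x \<partial>\<mu>)"
        unfolding N_def by (intro nn_integral_cong) (auto split: split_indicator)
      also have "\<dots> = ?X + ?Y"
        by (rule nn_integral_add) measurable
      finally have "N\<^sup>2 \<le> 2 * ?X\<^sup>2 + 2 * ?Y\<^sup>2"
        using ennreal_power2_add_le by simp
      also have "\<dots> \<le> 2 * (ennreal (\<kappa> * r powr (2 * a)) * sq_int \<mu> f) + 2 * (ennreal (r powr (- s)) * W)\<^sup>2"
      proof (intro add_mono mult_left_mono power_mono)
        show "?X\<^sup>2 \<le> ennreal (\<kappa> * r powr (2 * a)) * sq_int \<mu> f"
          by (rule order.trans[OF nn_integral_power2_le_sq_int[OF fm ball_Int_sets]])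
             (intro mult_right_mono \<kappa>(2) r, simp)
        show "?Y \<le> ennreal (r powr (- s)) * W"
          using tail_nn_integral_le[OF fm r s] by (simp only: W_def Lp_norm_1)
      qed auto
      also have "(ennreal (r powr (- s)) * W)\<^sup>2 = ennreal (r powr (- 2 * s)) * W\<^sup>2"
        by (simp add: power_mult_distrib ennreal_power power2_eq_square[of "r powr _"] powr_add[symmetric])
      finally have "ennreal m * (ennreal c * N)\<^sup>2 \<le> ennreal m * (ennreal (c\<^sup>2) *
          (2 * (ennreal (\<kappa> * r powr (2 * a)) * sq_int \<mu> f) + 2 * (ennreal (r powr (- 2 * s)) * W\<^sup>2)))"
        using c(1) unfolding power_mult_distrib by (simp add: ennreal_power mult_left_mono)
      also have "\<dots> = ennreal (2 * \<kappa> * c\<^sup>2 * m * r powr (2 * a)) * sq_int \<mu> f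
          + ennreal (2 * c\<^sup>2 * m powr 1 * r powr (- 2 * s)) * W\<^sup>2"
        using m \<kappa>(1) by (simp add: ennreal_mult distrib_left mult_ac)
      finally show ?thesis using le1 by simp
    qed
    from C(2)[OF m fin le] have "ennreal C * sq_int \<mu> f \<le> ennreal (m powr (1 + s / a)) * W\<^sup>2" .
    then have "(ennreal (sqrt C) * Lp_norm 2 \<mu> f)\<^sup>2 \<le> (ennreal (m powr ((a + s) / (2 * a))) * W)\<^sup>2"
      using C(1) m by (simp add: power_mult_distrib ennreal_power Lp_norm_2_power2 powr_half_exponent_power2)
    then show ?thesis
      unfolding ennreal_power2_le_iff by (simp add: W_def m_def)
  qed
  then show ?thesis using C(1) by (intro exI[of _ "sqrt C"]) auto
qed

end

text \<open>The constant \<open>C / D\<close> does it. In the applications \<open>D\<close> is a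
  power of \<open>1 - \<epsilon>\<close> or \<open>1 - \<epsilon>^2\<close> whose base and exponent
  are fixed before the constant is chosen.\<close>

lemma ex_constant_rescale:
  fixes D :: real
  assumes "\<exists>C>0. P C" "D > 0"
  shows "\<exists>C>0. P (C * D)"
proof -
  from assms(1) obtain C where "C > 0" "P C" by blast
  with assms(2) show ?thesis by (intro exI[of _ "C / D"]) auto
qed

theorem theoremB:
  fixes \<Omega> :: "'a::euclidean_space set"
    and \<mu> :: "'a measure"
    and a :: real
    and Q :: "'a \<Rightarrow> real"
    and K :: "'a \<Rightarrow> 'a \<Rightarrow> complex"
    and \<epsilon>\<^sub>1 \<epsilon>\<^sub>2 :: real
  assumes "cone_transform \<Omega> \<mu> a Q K"
    and "0 \<le> \<epsilon>\<^sub>1" "\<epsilon>\<^sub>1 < 1" "0 \<le> \<epsilon>\<^sub>2" "\<epsilon>\<^sub>2 < 1"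
  shows
    "(\<forall>s \<beta> :: real. s > a \<and> \<beta> > a \<longrightarrow>
        (\<exists>C>0. \<forall>S f. S \<in> sets \<mu> \<longrightarrow> 0 < emeasure \<mu> S \<longrightarrow> emeasure \<mu> S < \<infinity> \<longrightarrow>
           f \<in> Lp_space 2 \<mu> \<longrightarrow> concentrated \<mu> \<epsilon>\<^sub>1 S f \<longrightarrow>
           ennreal (measure \<mu> S powr (\<beta> / a)) *
             (Lp_norm 2 \<mu> (\<lambda>\<xi>. (norm \<xi> powr \<beta>) *\<^sub>R L2_transform \<mu> K f \<xi>))\<^sup>2
           \<ge> ennreal (C * (1 - \<epsilon>\<^sub>1\<^sup>2) powr (\<beta> / a)) * (Lp_norm 2 \<mu> f)\<^sup>2) \<and>
        (\<exists>C>0. \<forall>\<Sigma> f. \<Sigma> \<in> sets \<mu> \<longrightarrow> 0 < emeasure \<mu> \<Sigma> \<longrightarrow> emeasure \<mu> \<Sigma> < \<infinity> \<longrightarrow>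
           f \<in> Lp_space 2 \<mu> \<longrightarrow> bandlimited \<mu> K \<epsilon>\<^sub>2 \<Sigma> f \<longrightarrow>
           ennreal (measure \<mu> \<Sigma> powr (s / a)) *
             (Lp_norm 2 \<mu> (\<lambda>x. (norm x powr s) *\<^sub>R f x))\<^sup>2
           \<ge> ennreal (C * (1 - \<epsilon>\<^sub>2\<^sup>2) powr (s / a)) * (Lp_norm 2 \<mu> f)\<^sup>2)) \<and>
     (\<forall>s \<beta> :: real. s > 0 \<and> \<beta> > 0 \<longrightarrow>
        (\<exists>C>0. \<forall>S f. S \<in> sets \<mu> \<longrightarrow> 0 < emeasure \<mu> S \<longrightarrow> emeasure \<mu> S < \<infinity> \<longrightarrow>
           f \<in> Lp_space 1 \<mu> \<inter> Lp_space 2 \<mu> \<longrightarrow> timelimited \<mu> \<epsilon>\<^sub>1 S f \<longrightarrow>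
           ennreal (measure \<mu> S powr ((a + \<beta>) / (2 * a))) *
             Lp_norm 2 \<mu> (\<lambda>\<xi>. (norm \<xi> powr \<beta>) *\<^sub>R int_transform \<mu> K f \<xi>)
           \<ge> ennreal (C * (1 - \<epsilon>\<^sub>1) powr ((a + \<beta>) / a)) * Lp_norm 1 \<mu> f) \<and>
        (\<exists>C>0. \<forall>\<Sigma> f. \<Sigma> \<in> sets \<mu> \<longrightarrow> 0 < emeasure \<mu> \<Sigma> \<longrightarrow> emeasure \<mu> \<Sigma> < \<infinity> \<longrightarrow>
           f \<in> Lp_space 1 \<mu> \<inter> Lp_space 2 \<mu> \<longrightarrow> bandlimited \<mu> K \<epsilon>\<^sub>2 \<Sigma> f \<longrightarrow>
           ennreal (measure \<mu> \<Sigma> powr ((a + s) / (2 * a))) *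
             Lp_norm 1 \<mu> (\<lambda>x. (norm x powr s) *\<^sub>R f x)
           \<ge> ennreal (C * (1 - \<epsilon>\<^sub>2\<^sup>2) powr ((a + s) / (2 * a))) * Lp_norm 2 \<mu> f))"
proof -
  interpret cone_transform \<Omega> \<mu> a Q K by (rule assms(1))
  have \<eta>: "0 < 1 - \<epsilon>\<^sub>1\<^sup>2" "0 < 1 - \<epsilon>\<^sub>2\<^sup>2" "0 < 1 - \<epsilon>\<^sub>1"
    using assms(2-5) by (simp_all add: power_less_one_iff abs_square_less_1)
  have 1: "\<exists>C>0. \<forall>S f. S \<in> sets \<mu> \<longrightarrow> 0 < emeasure \<mu> S \<longrightarrow> emeasure \<mu> S < \<infinity> \<longrightarrow>
      f \<in> Lp_space 2 \<mu> \<longrightarrow> concentrated \<mu> \<epsilon>\<^sub>1 S f \<longrightarrow>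
      ennreal (measure \<mu> S powr (\<beta> / a)) * (Lp_norm 2 \<mu> (\<lambda>\<xi>. (norm \<xi> powr \<beta>) *\<^sub>R U f \<xi>))\<^sup>2
      \<ge> ennreal (C * (1 - \<epsilon>\<^sub>1\<^sup>2) powr (\<beta> / a)) * (Lp_norm 2 \<mu> f)\<^sup>2" if "\<beta> > a" for \<beta>
    unfolding Lp_norm_2_power2
    by (rule ex_constant_rescale[OF uncertainty_concentrated]) (use that a_pos assms \<eta> in auto)
  have 2: "\<exists>C>0. \<forall>S f. S \<in> sets \<mu> \<longrightarrow> 0 < emeasure \<mu> S \<longrightarrow> emeasure \<mu> S < \<infinity> \<longrightarrow>
      f \<in> Lp_space 2 \<mu> \<longrightarrow> bandlimited \<mu> K \<epsilon>\<^sub>2 S f \<longrightarrow>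
      ennreal (measure \<mu> S powr (s / a)) * (Lp_norm 2 \<mu> (\<lambda>x. (norm x powr s) *\<^sub>R f x))\<^sup>2
      \<ge> ennreal (C * (1 - \<epsilon>\<^sub>2\<^sup>2) powr (s / a)) * (Lp_norm 2 \<mu> f)\<^sup>2" if "s > a" for s
    unfolding Lp_norm_2_power2
    by (rule ex_constant_rescale[OF uncertainty_bandlimited]) (use that a_pos assms \<eta> in auto)
  have 3: "\<exists>C>0. \<forall>S f. S \<in> sets \<mu> \<longrightarrow> 0 < emeasure \<mu> S \<longrightarrow> emeasure \<mu> S < \<infinity> \<longrightarrow>
      f \<in> Lp_space 1 \<mu> \<inter> Lp_space 2 \<mu> \<longrightarrow> timelimited \<mu> \<epsilon>\<^sub>1 S f \<longrightarrow>
      ennreal (measure \<mu> S powr ((a + \<beta>) / (2 * a))) * Lp_norm 2 \<mu> (\<lambda>\<xi>. (norm \<xi> powr \<beta>) *\<^sub>R T f \<xi>)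
      \<ge> ennreal (C * (1 - \<epsilon>\<^sub>1) powr ((a + \<beta>) / a)) * Lp_norm 1 \<mu> f" if "\<beta> > 0" for \<beta>
    by (rule ex_constant_rescale[OF uncertainty_timelimited]) (use that assms \<eta> in auto)
  have 4: "\<exists>C>0. \<forall>S f. S \<in> sets \<mu> \<longrightarrow> 0 < emeasure \<mu> S \<longrightarrow> emeasure \<mu> S < \<infinity> \<longrightarrow>
      f \<in> Lp_space 1 \<mu> \<inter> Lp_space 2 \<mu> \<longrightarrow> bandlimited \<mu> K \<epsilon>\<^sub>2 S f \<longrightarrow>
      ennreal (measure \<mu> S powr ((a + s) / (2 * a))) * Lp_norm 1 \<mu> (\<lambda>x. (norm x powr s) *\<^sub>R f x)
      \<ge> ennreal (C * (1 - \<epsilon>\<^sub>2\<^sup>2) powr ((a + s) / (2 * a))) * Lp_norm 2 \<mu> f" if "s > 0" for s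
    by (rule ex_constant_rescale[OF uncertainty_bandlimited_L1]) (use that assms \<eta> in auto)
  show ?thesis
    by (intro conjI allI impI; (rule 1 | rule 2 | rule 3 | rule 4); simp)
qed

end
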